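(* Let $\overline{Y}$ be a generalized solution of the Cauchy problem $\dot{\overline Y}=-\mathbb{J}_2\,\overline{\nabla_Y R}$, $\overline Y(t_0)=Y_0$, and let $\overline{\mathcal{E}}(t)=(\overline E(t),\overline E'(t))$ with $\overline E(t)=(k_0\sqrt a,\overline Y(t))$. Assume that $t_c\in T(\overline Y)$ is a crossing time and that $\mathcal{E}_c=\overline{\mathcal{E}}(t_c)$ is a non-degenerate crossing configuration with only one crossing point; let $h$ be the local minimum index with $d_h(\mathcal{E}_c)=0$ and $\overline d_h(t)=\tilde d_h(\overline{\mathcal{E}}(t))$. Then there exists an interval $(t_a,t_b)$ with $t_a<t_c<t_b$ such that $\overline d_h\in C^1((t_a,t_b);\mathbb{R})$.
   Context: Orbits and elements. Two bodies (asteroid and planet, "Earth") move on bounded (elliptic) Keplerian orbits with a common focus (the Sun) at the origin of $\mathbb{R}^3$. Let $k_0>0$ be Gauss' constant and $\mu>0$ a small parameter (ratio of the planet mass to the Sun mass). For Keplerian elements $(a,e,I,\omega,\Omega,\ell)$ (semimajor axis, eccentricity, inclination, argument of perihelion, longitude of node, mean anomaly), Delaunay's elements are $L=k_0\sqrt a$, $G=k_0\sqrt{a(1-e^2)}$, $Z=k_0\sqrt{a(1-e^2)}\cos I$, $\ell$, $g=\omega$, $z=\Omega$. Write $E=(L,G,Z,g,z)$ and $E'=(L',G',Z',g',z')$ for the elements describing the trajectories of asteroid and planet, $\mathcal{E}=(E,E')\in\mathbb{R}^{10}$ for the two-orbit configuration, $V=(\ell,\ell')$ for the mean anomalies, a point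 of the torus $\mathbb{T}^2$ (of periods $2\pi$), and $Y=(G,Z,g,z)$. Elements range over the open set where they are regular coordinates, so that the heliocentric positions $\mathcal{X}=\mathcal{X}(E,\ell)$, $\mathcal{X}'=\mathcal{X}'(E',\ell')\in\mathbb{R}^3$ are analytic. Distance. $\Delta(\mathcal{E},V)=\mathcal{X}-\mathcal{X}'$ and $d(\mathcal{E},V)=|\mathcal{X}-\mathcal{X}'|$. $\mathcal{E}$ is non-degenerate if all critical points of $V\mapsto d^2(\mathcal{E},V)$ are non-degenerate. $\mathcal{E}_c$ is a crossing configuration if $d(\mathcal{E}_c,V)=0$ for some $V$; it has only one crossing point if there is exactly one such $V$. The local minimum points of $V\mapsto d^2(\mathcal{E},V)$ are denoted $V_h(\mathcal{E})$; near a non-degenerate $\mathcal{E}_c$ they are smooth continuations of those at $\mathcal{E}_c$. Set $V_h=(\ell_h,\ell_h')$, $d_h(\mathcal{E})=d(\mathcal{E},V_h(\mathcal{E}))$, $d_{min}(\mathcal{E})=\min_h d_h(\mathcal{E})$. Let $\tau_h=\frac{\partial\mathcal{X}}{\partial\ell}(E,\ell_h)$, $\tau_h'=\frac{\partial\mathcal{X}'}{\partial\ell'}(E',\ell_h')$, $\tau_3^{(h)}=\tau_h\times\tau_h'$, $\hat\tau_3^{(h)}=\tau_3^{(h)}/|\tau_3^{(h)}|$, $\Delta_h=\Delta(\mathcal{E},V_h)$. The signed distance is $\tilde d_h=(\hat\tau_3^{(h)}\cdot\hat\Delta_h)\,d_h$ with $\hat\Delta_h=\Delta_h/|\Delta_h|$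 (and $\tilde d_h=0$ where $d_h=0$), equivalently $\tilde d_h=\hat\tau_3^{(h)}\cdot\Delta_h$; it is considered near $\mathcal{E}_c$, where $\tau_3^{(h)}\neq 0$. Averaged equations. $R=\mu k_0^2\left(\frac{1}{|\mathcal{X}-\mathcal{X}'|}-\frac{\mathcal{X}\cdot\mathcal{X}'}{|\mathcal{X}'|^3}\right)$, $\overline{\nabla_Y R}(\mathcal{E})=\frac{1}{(2\pi)^2}\int_{\mathbb{T}^2}\nabla_Y R(\mathcal{E},V)\,d\ell\,d\ell'$ (defined when $d_{min}(\mathcal{E})>0$), and $\mathbb{J}_2=\begin{pmatrix}O_2&-I_2\\ I_2&O_2\end{pmatrix}$, where $O_2,I_2$ are the $2\times2$ zero and identity matrices. Fix the asteroid's semimajor axis $a>0$ (constant in the averaged dynamics), and let $\overline E'$ be a known continuously differentiable function of time giving the evolution of the planet's trajectory (constant if only one perturbing planet is considered). In the differential equation, $\overline{\nabla_Y R}$ is evaluated at $\overline{\mathcal{E}}(t)=(\overline E(t),\overline E'(t))$, $\overline E(t)=(k_0\sqrt a,\overline Y(t))$. The initial data are $Y_0\in\mathbb{R}^4$ and $t_0$ with $d_{min}(\mathcal{E}_0)>0$, where $\mathcal{E}_0=((k_0\sqrt a,Y_0),\overline E'(t_0))$. Generalized solution. Let $\overline Y:I\to\mathbb{R}^4$ be continuous on an open interval $I$, and let $T(\overline Y)=\{t_c\in I: d_{min}(\overline{\mathcal{E}}(t_c))=0\}$ (crossing times), assumed to consist of isolated points, so that $I\setminus T(\overline Y)=\bigsqcup_{j\in\mathcal{N}}I_j$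 is a disjoint union of countably many open intervals. $\overline Y$ is a generalized solution of the averaged equations if its restriction to each $I_j$ is a classical solution and, for each $t_c\in T(\overline Y)$, the limits $\lim_{t\to t_c^+}\dot{\overline Y}(t)$ and $\lim_{t\to t_c^-}\dot{\overline Y}(t)$ exist and are finite; it is a generalized solution of the Cauchy problem if moreover $\overline Y(t_0)=Y_0$. *)

theory Defs
  imports "HOL-Analysis.Analysis"
begin

section \<open>Gradients, non-degenerate critical points, local minima\<close>

definition grad :: "(real ^ 'n \<Rightarrow> real) \<Rightarrow> real ^ 'n \<Rightarrow> real ^ 'n" where
  "grad f x = (\<chi> i. frechet_derivative f (at x) (axis i 1))"

definition nondegenerate_critical_points :: "(real ^ 'n \<Rightarrow> real) \<Rightarrow> bool" where
  "nondegenerate_critical_points f \<longleftrightarrow>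
     (\<forall>x. grad f x = 0 \<longrightarrow> det (jacobian (grad f) (at x)) \<noteq> 0)"

definition local_min_points :: "(real ^ 'n \<Rightarrow> real) \<Rightarrow> (real ^ 'n) set" where
  "local_min_points f = {x. \<forall>\<^sub>F y in nhds x. f x \<le> f y}"


section \<open>Keplerian motion\<close>

definition rot1 :: "real \<Rightarrow> real ^ 3 ^ 3" where
  "rot1 \<theta> = vector [vector [1, 0, 0],
                    vector [0, cos \<theta>, - sin \<theta>],
                    vector [0, sin \<theta>, cos \<theta>]]"

definition rot3 :: "real \<Rightarrow> real ^ 3 ^ 3" where
  "rot3 \<theta> = vector [vector [cos \<theta>, - sin \<theta>, 0],
                    vector [sin \<theta>, cos \<theta>, 0],
                    vector [0, 0, 1]]"

definition eccentric_anomaly :: "real \<Rightarrow> real \<Rightarrow> real" where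
  "eccentric_anomaly e l = (THE u. u - e * sin u = l)"

lemma kepler_equation_unique_solution:
  assumes "0 \<le> e" "e < 1"
  shows "\<exists>!u::real. u - e * sin u = l"
proof -
  let ?f = "\<lambda>u::real. u - e * sin u"
  have bound: "\<bar>e * sin u\<bar> \<le> 1" for u
    using assms by (simp add: abs_mult mult_le_one)
  have "\<exists>u. l - 1 \<le> u \<and> u \<le> l + 1 \<and> ?f u = l"
  proof (rule IVT')
    show "?f (l - 1) \<le> l" using bound[of "l - 1"] by linarith
    show "l \<le> ?f (l + 1)" using bound[of "l + 1"] by linarith
  qed (auto intro!: continuous_intros)
  moreover have "strict_mono ?f"
  proof (rule strict_monoI)
    fix x y :: real assume "x < y"
    moreover have "e * cos u < 1" for u
    proof -
      have "e * cos u \<le> e * 1"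
        using assms by (intro mult_left_mono) auto
      then show ?thesis using assms by linarith
    qed
    ultimately show "?f x < ?f y"
      by (intro DERIV_pos_imp_increasing[of x y ?f])
         (auto intro!: exI derivative_eq_intros simp: mult.commute)
  qed
  ultimately show ?thesis
    by (metis strict_mono_eq)
qed

definition kepler_position ::
  "real \<Rightarrow> real \<Rightarrow> real \<Rightarrow> real \<Rightarrow> real \<Rightarrow> real \<Rightarrow> real ^ 3" where
  "kepler_position a e i \<omega> \<Omega> l =
     (let u = eccentric_anomaly e l in
      (rot3 \<Omega> ** rot1 i ** rot3 \<omega>) *v
        vector [a * (cos u - e), a * sqrt (1 - e\<^sup>2) * sin u, 0])"


section \<open>Delaunay's elements\<close>

text \<open>
  The elements \<open>E = (L, G, Z, g, z)\<close> of an orbit are the pair \<open>(L, Y)\<close> with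
  \<open>Y = (G, Z, g, z) \<in> \<real>\<^sup>4\<close>. The node and perihelion angles, like the mean anomalies,
  are real numbers on which everything depends with period \<open>2\<pi>\<close>.
\<close>

type_synonym elements = "real \<times> (real ^ 4)"
type_synonym config = "elements \<times> elements"

definition delaunay ::
  "real \<Rightarrow> real \<Rightarrow> real \<Rightarrow> real \<Rightarrow> real \<Rightarrow> real \<Rightarrow> elements" where
  "delaunay k0 a e i \<omega> \<Omega> =
     (k0 * sqrt a,
      vector [k0 * sqrt (a * (1 - e\<^sup>2)), k0 * sqrt (a * (1 - e\<^sup>2)) * cos i, \<omega>, \<Omega>])"

text \<open>
  Elliptic orbits with \<open>0 < e < 1\<close> and \<open>0 < I < \<pi>\<close>: outside this set the perihelion or the
  node is undefined, or the orbit is rectilinear.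
\<close>

definition delaunay_domain :: "elements set" where
  "delaunay_domain = {(L, Y). 0 < Y $ 1 \<and> Y $ 1 < L \<and> \<bar>Y $ 2\<bar> < Y $ 1}"

definition position :: "real \<Rightarrow> elements \<Rightarrow> real \<Rightarrow> real ^ 3" where
  "position k0 E l =
     (case E of (L, Y) \<Rightarrow>
        kepler_position ((L / k0)\<^sup>2) (sqrt (1 - (Y $ 1 / L)\<^sup>2)) (arccos (Y $ 2 / Y $ 1))
          (Y $ 3) (Y $ 4) l)"

lemma vector4_nth [simp]:
  "(vector [w, x, y, z] :: 'a::zero ^ 4) $ 1 = w"
  "(vector [w, x, y, z] :: 'a::zero ^ 4) $ 2 = x"
  "(vector [w, x, y, z] :: 'a::zero ^ 4) $ 3 = y"
  "(vector [w, x, y, z] :: 'a::zero ^ 4) $ 4 = z"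
  unfolding vector_def by auto

lemma position_delaunay:
  assumes "0 < k0" "0 < a" "0 < e" "e < 1" "0 < i" "i < pi"
  shows "position k0 (delaunay k0 a e i \<omega> \<Omega>) l = kepler_position a e i \<omega> \<Omega> l"
proof -
  have e2: "0 < 1 - e\<^sup>2"
    using assms by (simp add: abs_square_less_1)
  have ecc: "sqrt (1 - (k0 * sqrt (a * (1 - e\<^sup>2)) / (k0 * sqrt a))\<^sup>2) = e"
    using assms e2 by (simp add: real_sqrt_mult)
  have inc: "arccos (k0 * sqrt (a * (1 - e\<^sup>2)) * cos i / (k0 * sqrt (a * (1 - e\<^sup>2)))) = i"
    using assms e2 by (simp add: arccos_cos)
  have sma: "(k0 * sqrt a / k0)\<^sup>2 = a"
    using assms by simp
  show ?thesis
    unfolding position_def delaunay_def by (simp only: prod.case vector4_nth ecc inc sma)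
qed

lemma delaunay_in_domain:
  assumes "0 < k0" "0 < a" "0 < e" "e < 1" "0 < i" "i < pi"
  shows "delaunay k0 a e i \<omega> \<Omega> \<in> delaunay_domain"
proof -
  have e2: "0 < 1 - e\<^sup>2" "1 - e\<^sup>2 < 1"
    using assms by (simp_all add: abs_square_less_1)
  have "\<bar>cos i\<bar> < 1"
    using assms cos_monotone_0_pi[of 0 i] cos_monotone_0_pi[of i pi] by auto
  then show ?thesis
    using assms e2 unfolding delaunay_domain_def delaunay_def
    by (simp add: abs_mult)
qed


section \<open>The distance function\<close>

text \<open>
  A pair of mean anomalies is a vector \<open>V = (l, l') \<in> \<real>\<^sup>2\<close>. A point of the torus has exactly one
  representative in \<open>torus\<close>.
\<close>

definition torus :: "(real ^ 2) set" where
  "torus = {V. \<forall>i. 0 \<le> V $ i \<and> V $ i < 2 * pi}"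

definition regular :: "config set" where
  "regular = Sigma delaunay_domain (\<lambda>_. delaunay_domain)"

definition Delta :: "real \<Rightarrow> config \<Rightarrow> real ^ 2 \<Rightarrow> real ^ 3" where
  "Delta k0 C V = position k0 (fst C) (V $ 1) - position k0 (snd C) (V $ 2)"

definition orbit_dist :: "real \<Rightarrow> config \<Rightarrow> real ^ 2 \<Rightarrow> real" where
  "orbit_dist k0 C V = norm (Delta k0 C V)"

definition orbit_dist2 :: "real \<Rightarrow> config \<Rightarrow> real ^ 2 \<Rightarrow> real" where
  "orbit_dist2 k0 C V = (orbit_dist k0 C V)\<^sup>2"

definition nondegenerate :: "real \<Rightarrow> config \<Rightarrow> bool" where
  "nondegenerate k0 C \<longleftrightarrow> nondegenerate_critical_points (orbit_dist2 k0 C)"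

definition crossing :: "real \<Rightarrow> config \<Rightarrow> bool" where
  "crossing k0 C \<longleftrightarrow> (\<exists>V. orbit_dist k0 C V = 0)"

definition only_one_crossing_point :: "real \<Rightarrow> config \<Rightarrow> bool" where
  "only_one_crossing_point k0 C \<longleftrightarrow> (\<exists>!V. V \<in> torus \<and> orbit_dist k0 C V = 0)"

text \<open>
  The infimum is attained: the squared distance is continuous and periodic, so it has a global
  minimum point, which is one of its local minimum points.
\<close>

definition d_min :: "real \<Rightarrow> config \<Rightarrow> real" where
  "d_min k0 C = (INF V\<in>local_min_points (orbit_dist2 k0 C). orbit_dist k0 C V)"

text \<open>
  A continuation \<open>Vh\<close> of one local minimum point over an open set \<open>U\<close> of configurations.
  Near a non-degenerate configuration a continuous choice of critical points is smooth, by the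
  implicit function theorem, and is determined by its value there. Hence continuity is all that
  has to be required.
\<close>

definition min_point_continuation ::
  "real \<Rightarrow> config set \<Rightarrow> (config \<Rightarrow> real ^ 2) \<Rightarrow> bool" where
  "min_point_continuation k0 U Vh \<longleftrightarrow>
     open U \<and> U \<subseteq> regular \<and> continuous_on U Vh \<and>
     (\<forall>C\<in>U. Vh C \<in> local_min_points (orbit_dist2 k0 C))"

definition tau3 :: "real \<Rightarrow> config \<Rightarrow> real ^ 2 \<Rightarrow> real ^ 3" where
  "tau3 k0 C V =
     cross3 (vector_derivative (position k0 (fst C)) (at (V $ 1)))
            (vector_derivative (position k0 (snd C)) (at (V $ 2)))"

text \<open>
  Here \<open>sgn v = v /\<^sub>R norm v\<close>, and the value is \<open>0\<close> where the distance vanishes.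
\<close>

definition signed_dist :: "real \<Rightarrow> (config \<Rightarrow> real ^ 2) \<Rightarrow> config \<Rightarrow> real" where
  "signed_dist k0 Vh C =
     (sgn (tau3 k0 C (Vh C)) \<bullet> sgn (Delta k0 C (Vh C))) * orbit_dist k0 C (Vh C)"

lemma signed_dist_eq: "signed_dist k0 Vh C = sgn (tau3 k0 C (Vh C)) \<bullet> Delta k0 C (Vh C)"
  by (cases "Delta k0 C (Vh C) = 0")
     (simp_all add: signed_dist_def orbit_dist_def sgn_div_norm)


section \<open>Averaged equations and generalized solutions\<close>

definition perturbing_function :: "real \<Rightarrow> real \<Rightarrow> config \<Rightarrow> real ^ 2 \<Rightarrow> real" where
  "perturbing_function k0 \<mu> C V =
     (let X = position k0 (fst C) (V $ 1); X' = position k0 (snd C) (V $ 2)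
      in \<mu> * k0\<^sup>2 * (1 / norm (X - X') - (X \<bullet> X') / norm X' ^ 3))"

definition grad_Y_R :: "real \<Rightarrow> real \<Rightarrow> config \<Rightarrow> real ^ 2 \<Rightarrow> real ^ 4" where
  "grad_Y_R k0 \<mu> C V =
     (case C of ((L, Y), E') \<Rightarrow> grad (\<lambda>Y. perturbing_function k0 \<mu> ((L, Y), E') V) Y)"

definition averaged_grad_Y_R :: "real \<Rightarrow> real \<Rightarrow> config \<Rightarrow> real ^ 4" where
  "averaged_grad_Y_R k0 \<mu> C = (1 / (2 * pi)\<^sup>2) *\<^sub>R integral torus (grad_Y_R k0 \<mu> C)"

definition J2 :: "real ^ 4 ^ 4" where
  "J2 = vector [vector [0, 0, -1, 0],
                vector [0, 0, 0, -1],
                vector [1, 0, 0, 0],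
                vector [0, 1, 0, 0]]"

definition config_at ::
  "real \<Rightarrow> real \<Rightarrow> (real \<Rightarrow> elements) \<Rightarrow> (real \<Rightarrow> real ^ 4) \<Rightarrow> real \<Rightarrow> config" where
  "config_at k0 a E' Y t = ((k0 * sqrt a, Y t), E' t)"

definition crossing_times ::
  "real \<Rightarrow> real \<Rightarrow> (real \<Rightarrow> elements) \<Rightarrow> real set \<Rightarrow> (real \<Rightarrow> real ^ 4) \<Rightarrow> real set" where
  "crossing_times k0 a E' I Y = {t\<in>I. d_min k0 (config_at k0 a E' Y t) = 0}"

definition classical_solution ::
  "real \<Rightarrow> real \<Rightarrow> real \<Rightarrow> (real \<Rightarrow> elements) \<Rightarrow> real set \<Rightarrow> (real \<Rightarrow> real ^ 4) \<Rightarrow> bool" where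
  "classical_solution k0 \<mu> a E' J Y \<longleftrightarrow>
     (\<forall>t\<in>J. (Y has_vector_derivative
                - (J2 *v averaged_grad_Y_R k0 \<mu> (config_at k0 a E' Y t))) (at t within J))"

text \<open>
  The intervals \<open>I\<^sub>j\<close> are the connected components of the complement of the crossing times.
\<close>

definition generalized_solution ::
  "real \<Rightarrow> real \<Rightarrow> real \<Rightarrow> (real \<Rightarrow> elements) \<Rightarrow> real set \<Rightarrow> (real \<Rightarrow> real ^ 4) \<Rightarrow> bool" where
  "generalized_solution k0 \<mu> a E' I Y \<longleftrightarrow>
     open I \<and> is_interval I \<and>
     continuous_on I Y \<and>
     (\<forall>t\<in>I. config_at k0 a E' Y t \<in> regular) \<and>
     discrete (crossing_times k0 a E' I Y) \<and>
     (\<forall>J\<in>components (I - crossing_times k0 a E' I Y). classical_solution k0 \<mu> a E' J Y) \<and>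
     (\<forall>tc\<in>crossing_times k0 a E' I Y.
        (\<exists>l. ((\<lambda>t. vector_derivative Y (at t)) \<longlongrightarrow> l) (at_right tc)) \<and>
        (\<exists>l. ((\<lambda>t. vector_derivative Y (at t)) \<longlongrightarrow> l) (at_left tc)))"

definition generalized_cauchy_solution ::
  "real \<Rightarrow> real \<Rightarrow> real \<Rightarrow> (real \<Rightarrow> elements) \<Rightarrow> real \<Rightarrow> real ^ 4 \<Rightarrow>
   real set \<Rightarrow> (real \<Rightarrow> real ^ 4) \<Rightarrow> bool" where
  "generalized_cauchy_solution k0 \<mu> a E' t0 Y0 I Y \<longleftrightarrow>
     generalized_solution k0 \<mu> a E' I Y \<and> t0 \<in> I \<and> Y t0 = Y0 \<and>
     d_min k0 ((k0 * sqrt a, Y0), E' t0) > 0"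

end

theory Submission
  imports Defs
begin

text \<open>
  Write \<open>n\<close> for the unit vector along \<open>\<tau>\<^sub>3\<close> at the minimum point \<open>V\<^sub>h\<close>. Since \<open>V\<^sub>h\<close> is a critical
  point of \<open>d\<^sup>2\<close>, the vector \<open>\<Delta>\<^sub>h\<close> is the signed distance times \<open>n\<close>, and by the envelope theorem
  the derivative of the signed distance with respect to the elements is \<open>n \<bullet> \<partial>\<Delta>\<close>, evaluated at \<open>V\<^sub>h\<close>
  (\<open>signed_dist_has_derivative\<close>). Let \<open>N\<close> be its \<open>Y\<close>-gradient. Off the crossing times the time
  derivative of the signed distance is therefore a term that is plainly continuous, coming from the
  planet, minus \<open>N \<bullet> J\<^sub>2 g = w \<bullet> g\<close>, where \<open>g\<close> is the averaged gradient and \<open>w = J\<^sub>2\<^sup>T N\<close>. The gradient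
  \<open>g\<close> itself may jump at a crossing, but \<open>w\<close> is orthogonal to \<open>N\<close> because \<open>J\<^sub>2\<close> is antisymmetric, and in
  that direction nothing jumps.

  Indeed \<open>n \<bullet> \<partial>\<^sub>w\<Delta> = N \<bullet> w = 0\<close> at \<open>V\<^sub>h\<close>, so there \<open>\<partial>\<^sub>w\<Delta>\<close> is a combination of the tangent vectors
  \<open>\<partial>\<Delta>/\<partial>\<ell>\<close> and \<open>\<partial>\<Delta>/\<partial>\<ell>'\<close>. Subtracting from \<open>\<partial>\<^sub>w(1/d)\<close> the same combination of \<open>\<partial>(1/d)/\<partial>\<ell>\<close> and
  \<open>\<partial>(1/d)/\<partial>\<ell>'\<close>, which has mean zero over the torus, leaves the integrand \<open>- \<Delta> \<bullet> D / d\<^sup>3\<close> with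
  \<open>D = O(|V - V\<^sub>h|)\<close> (\<open>tangent_inner_averaged_grad\<close>); the indirect part of the perturbing function is
  regular. Non-degeneracy gives \<open>d \<ge> c |V - V\<^sub>h|\<close> for \<open>V\<close> near \<open>V\<^sub>h\<close>, uniformly near the crossing
  configuration (\<open>neighbourhood_of_crossing\<close>), and uniqueness of the crossing point excludes any other
  zero of \<open>d\<close>. Hence the new integrand is bounded by \<open>M / |V - V\<^sub>h|\<close>
  (\<open>kappa_bound\<close>), which is integrable in dimension two. After a translation by \<open>V\<^sub>h\<close>, dominated
  convergence shows that \<open>w \<bullet> g\<close> extends continuously across the crossing
  (\<open>continuous_on_integral_weak_singularity\<close>). A continuous function whose derivative off one point
  extends continuously to it is continuously differentiable.
\<close>



section \<open>Continuously differentiable maps on open sets\<close>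

text \<open>
  Continuity of the derivative is required in each fixed direction. The domain being
  finite-dimensional, this is the same as continuity in the operator norm.
\<close>

definition C1_on :: "('a::euclidean_space \<Rightarrow> 'b::euclidean_space) \<Rightarrow> 'a set \<Rightarrow> bool" where
  "C1_on f D \<longleftrightarrow> (\<forall>x\<in>D. f differentiable (at x)) \<and>
     (\<forall>v. continuous_on D (\<lambda>x. frechet_derivative f (at x) v))"

abbreviation fderiv :: "('a::euclidean_space \<Rightarrow> 'b::euclidean_space) \<Rightarrow> 'a \<Rightarrow> 'a \<Rightarrow> 'b" where
  "fderiv f x \<equiv> frechet_derivative f (at x)"

lemma fderiv_eqI: "(f has_derivative f') (at x) \<Longrightarrow> fderiv f x = f'"
  by (metis frechet_derivative_at)

lemma C1_onI:
  assumes "\<And>x. x \<in> D \<Longrightarrow> (f has_derivative f' x) (at x)"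
    and "\<And>v. continuous_on D (\<lambda>x. f' x v)"
  shows "C1_on f D"
proof -
  have "continuous_on D (\<lambda>x. fderiv f x v)" for v
    using assms(2)[of v] by (rule continuous_on_eq) (simp add: fderiv_eqI[OF assms(1)])
  then show ?thesis
    using assms(1) unfolding C1_on_def by (auto intro: differentiableI)
qed

lemma C1_on_has_derivative:
  "C1_on f D \<Longrightarrow> x \<in> D \<Longrightarrow> (f has_derivative fderiv f x) (at x)"
  unfolding C1_on_def by (simp add: frechet_derivative_works)

lemma C1_on_imp_continuous_on: "C1_on f D \<Longrightarrow> continuous_on D f"
  by (meson C1_on_has_derivative continuous_at_imp_continuous_on has_derivative_continuous)

lemma C1_on_linear_fderiv: "C1_on f D \<Longrightarrow> x \<in> D \<Longrightarrow> linear (fderiv f x)"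
  using C1_on_has_derivative has_derivative_linear by blast

lemma C1_on_subset: "C1_on f D \<Longrightarrow> S \<subseteq> D \<Longrightarrow> C1_on f S"
  unfolding C1_on_def by (meson continuous_on_subset subsetD)

lemma C1_on_continuous_on_fderiv: "C1_on f D \<Longrightarrow> continuous_on D (\<lambda>x. fderiv f x v)"
  unfolding C1_on_def by blast

lemma continuous_on_fderiv:
  assumes "C1_on f D" "continuous_on S g" "continuous_on S h" "g ` S \<subseteq> D"
  shows "continuous_on S (\<lambda>s. fderiv f (g s) (h s))"
proof -
  have "fderiv f (g s) (h s) = (\<Sum>b\<in>Basis. (h s \<bullet> b) *\<^sub>R fderiv f (g s) b)" if "s \<in> S" for s
  proof -
    interpret linear "fderiv f (g s)"
      using assms that by (intro C1_on_linear_fderiv) auto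
    have "fderiv f (g s) (h s) = fderiv f (g s) (\<Sum>b\<in>Basis. (h s \<bullet> b) *\<^sub>R b)"
      by (simp add: euclidean_representation)
    then show ?thesis by (simp add: sum scale)
  qed
  moreover have "continuous_on S (\<lambda>s. \<Sum>b\<in>Basis. (h s \<bullet> b) *\<^sub>R fderiv f (g s) b)"
    using assms
    by (intro continuous_on_sum continuous_on_scaleR continuous_on_inner continuous_on_const
        continuous_on_compose2[OF C1_on_continuous_on_fderiv, of f D S g]) auto
  ultimately show ?thesis
    by (simp cong: continuous_on_cong)
qed

lemma C1_on_cong:
  assumes "open D" "\<And>x. x \<in> D \<Longrightarrow> f x = g x" "C1_on f D"
  shows "C1_on g D"
proof (rule C1_onI[where f' = "fderiv f"])
  show "(g has_derivative fderiv f x) (at x)" if "x \<in> D" for x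
    using C1_on_has_derivative[OF assms(3) that] assms(1) that
    by (rule has_derivative_transform_within_open) (simp add: assms(2))
  show "continuous_on D (\<lambda>x. fderiv f x v)" for v
    using assms(3) unfolding C1_on_def by blast
qed

lemma C1_on_compose:
  assumes "C1_on g T" "C1_on f D" "\<And>x. x \<in> D \<Longrightarrow> f x \<in> T"
  shows "C1_on (\<lambda>x. g (f x)) D"
proof (rule C1_onI[where f' = "\<lambda>x v. fderiv g (f x) (fderiv f x v)"])
  show "((\<lambda>x. g (f x)) has_derivative (\<lambda>v. fderiv g (f x) (fderiv f x v))) (at x)"
    if "x \<in> D" for x
    using has_derivative_compose[OF C1_on_has_derivative[OF assms(2) that]
        C1_on_has_derivative[OF assms(1) assms(3)[OF that]]] .
  show "continuous_on D (\<lambda>x. fderiv g (f x) (fderiv f x v))" for v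
    using assms C1_on_imp_continuous_on[OF assms(2)]
    by (intro continuous_on_fderiv[OF assms(1)]) (auto simp: C1_on_def)
qed

lemma C1_on_const: "C1_on (\<lambda>x. c) D"
  by (rule C1_onI[where f' = "\<lambda>x v. 0"]) auto

lemma C1_on_bounded_linear: "bounded_linear f \<Longrightarrow> C1_on f D"
  by (rule C1_onI[where f' = "\<lambda>x. f"]) (auto intro: bounded_linear_imp_has_derivative)

lemma C1_on_add: "C1_on f D \<Longrightarrow> C1_on g D \<Longrightarrow> C1_on (\<lambda>x. f x + g x) D"
  by (rule C1_onI[where f' = "\<lambda>x v. fderiv f x v + fderiv g x v"])
    (simp_all add: C1_on_has_derivative has_derivative_add C1_on_continuous_on_fderiv continuous_on_add)

lemma C1_on_diff: "C1_on f D \<Longrightarrow> C1_on g D \<Longrightarrow> C1_on (\<lambda>x. f x - g x) D"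
  by (rule C1_onI[where f' = "\<lambda>x v. fderiv f x v - fderiv g x v"])
    (simp_all add: C1_on_has_derivative has_derivative_diff C1_on_continuous_on_fderiv continuous_on_diff)

lemma C1_on_Pair: "C1_on f D \<Longrightarrow> C1_on g D \<Longrightarrow> C1_on (\<lambda>x. (f x, g x)) D"
  by (rule C1_onI[where f' = "\<lambda>x v. (fderiv f x v, fderiv g x v)"])
    (simp_all add: C1_on_has_derivative has_derivative_Pair C1_on_continuous_on_fderiv continuous_on_Pair)

lemma C1_on_bilinear:
  assumes "bounded_bilinear h" "C1_on f D" "C1_on g D"
  shows "C1_on (\<lambda>x. h (f x) (g x)) D"
proof (rule C1_onI[where f' = "\<lambda>x v. h (f x) (fderiv g x v) + h (fderiv f x v) (g x)"])
  show "((\<lambda>x. h (f x) (g x)) has_derivative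
           (\<lambda>v. h (f x) (fderiv g x v) + h (fderiv f x v) (g x))) (at x)" if "x \<in> D" for x
    by (rule bounded_bilinear.FDERIV[OF assms(1)]) (use that assms C1_on_has_derivative in blast)+
  show "continuous_on D (\<lambda>x. h (f x) (fderiv g x v) + h (fderiv f x v) (g x))" for v
    using assms(2,3) C1_on_imp_continuous_on[OF assms(2)] C1_on_imp_continuous_on[OF assms(3)]
    by (intro continuous_on_add bounded_bilinear.continuous_on[OF assms(1)]) (auto simp: C1_on_def)
qed

lemmas C1_on_mult = C1_on_bilinear[OF bounded_bilinear_mult]
lemmas C1_on_scaleR = C1_on_bilinear[OF bounded_bilinear_scaleR]
lemmas C1_on_inner = C1_on_bilinear[OF bounded_bilinear_inner]

lemma C1_on_minus: "C1_on f D \<Longrightarrow> C1_on (\<lambda>x. - f x) D"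
  using C1_on_diff[OF C1_on_const[of 0]] by simp

lemma C1_on_power2: "C1_on f D \<Longrightarrow> C1_on (\<lambda>x. (f x)\<^sup>2 :: real) D"
  unfolding power2_eq_square by (rule C1_on_mult)

lemma C1_on_real:
  fixes h :: "real \<Rightarrow> real"
  assumes "\<And>y. y \<in> T \<Longrightarrow> (h has_real_derivative h' y) (at y)" "continuous_on T h'"
  shows "C1_on h T"
  using assms
  by (intro C1_onI[where f' = "\<lambda>x v. h' x * v"])
    (auto simp: has_field_derivative_def intro!: continuous_intros)

lemma C1_on_sin: "C1_on (f :: _ \<Rightarrow> real) D \<Longrightarrow> C1_on (\<lambda>x. sin (f x)) D"
  by (rule C1_on_compose[OF C1_on_real[of UNIV sin cos]]) (simp_all add: DERIV_sin continuous_on_cos)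

lemma C1_on_cos: "C1_on (f :: _ \<Rightarrow> real) D \<Longrightarrow> C1_on (\<lambda>x. cos (f x)) D"
  by (rule C1_on_compose[OF C1_on_real[of UNIV cos "\<lambda>x. - sin x"]])
    (simp_all add: DERIV_cos continuous_on_minus continuous_on_sin)

lemma C1_on_sqrt:
  assumes "C1_on f D" "\<And>x. x \<in> D \<Longrightarrow> 0 < f x"
  shows "C1_on (\<lambda>x. sqrt (f x)) D"
proof (rule C1_on_compose[OF C1_on_real[of "{0<..}" sqrt "\<lambda>x. inverse (sqrt x) / 2"] assms(1)])
  show "continuous_on {0<..} (\<lambda>x. inverse (sqrt x) / 2)"
    by (intro continuous_intros) auto
qed (simp_all add: DERIV_real_sqrt assms)

lemma C1_on_inverse:
  fixes f :: "'a::euclidean_space \<Rightarrow> real"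
  assumes "C1_on f D" "\<And>x. x \<in> D \<Longrightarrow> f x \<noteq> 0"
  shows "C1_on (\<lambda>x. inverse (f x)) D"
proof (rule C1_on_compose[OF C1_on_real[of "- {0}" inverse "\<lambda>x. - (inverse x ^ Suc (Suc 0))"] assms(1)])
  show "continuous_on (- {0::real}) (\<lambda>x. - (inverse x ^ Suc (Suc 0)))"
    by (intro continuous_intros) auto
  show "(inverse has_real_derivative - (inverse y ^ Suc (Suc 0))) (at y)" if "y \<in> - {0}" for y :: real
    using that by (intro DERIV_inverse) auto
qed (simp add: assms)

lemma C1_on_divide:
  "C1_on f D \<Longrightarrow> C1_on g D \<Longrightarrow> (\<And>x. x \<in> D \<Longrightarrow> g x \<noteq> 0) \<Longrightarrow> C1_on (\<lambda>x. f x / g x :: real) D"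
  unfolding divide_inverse by (simp add: C1_on_mult C1_on_inverse)

lemmas C1_on_fst = C1_on_compose[OF C1_on_bounded_linear[OF bounded_linear_fst] _ UNIV_I]
lemmas C1_on_snd = C1_on_compose[OF C1_on_bounded_linear[OF bounded_linear_snd] _ UNIV_I]
lemmas C1_on_nth = C1_on_compose[OF C1_on_bounded_linear[OF bounded_linear_vec_nth] _ UNIV_I]

lemma C1_on_id: "C1_on (\<lambda>x. x) D"
  by (simp add: C1_on_bounded_linear bounded_linear_ident)

lemma vector3_eq_sum:
  "(vector [x, y, z] :: real ^ 3) = x *\<^sub>R axis 1 1 + y *\<^sub>R axis 2 1 + z *\<^sub>R axis 3 1"
  by (simp add: vec_eq_iff forall_3 axis_def)

lemma C1_on_vector3:
  "C1_on f D \<Longrightarrow> C1_on g D \<Longrightarrow> C1_on h D \<Longrightarrow> C1_on (\<lambda>x. vector [f x, g x, h x] :: real ^ 3) D"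
  by (simp add: vector3_eq_sum C1_on_add C1_on_scaleR C1_on_const)

text \<open>
  A continuously differentiable map is strictly differentiable: the linearization at a point
  is uniformly good for all pairs of nearby points.
\<close>

lemma C1_on_strict:
  assumes "C1_on f D" "open D" "x0 \<in> D" "0 < \<epsilon>"
  obtains \<delta> where "0 < \<delta>" "ball x0 \<delta> \<subseteq> D"
    "\<And>x y. x \<in> ball x0 \<delta> \<Longrightarrow> y \<in> ball x0 \<delta> \<Longrightarrow>
       norm (f y - f x - fderiv f x0 (y - x)) \<le> \<epsilon> * norm (y - x)"
proof -
  define S where "S x = (\<Sum>b\<in>Basis. norm (fderiv f x b - fderiv f x0 b))" for x
  have "continuous_on D S"
    unfolding S_def using assms(1)
    by (intro continuous_on_sum continuous_on_norm continuous_on_diff continuous_on_const)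
       (simp add: C1_on_def)
  then have "isCont S x0"
    using assms continuous_on_eq_continuous_at by blast
  then have "(S \<longlongrightarrow> S x0) (nhds x0)"
    by (simp add: isCont_def tendsto_at_iff_tendsto_nhds)
  moreover have "S x0 = 0" by (simp add: S_def)
  ultimately have "\<forall>\<^sub>F x in nhds x0. S x < \<epsilon>"
    using assms(4) by (auto intro: order_tendstoD(2))
  moreover have "\<forall>\<^sub>F x in nhds x0. x \<in> D"
    using assms by (simp add: eventually_nhds_in_open)
  ultimately have "\<forall>\<^sub>F x in nhds x0. x \<in> D \<and> S x < \<epsilon>"
    by eventually_elim auto
  then obtain \<delta> where \<delta>: "0 < \<delta>" "\<And>x. dist x x0 < \<delta> \<Longrightarrow> x \<in> D \<and> S x < \<epsilon>"
    unfolding eventually_nhds_metric by blast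
  have sub: "ball x0 \<delta> \<subseteq> D" using \<delta> by (auto simp: dist_commute)
  have "norm (f y - f x - fderiv f x0 (y - x)) \<le> \<epsilon> * norm (y - x)"
    if xy: "x \<in> ball x0 \<delta>" "y \<in> ball x0 \<delta>" for x y
  proof -
    have "norm (f y - f x - fderiv f x0 (y - x)) \<le> norm (y - x) * \<epsilon>"
    proof (rule differentiable_bound_linearization[where S = "ball x0 \<delta>" and f' = "fderiv f"])
      show "x + t *\<^sub>R (y - x) \<in> ball x0 \<delta>" if "t \<in> {0..1}" for t
        using convexD_alt[OF convex_ball xy, of t] that by (simp add: algebra_simps)
      show "(f has_derivative fderiv f z) (at z within ball x0 \<delta>)" if "z \<in> ball x0 \<delta>" for z
        using that sub C1_on_has_derivative[OF assms(1)] has_derivative_at_withinI by blast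
      show "x0 \<in> ball x0 \<delta>" using \<delta> by simp
      show "onorm (fderiv f z - fderiv f x0) \<le> \<epsilon>" if "z \<in> ball x0 \<delta>" for z
      proof -
        have lin: "linear (fderiv f z)" "linear (fderiv f x0)"
          using that sub assms C1_on_linear_fderiv by blast+
        have "norm ((fderiv f z - fderiv f x0) v) \<le> S z * norm v" for v
        proof -
          interpret linear "fderiv f z - fderiv f x0"
            using lin linear_compose_sub[of "fderiv f z" "fderiv f x0"] by (simp add: fun_diff_def)
          have "(fderiv f z - fderiv f x0) v
              = (fderiv f z - fderiv f x0) (\<Sum>b\<in>Basis. (v \<bullet> b) *\<^sub>R b)"
            by (simp add: euclidean_representation)
          also have "\<dots> = (\<Sum>b\<in>Basis. (v \<bullet> b) *\<^sub>R (fderiv f z - fderiv f x0) b)"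
            unfolding sum scale ..
          also have "norm \<dots> \<le> (\<Sum>b\<in>Basis. \<bar>v \<bullet> b\<bar> * norm (fderiv f z b - fderiv f x0 b))"
            by (rule order_trans[OF norm_sum]) simp
          also have "\<dots> \<le> (\<Sum>b\<in>Basis. norm v * norm (fderiv f z b - fderiv f x0 b))"
            by (intro sum_mono mult_right_mono) (auto simp: Basis_le_norm)
          finally show ?thesis
            by (simp add: S_def sum_distrib_left mult.commute)
        qed
        then have "onorm (fderiv f z - fderiv f x0) \<le> S z"
          by (intro onorm_le) auto
        moreover have "S z < \<epsilon>" using \<delta>(2)[of z] that by (simp add: dist_commute)
        ultimately show ?thesis by simp
      qed
    qed
    then show ?thesis by (simp add: mult.commute)
  qed
  then show thesis by (rule that[OF \<delta>(1) sub])
qed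

lemma C1_on_locally_lipschitz:
  assumes "C1_on f D" "open D" "x0 \<in> D"
  obtains \<delta> K where "0 < \<delta>" "0 < K" "ball x0 \<delta> \<subseteq> D"
    "\<And>x y. x \<in> ball x0 \<delta> \<Longrightarrow> y \<in> ball x0 \<delta> \<Longrightarrow> norm (f y - f x) \<le> K * norm (y - x)"
proof -
  obtain \<delta> where \<delta>: "0 < \<delta>" "ball x0 \<delta> \<subseteq> D"
    "\<And>x y. x \<in> ball x0 \<delta> \<Longrightarrow> y \<in> ball x0 \<delta> \<Longrightarrow>
       norm (f y - f x - fderiv f x0 (y - x)) \<le> 1 * norm (y - x)"
    by (rule C1_on_strict[OF assms zero_less_one]) (rule that)
  obtain B where B: "0 < B" "\<And>v. norm (fderiv f x0 v) \<le> B * norm v"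
    using linear_bounded_pos[OF C1_on_linear_fderiv[OF assms(1,3)]] by blast
  have "norm (f y - f x) \<le> (B + 1) * norm (y - x)" if "x \<in> ball x0 \<delta>" "y \<in> ball x0 \<delta>" for x y
    using \<delta>(3)[OF that] B(2)[of "y - x"] norm_triangle_ineq2[of "f y - f x" "fderiv f x0 (y - x)"]
    by (simp add: algebra_simps)
  moreover have "0 < B + 1" using B by simp
  ultimately show thesis using that[OF \<delta>(1) _ \<delta>(2)] by blast
qed


section \<open>Regularity of Keplerian motion\<close>

subsection \<open>Kepler's equation\<close>

lemma eccentric_anomaly_eq:
  assumes "0 \<le> e" "e < 1"
  shows "eccentric_anomaly e l - e * sin (eccentric_anomaly e l) = l"
  unfolding eccentric_anomaly_def by (rule theI'[OF kepler_equation_unique_solution[OF assms]])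

lemma eccentric_anomaly_eqI:
  assumes "0 \<le> e" "e < 1" "u - e * sin u = l"
  shows "eccentric_anomaly e l = u"
  using kepler_equation_unique_solution[OF assms(1,2)] eccentric_anomaly_eq[OF assms(1,2)] assms(3)
  by blast

lemma eccentric_anomaly_add_2pi:
  assumes "0 \<le> e" "e < 1"
  shows "eccentric_anomaly e (l + 2 * pi) = eccentric_anomaly e l + 2 * pi"
  using eccentric_anomaly_eq[OF assms, of l] by (intro eccentric_anomaly_eqI assms) auto

lemma kepler_derivative_pos:
  assumes "0 \<le> e" "e < 1"
  shows "0 < 1 - e * cos (u::real)"
proof -
  have "e * cos u \<le> e * 1" using assms by (intro mult_left_mono) auto
  then show ?thesis using assms by linarith
qed

lemma abs_sin_diff_le: "\<bar>sin x - sin y\<bar> \<le> \<bar>x - (y::real)\<bar>"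
proof -
  have "norm (sin x - sin y) \<le> 1 * norm (x - y)"
    by (rule differentiable_bound[where S = UNIV and f' = "\<lambda>x v. cos x * v"])
      (auto intro!: onorm_le simp: has_field_derivative_def[symmetric] abs_mult
         simp: mult_left_le_one_le intro: DERIV_sin[THEN DERIV_subset])
  then show ?thesis by simp
qed

lemma eccentric_anomaly_lipschitz:
  assumes "0 \<le> e" "e < 1" "0 \<le> e'" "e' < 1"
  shows "(1 - e') * \<bar>eccentric_anomaly e' l' - eccentric_anomaly e l\<bar> \<le> \<bar>l' - l\<bar> + \<bar>e' - e\<bar>"
proof -
  define u u' where "u = eccentric_anomaly e l" and "u' = eccentric_anomaly e' l'"
  have "u - e * sin u = l" "u' - e' * sin u' = l'"
    using assms by (simp_all add: u_def u'_def eccentric_anomaly_eq)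
  then have "u' - u = (l' - l) + e' * (sin u' - sin u) + (e' - e) * sin u"
    by (simp add: algebra_simps)
  moreover have "\<bar>e' * (sin u' - sin u)\<bar> \<le> e' * \<bar>u' - u\<bar>"
    using abs_sin_diff_le[of u' u] assms by (simp add: abs_mult mult_left_mono)
  moreover have "\<bar>(e' - e) * sin u\<bar> \<le> \<bar>e' - e\<bar>"
    by (simp add: abs_mult mult_left_le)
  ultimately show ?thesis unfolding u_def[symmetric] u'_def[symmetric]
    by (simp add: algebra_simps)
qed

text \<open>
  The inverse of \<open>(e, u) \<mapsto> (e, u - e sin u)\<close> is \<open>(e, l) \<mapsto> (e, u)\<close> with \<open>u\<close> the eccentric anomaly.
\<close>

lemma C1_on_eccentric_anomaly: "C1_on (\<lambda>(e, l). eccentric_anomaly e l) ({0<..<1} \<times> UNIV)"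
proof -
  let ?D = "{0<..<1::real} \<times> (UNIV :: real set)"
  let ?u = "\<lambda>x. eccentric_anomaly (fst x) (snd x)"
  let ?f = "\<lambda>(e, u). (e, u - e * sin u) :: real \<times> real"
  let ?g = "\<lambda>x. (fst x, ?u x)"
  let ?g' = "\<lambda>x v. (fst v, (sin (?u x) * fst v + snd v) / (1 - fst x * cos (?u x)))"
  have cont: "isCont ?u x" if "x \<in> ?D" for x
  proof -
    have "\<forall>\<^sub>F y in at x. y \<in> ?D"
      using that by (intro eventually_at_in_open') (auto intro: open_Times)
    then have bound: "\<forall>\<^sub>F y in at x.
        norm (?u y - ?u x) \<le> (\<bar>snd y - snd x\<bar> + \<bar>fst y - fst x\<bar>) / (1 - fst y)"
    proof eventually_elim
      case (elim y)
      then show ?case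
        using eccentric_anomaly_lipschitz[of "fst x" "fst y" "snd y" "snd x"] that
        by (auto simp: field_simps mem_Times_iff)
    qed
    have "((\<lambda>y. (\<bar>snd y - snd x\<bar> + \<bar>fst y - fst x\<bar>) / (1 - fst y)) \<longlongrightarrow>
        (\<bar>snd x - snd x\<bar> + \<bar>fst x - fst x\<bar>) / (1 - fst x)) (at x)"
      using that by (intro tendsto_intros) (auto simp: mem_Times_iff)
    then have "((\<lambda>y. (\<bar>snd y - snd x\<bar> + \<bar>fst y - fst x\<bar>) / (1 - fst y)) \<longlongrightarrow> 0) (at x)"
      by simp
    then have "((\<lambda>y. ?u y - ?u x) \<longlongrightarrow> 0) (at x)"
      by (rule Lim_null_comparison[OF bound])
    then show ?thesis by (simp add: isCont_def LIM_zero_iff)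
  qed
  have deriv: "(?g has_derivative ?g' x) (at x)" if x: "x \<in> ?D" for x
  proof (rule has_derivative_inverse_basic[where f = ?f and T = ?D])
    have pos: "0 < 1 - fst x * cos (?u x)"
      using x by (intro kepler_derivative_pos) (auto simp: mem_Times_iff)
    let ?f' = "\<lambda>v. (fst v, snd v - (fst x * (snd v * cos (?u x)) + fst v * sin (?u x)))"
    show "(?f has_derivative ?f') (at (?g x))"
      unfolding case_prod_unfold by (auto intro!: derivative_eq_intros)
    show "?g' x \<circ> ?f' = id"
      using pos by (auto simp: fun_eq_iff field_simps)
    show "bounded_linear (?g' x)"
      by (intro bounded_linear_Pair bounded_linear_fst bounded_linear_add
          bounded_linear_compose[OF bounded_linear_divide]
          bounded_linear_compose[OF bounded_linear_mult_right] bounded_linear_snd)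
    show "continuous (at x) ?g"
      using cont[OF x] by (intro continuous_intros) auto
    show "open ?D" by (intro open_Times) auto
    show "?f (?g z) = z" if "z \<in> ?D" for z
      using that by (cases z) (simp add: eccentric_anomaly_eq)
  qed (use x in auto)
  have "C1_on ?u ?D"
  proof (rule C1_onI)
    show "(?u has_derivative (\<lambda>v. (sin (?u x) * fst v + snd v) / (1 - fst x * cos (?u x)))) (at x)"
      if "x \<in> ?D" for x
      using has_derivative_snd[OF deriv[OF that]] by simp
    have "continuous_on ?D ?u"
      using cont continuous_at_imp_continuous_on by blast
    moreover have "1 - fst x * cos (?u x) \<noteq> 0" if "x \<in> ?D" for x
      using kepler_derivative_pos[of "fst x" "?u x"] that by (auto simp: mem_Times_iff)
    ultimately show "continuous_on ?D
        (\<lambda>x. (sin (?u x) * fst v + snd v) / (1 - fst x * cos (?u x)))" for v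
      by (intro continuous_intros) auto
  qed
  then show ?thesis by (simp add: case_prod_unfold)
qed

subsection \<open>Position and velocity as functions of the elements\<close>

text \<open>The eccentricity \<open>\<surd>(1 - (G/L)\<^sup>2)\<close>.\<close>

definition ecc :: "elements \<Rightarrow> real" where
  "ecc E = sqrt (1 - (snd E $ 1 / fst E)\<^sup>2)"

text \<open>
  The position is \<open>(cos u - e) P + (sin u) Q\<close>, where \<open>u\<close> is the eccentric anomaly and
  \<open>P\<close>, \<open>Q\<close> are the semiaxes of the ellipse, \<open>P\<close> pointing to the perihelion. The cosine and sine of
  the inclination are written as \<open>Z/G\<close> and \<open>\<surd>(1 - (Z/G)\<^sup>2)\<close>, which keeps the arc cosine out of the
  smoothness proofs.
\<close>

definition axisP :: "real \<Rightarrow> elements \<Rightarrow> real ^ 3" where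
  "axisP k0 E = (let c = snd E $ 2 / snd E $ 1; s = sqrt (1 - (snd E $ 2 / snd E $ 1)\<^sup>2);
       \<omega> = snd E $ 3; \<Omega> = snd E $ 4 in
     (fst E / k0)\<^sup>2 *\<^sub>R vector [cos \<Omega> * cos \<omega> - sin \<Omega> * c * sin \<omega>,
        sin \<Omega> * cos \<omega> + cos \<Omega> * c * sin \<omega>, s * sin \<omega>])"

definition axisQ :: "real \<Rightarrow> elements \<Rightarrow> real ^ 3" where
  "axisQ k0 E = (let c = snd E $ 2 / snd E $ 1; s = sqrt (1 - (snd E $ 2 / snd E $ 1)\<^sup>2);
       \<omega> = snd E $ 3; \<Omega> = snd E $ 4 in
     ((fst E / k0)\<^sup>2 * (snd E $ 1 / fst E)) *\<^sub>R vector [- cos \<Omega> * sin \<omega> - sin \<Omega> * c * cos \<omega>,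
        - sin \<Omega> * sin \<omega> + cos \<Omega> * c * cos \<omega>, s * cos \<omega>])"

text \<open>The eccentric anomaly as a function of the elements and the mean anomaly.\<close>

definition anomaly :: "elements \<times> real \<Rightarrow> real" where
  "anomaly x = eccentric_anomaly (ecc (fst x)) (snd x)"

text \<open>The derivative of the position with respect to the mean anomaly, in closed form.\<close>

definition velocity :: "real \<Rightarrow> elements \<times> real \<Rightarrow> real ^ 3" where
  "velocity k0 x = (1 / (1 - ecc (fst x) * cos (anomaly x))) *\<^sub>R
     (cos (anomaly x) *\<^sub>R axisQ k0 (fst x) - sin (anomaly x) *\<^sub>R axisP k0 (fst x))"

abbreviation pos :: "real \<Rightarrow> elements \<times> real \<Rightarrow> real ^ 3" where
  "pos k0 x \<equiv> position k0 (fst x) (snd x)"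

abbreviation kepler_domain :: "(elements \<times> real) set" where
  "kepler_domain \<equiv> delaunay_domain \<times> UNIV"

lemma delaunay_domain_iff:
  "E \<in> delaunay_domain \<longleftrightarrow> 0 < snd E $ 1 \<and> snd E $ 1 < fst E \<and> \<bar>snd E $ 2\<bar> < snd E $ 1"
  by (cases E) (simp add: delaunay_domain_def)

lemma open_delaunay_domain: "open delaunay_domain"
proof -
  have "delaunay_domain = {E. 0 < snd E $ 1} \<inter> {E. snd E $ 1 < fst E} \<inter> {E. \<bar>snd E $ 2\<bar> < snd E $ 1}"
    by (auto simp: delaunay_domain_iff)
  moreover have "open \<dots>"
    by (intro open_Int open_Collect_less continuous_intros)
  ultimately show ?thesis by simp
qed

lemma open_kepler_domain: "open kepler_domain"
  by (intro open_Times open_delaunay_domain open_UNIV)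

lemma open_regular: "open regular"
  unfolding regular_def by (intro open_Times open_delaunay_domain)

lemma delaunay_domain_bounds:
  assumes "E \<in> delaunay_domain"
  shows "0 < ecc E" "ecc E < 1" "0 < fst E" "0 < 1 - (snd E $ 1 / fst E)\<^sup>2"
    "0 < 1 - (snd E $ 2 / snd E $ 1)\<^sup>2" "0 < snd E $ 1" "sqrt (1 - (ecc E)\<^sup>2) = snd E $ 1 / fst E"
    "\<bar>snd E $ 2 / snd E $ 1\<bar> < 1"
proof -
  have Y: "0 < snd E $ 1" "snd E $ 1 < fst E" "\<bar>snd E $ 2\<bar> < snd E $ 1"
    using assms by (auto simp: delaunay_domain_iff)
  then show L: "0 < fst E" "0 < snd E $ 1" by linarith+
  show "\<bar>snd E $ 2 / snd E $ 1\<bar> < 1" using Y by (simp add: abs_divide)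
  then show "0 < 1 - (snd E $ 2 / snd E $ 1)\<^sup>2"
    by (simp add: abs_square_less_1)
  have "\<bar>snd E $ 1 / fst E\<bar> < 1" using Y L by simp
  then show r: "0 < 1 - (snd E $ 1 / fst E)\<^sup>2" by (simp only: abs_square_less_1 diff_gt_0_iff_gt)
  then show "0 < ecc E" unfolding ecc_def using real_sqrt_gt_zero by blast
  have "0 < (snd E $ 1 / fst E)\<^sup>2" using Y L by simp
  then show "ecc E < 1" unfolding ecc_def by simp
  show "sqrt (1 - (ecc E)\<^sup>2) = snd E $ 1 / fst E"
    unfolding ecc_def using r Y L by (simp add: less_imp_le)
qed

lemma rotation_of_plane:
  "(rot3 \<Omega> ** rot1 i ** rot3 \<omega>) *v vector [x, y, 0] =
     x *\<^sub>R vector [cos \<Omega> * cos \<omega> - sin \<Omega> * cos i * sin \<omega>,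
        sin \<Omega> * cos \<omega> + cos \<Omega> * cos i * sin \<omega>, sin i * sin \<omega>] +
     y *\<^sub>R vector [- cos \<Omega> * sin \<omega> - sin \<Omega> * cos i * cos \<omega>,
        - sin \<Omega> * sin \<omega> + cos \<Omega> * cos i * cos \<omega>, sin i * cos \<omega>]"
  by (simp add: vec_eq_iff forall_3 matrix_vector_mult_def matrix_matrix_mult_def sum_3
      rot1_def rot3_def algebra_simps)

lemma position_eq:
  assumes "fst x \<in> delaunay_domain"
  shows "pos k0 x = (cos (anomaly x) - ecc (fst x)) *\<^sub>R axisP k0 (fst x)
     + sin (anomaly x) *\<^sub>R axisQ k0 (fst x)"
proof -
  obtain L Y l where x: "x = ((L, Y), l)" by (metis prod.collapse)
  have b: "sqrt (1 - (sqrt (1 - (Y $ 1 / L)\<^sup>2))\<^sup>2) = Y $ 1 / L" "\<bar>Y $ 2 / Y $ 1\<bar> < 1"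
    using delaunay_domain_bounds(7,8)[OF assms] by (simp_all add: ecc_def x)
  then have cs: "cos (arccos (Y $ 2 / Y $ 1)) = Y $ 2 / Y $ 1"
      "sin (arccos (Y $ 2 / Y $ 1)) = sqrt (1 - (Y $ 2 / Y $ 1)\<^sup>2)"
    by (auto simp: cos_arccos_abs sin_arccos_abs)
  show ?thesis
    unfolding x position_def kepler_position_def axisP_def axisQ_def anomaly_def ecc_def Let_def
      fst_conv snd_conv prod.case b cs rotation_of_plane scaleR_scaleR
    by (simp add: mult_ac)
qed

lemma C1_on_ecc: "C1_on ecc delaunay_domain"
  unfolding ecc_def using delaunay_domain_bounds(3,4)
  by (intro C1_on_sqrt C1_on_diff C1_on_const C1_on_power2 C1_on_divide C1_on_nth C1_on_snd
      C1_on_fst C1_on_id) (auto simp: less_imp_neq[symmetric])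

lemma C1_on_axisP: "C1_on (axisP k0) delaunay_domain"
  unfolding axisP_def Let_def using delaunay_domain_bounds(5,6)
  by (cases "k0 = 0")
     (force intro!: C1_on_scaleR C1_on_vector3 C1_on_sqrt C1_on_add C1_on_minus C1_on_mult C1_on_sin
       C1_on_cos C1_on_diff C1_on_const C1_on_power2 C1_on_divide C1_on_nth C1_on_snd C1_on_fst C1_on_id)+

lemma C1_on_axisQ: "C1_on (axisQ k0) delaunay_domain"
  unfolding axisQ_def Let_def using delaunay_domain_bounds(3,5,6)
  by (cases "k0 = 0")
     (force intro!: C1_on_scaleR C1_on_vector3 C1_on_sqrt C1_on_add C1_on_minus C1_on_mult C1_on_sin
       C1_on_cos C1_on_diff C1_on_const C1_on_power2 C1_on_divide C1_on_nth C1_on_snd C1_on_fst C1_on_id)+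

lemmas C1_on_at_elements =
  C1_on_compose[OF _ C1_on_fst[OF C1_on_id], of _ delaunay_domain kepler_domain]

lemma C1_on_anomaly: "C1_on anomaly kepler_domain"
proof -
  have "C1_on (\<lambda>x. (ecc (fst x), snd x)) kepler_domain"
    by (intro C1_on_Pair C1_on_at_elements[OF C1_on_ecc] C1_on_snd C1_on_id) auto
  from C1_on_compose[OF C1_on_eccentric_anomaly this] show ?thesis
    using delaunay_domain_bounds by (auto simp: anomaly_def[abs_def])
qed

lemma C1_on_position: "C1_on (pos k0) kepler_domain"
proof (rule C1_on_cong[OF open_kepler_domain])
  show "(cos (anomaly x) - ecc (fst x)) *\<^sub>R axisP k0 (fst x) + sin (anomaly x) *\<^sub>R axisQ k0 (fst x)
     = pos k0 x" if "x \<in> kepler_domain" for x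
    using position_eq[of x k0] that by (simp add: mem_Times_iff)
  show "C1_on (\<lambda>x. (cos (anomaly x) - ecc (fst x)) *\<^sub>R axisP k0 (fst x)
     + sin (anomaly x) *\<^sub>R axisQ k0 (fst x)) kepler_domain"
    by (intro C1_on_add C1_on_scaleR C1_on_diff C1_on_cos C1_on_sin C1_on_anomaly
        C1_on_at_elements[OF C1_on_ecc] C1_on_at_elements[OF C1_on_axisP]
        C1_on_at_elements[OF C1_on_axisQ]) auto
qed

lemma C1_on_velocity: "C1_on (velocity k0) kepler_domain"
proof -
  have "1 - ecc (fst x) * cos (anomaly x) \<noteq> 0" if "x \<in> kepler_domain" for x
    using kepler_derivative_pos[of "ecc (fst x)" "anomaly x"] delaunay_domain_bounds(1,2)[of "fst x"]
      that by (auto simp: mem_Times_iff)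
  then show ?thesis
    unfolding velocity_def
    by (intro C1_on_scaleR C1_on_divide C1_on_diff C1_on_mult C1_on_cos C1_on_sin C1_on_anomaly
        C1_on_at_elements[OF C1_on_ecc] C1_on_at_elements[OF C1_on_axisP]
        C1_on_at_elements[OF C1_on_axisQ] C1_on_const) auto
qed

lemma position_has_vector_derivative:
  assumes "E \<in> delaunay_domain"
  shows "(position k0 E has_vector_derivative velocity k0 (E, l)) (at l)"
proof -
  let ?e = "ecc E" and ?u = "\<lambda>l. anomaly (E, l)"
  have e: "0 < ?e" "?e < 1" using delaunay_domain_bounds[OF assms] by auto
  have pos: "0 < 1 - ?e * cos (?u l)" using e by (intro kepler_derivative_pos) auto
  have "(?u has_real_derivative inverse (1 - ?e * cos (?u l))) (at l)"
  proof (rule DERIV_inverse_function[where f = "\<lambda>u. u - ?e * sin u" and a = "l - 1" and b = "l + 1"])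
    show "((\<lambda>u. u - ?e * sin u) has_real_derivative 1 - ?e * cos (?u l)) (at (?u l))"
      by (auto intro!: derivative_eq_intros)
    have "C1_on (\<lambda>l. anomaly (E, l)) UNIV"
      using assms by (intro C1_on_compose[OF C1_on_anomaly] C1_on_Pair C1_on_const C1_on_id) auto
    then show "isCont ?u l"
      using C1_on_imp_continuous_on continuous_on_eq_continuous_at by blast
  qed (use pos e in \<open>auto simp: anomaly_def eccentric_anomaly_eq\<close>)
  then have u': "(?u has_real_derivative 1 / (1 - ?e * cos (?u l))) (at l)"
    by (simp add: inverse_eq_divide)
  have "((\<lambda>l. (cos (?u l) - ?e) *\<^sub>R axisP k0 E + sin (?u l) *\<^sub>R axisQ k0 E)
      has_vector_derivative velocity k0 (E, l)) (at l)"
    unfolding velocity_def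
    by (auto intro!: derivative_eq_intros u' simp: algebra_simps divide_inverse)
  moreover have "position k0 E = (\<lambda>l. (cos (?u l) - ?e) *\<^sub>R axisP k0 E + sin (?u l) *\<^sub>R axisQ k0 E)"
    using position_eq[of "(E, _)" k0] assms by auto
  ultimately show ?thesis by simp
qed

lemma position_add_2pi:
  assumes "E \<in> delaunay_domain"
  shows "position k0 E (l + 2 * pi) = position k0 E l"
  using position_eq[of "(E, _)" k0] assms eccentric_anomaly_add_2pi[of "ecc E" l]
    delaunay_domain_bounds(1,2)[OF assms]
  by (simp add: anomaly_def)

text \<open>A body at the focus would have \<open>cos u = e\<close> and \<open>sin u = 0\<close>, which forces \<open>e = 1\<close>.\<close>

lemma position_nonzero:
  assumes "E \<in> delaunay_domain" "0 < k0"
  shows "position k0 E l \<noteq> 0"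
proof
  assume zero: "position k0 E l = 0"
  let ?u = "anomaly (E, l)"
  note b = delaunay_domain_bounds[OF assms(1)]
  define c s \<omega> \<Omega> where "c = snd E $ 2 / snd E $ 1" and "s = sqrt (1 - (snd E $ 2 / snd E $ 1)\<^sup>2)"
    and "\<omega> = snd E $ 3" and "\<Omega> = snd E $ 4"
  define p where "p = (vector [cos \<Omega> * cos \<omega> - sin \<Omega> * c * sin \<omega>,
        sin \<Omega> * cos \<omega> + cos \<Omega> * c * sin \<omega>, s * sin \<omega>] :: real ^ 3)"
  define q where "q = (vector [- cos \<Omega> * sin \<omega> - sin \<Omega> * c * cos \<omega>,
        - sin \<Omega> * sin \<omega> + cos \<Omega> * c * cos \<omega>, s * cos \<omega>] :: real ^ 3)"
  have s2: "s\<^sup>2 = 1 - c\<^sup>2" using b(5) by (simp add: s_def c_def)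
  have trig: "(cos \<omega>)\<^sup>2 = 1 - (sin \<omega>)\<^sup>2" "(cos \<Omega>)\<^sup>2 = 1 - (sin \<Omega>)\<^sup>2"
    by (simp_all add: cos_squared_eq)
  \<comment> \<open>\<open>p\<close> and \<open>q\<close> are the first two columns of the rotation that carries the reference plane to the orbital plane.\<close>
  have pp: "p \<bullet> p = 1" and pq: "p \<bullet> q = 0" and qq: "q \<bullet> q = 1"
    using s2 trig unfolding p_def q_def inner_vec_def sum_3
    by (simp_all, algebra+)
  have P: "axisP k0 E = (fst E / k0)\<^sup>2 *\<^sub>R p"
    and Q: "axisQ k0 E = ((fst E / k0)\<^sup>2 * (snd E $ 1 / fst E)) *\<^sub>R q"
    by (simp_all add: axisP_def axisQ_def p_def q_def Let_def c_def s_def \<omega>_def \<Omega>_def)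
  have z: "(cos ?u - ecc E) *\<^sub>R axisP k0 E + sin ?u *\<^sub>R axisQ k0 E = 0"
    using position_eq[of "(E, l)" k0] assms zero by simp
  have qp: "q \<bullet> p = 0" using pq by (simp add: inner_commute)
  have "0 = ((cos ?u - ecc E) *\<^sub>R axisP k0 E + sin ?u *\<^sub>R axisQ k0 E) \<bullet> p"
    using z by simp
  also have "\<dots> = (cos ?u - ecc E) * (fst E / k0)\<^sup>2"
    unfolding P Q by (simp add: inner_add_left pp qp)
  finally have cu: "cos ?u = ecc E" using b assms by simp
  have "0 = ((cos ?u - ecc E) *\<^sub>R axisP k0 E + sin ?u *\<^sub>R axisQ k0 E) \<bullet> q"
    using z by simp
  also have "\<dots> = sin ?u * ((fst E / k0)\<^sup>2 * (snd E $ 1 / fst E))"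
    unfolding P Q by (simp add: inner_add_left qq pq)
  finally have "sin ?u = 0" using b assms by simp
  with cu have "(ecc E)\<^sup>2 = 1" using sin_cos_squared_add[of ?u] by simp
  then show False using b(1,2) by (simp add: power2_eq_1_iff)
qed


section \<open>The distance function near a crossing\<close>

subsection \<open>Derivatives of the difference vector\<close>

abbreviation vel1 :: "real \<Rightarrow> config \<Rightarrow> real ^ 2 \<Rightarrow> real ^ 3" where
  "vel1 k0 C V \<equiv> velocity k0 (fst C, V $ 1)"

abbreviation vel2 :: "real \<Rightarrow> config \<Rightarrow> real ^ 2 \<Rightarrow> real ^ 3" where
  "vel2 k0 C V \<equiv> velocity k0 (snd C, V $ 2)"

text \<open>The derivative of \<open>\<Delta>(C, V)\<close> with respect to \<open>V\<close>.\<close>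

definition tmap :: "real \<Rightarrow> config \<Rightarrow> real ^ 2 \<Rightarrow> real ^ 2 \<Rightarrow> real ^ 3" where
  "tmap k0 C V u = u $ 1 *\<^sub>R vel1 k0 C V - u $ 2 *\<^sub>R vel2 k0 C V"

text \<open>The vanishing of both partial derivatives of \<open>V \<mapsto> d\<^sup>2(C, V)\<close>.\<close>

definition critical_point :: "real \<Rightarrow> config \<Rightarrow> real ^ 2 \<Rightarrow> bool" where
  "critical_point k0 C V \<longleftrightarrow> Delta k0 C V \<bullet> vel1 k0 C V = 0 \<and> Delta k0 C V \<bullet> vel2 k0 C V = 0"

abbreviation Delta2 :: "real \<Rightarrow> config \<times> (real ^ 2) \<Rightarrow> real ^ 3" where
  "Delta2 k0 x \<equiv> Delta k0 (fst x) (snd x)"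

abbreviation config_domain :: "(config \<times> (real ^ 2)) set" where
  "config_domain \<equiv> regular \<times> UNIV"

lemma regular_iff: "C \<in> regular \<longleftrightarrow> fst C \<in> delaunay_domain \<and> snd C \<in> delaunay_domain"
  by (cases C) (simp add: regular_def)

lemma open_config_domain: "open config_domain"
  by (intro open_Times open_regular open_UNIV)

lemma C1_on_asteroid_state: "C1_on (\<lambda>x. (fst (fst x), snd x $ 1)) (config_domain)"
  by (intro C1_on_Pair C1_on_fst C1_on_snd C1_on_nth C1_on_id)

lemma C1_on_planet_state: "C1_on (\<lambda>x. (snd (fst x), snd x $ 2)) (config_domain)"
  by (intro C1_on_Pair C1_on_fst C1_on_snd C1_on_nth C1_on_id)

lemma C1_on_vel1: "C1_on (\<lambda>x. vel1 k0 (fst x) (snd x)) config_domain"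
  by (rule C1_on_compose[OF C1_on_velocity C1_on_asteroid_state]) (auto simp: regular_iff)

lemma C1_on_vel2: "C1_on (\<lambda>x. vel2 k0 (fst x) (snd x)) config_domain"
  by (rule C1_on_compose[OF C1_on_velocity C1_on_planet_state]) (auto simp: regular_iff)

lemma C1_on_Delta: "C1_on (Delta2 k0) config_domain"
proof -
  have "C1_on (\<lambda>x. pos k0 (fst (fst x), snd x $ 1)) config_domain"
    by (rule C1_on_compose[OF C1_on_position C1_on_asteroid_state]) (auto simp: regular_iff)
  moreover have "C1_on (\<lambda>x. pos k0 (snd (fst x), snd x $ 2)) config_domain"
    by (rule C1_on_compose[OF C1_on_position C1_on_planet_state]) (auto simp: regular_iff)
  ultimately show ?thesis
    unfolding Delta_def using C1_on_diff by simp
qed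

lemma orbit_dist2_eq: "orbit_dist2 k0 C V = Delta k0 C V \<bullet> Delta k0 C V"
  by (simp add: orbit_dist2_def orbit_dist_def dot_square_norm)

lemma Delta_has_derivative:
  assumes "C \<in> regular"
  shows "(Delta k0 C has_derivative tmap k0 C V) (at V)"
proof -
  have nth: "((\<lambda>V. V $ i) has_derivative (\<lambda>u. u $ i)) (at V)" for i :: 2
    by (intro bounded_linear_imp_has_derivative bounded_linear_vec_nth)
  have vel: "(position k0 E has_derivative (\<lambda>s. s *\<^sub>R velocity k0 (E, l))) (at l)"
    if "E \<in> delaunay_domain" for E l
    using position_has_vector_derivative[OF that] by (simp add: has_vector_derivative_def)
  have "((\<lambda>V. position k0 (fst C) (V $ 1)) has_derivative (\<lambda>u. u $ 1 *\<^sub>R vel1 k0 C V)) (at V)"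
    by (rule has_derivative_compose[OF nth vel]) (use assms in \<open>simp add: regular_iff\<close>)
  moreover have "((\<lambda>V. position k0 (snd C) (V $ 2)) has_derivative (\<lambda>u. u $ 2 *\<^sub>R vel2 k0 C V)) (at V)"
    by (rule has_derivative_compose[OF nth vel]) (use assms in \<open>simp add: regular_iff\<close>)
  ultimately show ?thesis
    unfolding Delta_def tmap_def by (rule has_derivative_diff)
qed

lemma fderiv_Delta2_split:
  assumes "C \<in> regular"
  shows "fderiv (Delta2 k0) (C, V) (dC, dV) = fderiv (Delta2 k0) (C, V) (dC, 0) + tmap k0 C V dV"
proof -
  have D: "(Delta2 k0 has_derivative fderiv (Delta2 k0) (C, V)) (at (C, V))"
    using assms by (intro C1_on_has_derivative[OF C1_on_Delta]) auto
  have "((\<lambda>V. Delta2 k0 (C, V)) has_derivative (\<lambda>u. fderiv (Delta2 k0) (C, V) (0, u))) (at V)"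
    by (rule has_derivative_compose[where f = "\<lambda>V. (C, V)", OF _ D])
       (auto intro!: derivative_eq_intros)
  then have "fderiv (Delta2 k0) (C, V) (0, dV) = tmap k0 C V dV"
    using has_derivative_unique[OF Delta_has_derivative[OF assms]] by (simp add: fun_eq_iff)
  moreover have "fderiv (Delta2 k0) (C, V) ((dC, 0) + (0, dV))
      = fderiv (Delta2 k0) (C, V) (dC, 0) + fderiv (Delta2 k0) (C, V) (0, dV)"
    using linear_add[OF has_derivative_linear[OF D]] .
  ultimately show ?thesis by simp
qed

lemma fderiv_Delta2_elements:
  assumes "C \<in> regular"
  shows "fderiv (Delta2 k0) (C, V) (dC, 0) =
    fderiv (pos k0) (fst C, V $ 1) (fst dC, 0) - fderiv (pos k0) (snd C, V $ 2) (snd dC, 0)"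
proof -
  have D: "(Delta2 k0 has_derivative fderiv (Delta2 k0) (C, V)) (at (C, V))"
    using assms by (intro C1_on_has_derivative[OF C1_on_Delta]) auto
  have "((\<lambda>C. Delta2 k0 (C, V)) has_derivative (\<lambda>u. fderiv (Delta2 k0) (C, V) (u, 0))) (at C)"
    by (rule has_derivative_compose[where f = "\<lambda>C. (C, V)", OF _ D])
       (auto intro!: derivative_eq_intros)
  moreover have
    "((\<lambda>C. pos k0 (fst C, V $ 1) - pos k0 (snd C, V $ 2)) has_derivative
      (\<lambda>u. fderiv (pos k0) (fst C, V $ 1) (fst u, 0) - fderiv (pos k0) (snd C, V $ 2) (snd u, 0))) (at C)"
  proof (rule has_derivative_diff)
    show "((\<lambda>C. pos k0 (fst C, V $ 1)) has_derivative
        (\<lambda>u. fderiv (pos k0) (fst C, V $ 1) (fst u, 0))) (at C)"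
      by (rule has_derivative_compose[where f = "\<lambda>C. (fst C, V $ 1)",
            OF _ C1_on_has_derivative[OF C1_on_position]])
         (use assms in \<open>auto simp: regular_iff intro!: derivative_eq_intros\<close>)
    show "((\<lambda>C. pos k0 (snd C, V $ 2)) has_derivative
        (\<lambda>u. fderiv (pos k0) (snd C, V $ 2) (snd u, 0))) (at C)"
      by (rule has_derivative_compose[where f = "\<lambda>C. (snd C, V $ 2)",
            OF _ C1_on_has_derivative[OF C1_on_position]])
         (use assms in \<open>auto simp: regular_iff intro!: derivative_eq_intros\<close>)
  qed
  ultimately have "(\<lambda>u. fderiv (Delta2 k0) (C, V) (u, 0)) =
      (\<lambda>u. fderiv (pos k0) (fst C, V $ 1) (fst u, 0) - fderiv (pos k0) (snd C, V $ 2) (snd u, 0))"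
    unfolding Delta_def fst_conv snd_conv by (rule has_derivative_unique)
  then show ?thesis by (rule fun_cong)
qed

lemma tau3_eq:
  assumes "C \<in> regular"
  shows "tau3 k0 C V = cross3 (vel1 k0 C V) (vel2 k0 C V)"
proof -
  have "vector_derivative (position k0 (fst C)) (at (V $ 1)) = vel1 k0 C V"
    and "vector_derivative (position k0 (snd C)) (at (V $ 2)) = vel2 k0 C V"
    using assms position_has_vector_derivative vector_derivative_at
    unfolding regular_iff by blast+
  then show ?thesis by (simp add: tau3_def)
qed

lemma local_min_imp_critical:
  assumes "C \<in> regular" "V \<in> local_min_points (orbit_dist2 k0 C)"
  shows "critical_point k0 C V"
proof -
  have "\<forall>\<^sub>F W in nhds V. orbit_dist2 k0 C V \<le> orbit_dist2 k0 C W"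
    using assms(2) by (simp add: local_min_points_def)
  then obtain S where S: "open S" "V \<in> S" "\<And>W. W \<in> S \<Longrightarrow> orbit_dist2 k0 C V \<le> orbit_dist2 k0 C W"
    unfolding eventually_nhds by blast
  have "(orbit_dist2 k0 C has_derivative
      (\<lambda>u. Delta k0 C V \<bullet> tmap k0 C V u + tmap k0 C V u \<bullet> Delta k0 C V)) (at V)"
    unfolding orbit_dist2_eq
    using has_derivative_inner[OF Delta_has_derivative Delta_has_derivative] assms(1) by blast
  from differential_zero_maxmin[OF S(2,1) this] S(3)
  have "Delta k0 C V \<bullet> tmap k0 C V u + tmap k0 C V u \<bullet> Delta k0 C V = 0" for u
    by (metis (no_types, lifting))
  from this[of "axis 1 1"] this[of "axis 2 1"] show ?thesis
    by (simp add: critical_point_def tmap_def inner_commute axis_def)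
qed

text \<open>At a crossing, the Hessian of \<open>d\<^sup>2\<close> is twice the Gram matrix of the tangent vectors.\<close>

lemma nondegenerate_crossing_imp_tau3:
  assumes C: "C \<in> regular" and nd: "nondegenerate k0 C" and zero: "Delta k0 C V = 0"
  shows "tau3 k0 C V \<noteq> 0"
proof
  assume "tau3 k0 C V = 0"
  then have "collinear {0, vel1 k0 C V, vel2 k0 C V}"
    using C by (simp add: tau3_eq cross_eq_0)
  then have "\<exists>u. u \<noteq> 0 \<and> tmap k0 C V u = 0"
  proof (unfold collinear_lemma, elim disjE exE)
    assume "vel1 k0 C V = 0"
    then show ?thesis by (intro exI[of _ "axis 1 1"]) (simp add: tmap_def axis_eq_0_iff, simp add: axis_def)
  next
    assume "vel2 k0 C V = 0"
    then show ?thesis by (intro exI[of _ "axis 2 1"]) (simp add: tmap_def axis_eq_0_iff, simp add: axis_def)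
  next
    fix c assume "vel2 k0 C V = c *\<^sub>R vel1 k0 C V"
    then show ?thesis by (intro exI[of _ "vector [c, 1]"]) (auto simp: tmap_def vec_eq_iff forall_2)
  qed
  then obtain u where u: "u \<noteq> 0" "tmap k0 C V u = 0" by blast
  let ?f = "orbit_dist2 k0 C"
  have grad: "grad ?f W = vector [2 * (Delta k0 C W \<bullet> vel1 k0 C W), - 2 * (Delta k0 C W \<bullet> vel2 k0 C W)]"
    for W
  proof -
    have "(?f has_derivative
        (\<lambda>u. Delta k0 C W \<bullet> tmap k0 C W u + tmap k0 C W u \<bullet> Delta k0 C W)) (at W)"
      unfolding orbit_dist2_eq
      using has_derivative_inner[OF Delta_has_derivative Delta_has_derivative] C by blast
    then show ?thesis
      unfolding grad_def by (simp add: fderiv_eqI vec_eq_iff forall_2 tmap_def axis_def inner_commute)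
  qed
  have vel: "\<exists>a'. ((\<lambda>W. vel1 k0 C W) has_derivative a') (at V)"
            "\<exists>a'. ((\<lambda>W. vel2 k0 C W) has_derivative a') (at V)"
  proof -
    have "C1_on (\<lambda>V. vel1 k0 (fst (C, V)) (snd (C, V))) UNIV"
      "C1_on (\<lambda>V. vel2 k0 (fst (C, V)) (snd (C, V))) UNIV"
      by (rule C1_on_compose[OF C1_on_vel1 C1_on_Pair[OF C1_on_const C1_on_id]],
          use C in simp,
          rule C1_on_compose[OF C1_on_vel2 C1_on_Pair[OF C1_on_const C1_on_id]],
          use C in simp)
    then show "\<exists>a'. ((\<lambda>W. vel1 k0 C W) has_derivative a') (at V)"
            "\<exists>a'. ((\<lambda>W. vel2 k0 C W) has_derivative a') (at V)"
      by (auto dest: C1_on_has_derivative[OF _ UNIV_I, of _ V])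
  qed
  then obtain a' b' where a': "((\<lambda>W. vel1 k0 C W) has_derivative a') (at V)"
    and b': "((\<lambda>W. vel2 k0 C W) has_derivative b') (at V)" by blast
  let ?H = "\<lambda>w. (2 * (tmap k0 C V w \<bullet> vel1 k0 C V)) *\<^sub>R axis 1 1
      + (- 2 * (tmap k0 C V w \<bullet> vel2 k0 C V)) *\<^sub>R axis 2 1 :: real ^ 2"
  have "((\<lambda>W. (2 * (Delta k0 C W \<bullet> vel1 k0 C W)) *\<^sub>R axis 1 1
      + (- 2 * (Delta k0 C W \<bullet> vel2 k0 C W)) *\<^sub>R axis 2 1 :: real ^ 2) has_derivative ?H) (at V)"
    by (auto intro!: derivative_eq_intros Delta_has_derivative[OF C] a' b' simp: zero fun_eq_iff)
  moreover have "grad ?f = (\<lambda>W. (2 * (Delta k0 C W \<bullet> vel1 k0 C W)) *\<^sub>R axis 1 1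
      + (- 2 * (Delta k0 C W \<bullet> vel2 k0 C W)) *\<^sub>R axis 2 1)"
    by (simp add: fun_eq_iff grad vec_eq_iff forall_2 axis_def)
  ultimately have H: "(grad ?f has_derivative ?H) (at V)" by simp
  have "jacobian (grad ?f) (at V) *v u = ?H u"
    unfolding jacobian_def fderiv_eqI[OF H] using fun_cong[OF matrix_vector_mul(2)[OF has_derivative_linear[OF H]], of u] by simp
  also have "\<dots> = 0" using u by simp
  finally have "jacobian (grad ?f) (at V) *v u = 0" .
  then have "det (jacobian (grad ?f) (at V)) = 0"
    using u(1) by (metis invertible_det_nz invertible_left_inverse matrix_left_invertible_ker)
  moreover have "grad ?f V = 0"
    by (simp add: grad zero vec_eq_iff forall_2)
  ultimately show False
    using nd by (simp add: nondegenerate_def nondegenerate_critical_points_def)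
qed

subsection \<open>Quantitative estimates\<close>

lemma pair_in_ball:
  assumes "x \<in> ball x0 (\<delta> / 2)" "y \<in> ball y0 (\<delta> / 2)"
  shows "(x, y) \<in> ball (x0, y0) \<delta>"
proof -
  have "dist (x0, y0) (x, y) \<le> dist x0 x + dist y0 y"
    unfolding dist_Pair_Pair by (rule sqrt_sum_squares_le_sum) auto
  then show ?thesis using assms by auto
qed

text \<open>Taylor's formula in \<open>V\<close> with a remainder bounded uniformly in the configuration.\<close>

lemma Delta_taylor:
  assumes "C0 \<in> regular"
  obtains \<delta> K where "0 < \<delta>" "0 < K" "ball C0 \<delta> \<subseteq> regular"
    "\<And>C V W. C \<in> ball C0 \<delta> \<Longrightarrow> V \<in> ball V0 \<delta> \<Longrightarrow> W \<in> ball V0 \<delta> \<Longrightarrow>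
       norm (Delta k0 C W - Delta k0 C V - tmap k0 C V (W - V)) \<le> K * (norm (W - V))\<^sup>2"
proof -
  have mem: "(C0, V0) \<in> config_domain" using assms by simp
  obtain d1 K1 where 1: "0 < d1" "0 < K1"  "ball (C0, V0) d1 \<subseteq> config_domain"
    "\<And>x y. x \<in> ball (C0, V0) d1 \<Longrightarrow> y \<in> ball (C0, V0) d1 \<Longrightarrow>
       norm (vel1 k0 (fst y) (snd y) - vel1 k0 (fst x) (snd x)) \<le> K1 * norm (y - x)"
    by (rule C1_on_locally_lipschitz[OF C1_on_vel1[of k0] open_config_domain mem]) blast
  obtain d2 K2 where 2: "0 < d2" "0 < K2" "ball (C0, V0) d2 \<subseteq> config_domain"
    "\<And>x y. x \<in> ball (C0, V0) d2 \<Longrightarrow> y \<in> ball (C0, V0) d2 \<Longrightarrow>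
       norm (vel2 k0 (fst y) (snd y) - vel2 k0 (fst x) (snd x)) \<le> K2 * norm (y - x)"
    by (rule C1_on_locally_lipschitz[OF C1_on_vel2[of k0] open_config_domain mem]) blast
  define \<delta> where "\<delta> = min d1 d2 / 2"
  have \<delta>: "0 < \<delta>" "\<delta> \<le> d1 / 2" "\<delta> \<le> d2 / 2" using 1 2 by (auto simp: \<delta>_def)
  have sub: "ball C0 \<delta> \<subseteq> regular"
  proof
    fix C assume "C \<in> ball C0 \<delta>"
    then have "(C, V0) \<in> ball (C0, V0) d1" using \<delta> 1(1) by (intro pair_in_ball) auto
    then show "C \<in> regular" using 1(3) by auto
  qed
  have "norm (Delta k0 C W - Delta k0 C V - tmap k0 C V (W - V)) \<le> (K1 + K2) * (norm (W - V))\<^sup>2"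
    if C: "C \<in> ball C0 \<delta>" and V: "V \<in> ball V0 \<delta>" and W: "W \<in> ball V0 \<delta>" for C V W
  proof -
    have "norm (Delta k0 C W - Delta k0 C V - tmap k0 C V (W - V))
        \<le> norm (W - V) * ((K1 + K2) * norm (W - V))"
    proof (rule differentiable_bound_linearization[where S = "closed_segment V W"])
      show "V + t *\<^sub>R (W - V) \<in> closed_segment V W" if "t \<in> {0..1}" for t
        using that unfolding closed_segment_def
        by (auto intro!: exI[of _ t] simp: algebra_simps)
      show "(Delta k0 C has_derivative tmap k0 C X) (at X within closed_segment V W)" for X
        by (rule has_derivative_at_withinI, rule Delta_has_derivative) (use sub C in auto)
      show "V \<in> closed_segment V W" by simp
      show "onorm (tmap k0 C X - tmap k0 C V) \<le> (K1 + K2) * norm (W - V)"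
        if X: "X \<in> closed_segment V W" for X
      proof (rule onorm_le)
        fix u :: "real ^ 2"
        have "X \<in> ball V0 \<delta>" using X closed_segment_subset[OF V W convex_ball] by blast
        then have m: "(C, X) \<in> ball (C0, V0) d1" "(C, V) \<in> ball (C0, V0) d1"
          "(C, X) \<in> ball (C0, V0) d2" "(C, V) \<in> ball (C0, V0) d2"
          using C V \<delta> by (intro pair_in_ball; auto)+
        have XV: "norm (X - V) \<le> norm (W - V)"
          using segment_bound1[OF X] by (simp add: norm_minus_commute)
        have b1: "norm (vel1 k0 C X - vel1 k0 C V) \<le> K1 * norm (W - V)"
          using order_trans[OF 1(4)[OF m(2,1)], of "K1 * norm (W - V)"] XV 1(2)
          by (simp add: norm_Pair)
        have b2: "norm (vel2 k0 C X - vel2 k0 C V) \<le> K2 * norm (W - V)"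
          using order_trans[OF 2(4)[OF m(4,3)], of "K2 * norm (W - V)"] XV 2(2)
          by (simp add: norm_Pair)
        have "(tmap k0 C X - tmap k0 C V) u
           = u $ 1 *\<^sub>R (vel1 k0 C X - vel1 k0 C V) - u $ 2 *\<^sub>R (vel2 k0 C X - vel2 k0 C V)"
          by (simp add: tmap_def algebra_simps)
        also have "norm \<dots> \<le> \<bar>u $ 1\<bar> * norm (vel1 k0 C X - vel1 k0 C V)
            + \<bar>u $ 2\<bar> * norm (vel2 k0 C X - vel2 k0 C V)"
          by (rule order_trans[OF norm_triangle_ineq4]) simp
        also have "\<dots> \<le> norm u * (K1 * norm (W - V)) + norm u * (K2 * norm (W - V))"
          using b1 b2 by (intro add_mono mult_mono component_le_norm_cart) auto
        finally show "norm ((tmap k0 C X - tmap k0 C V) u) \<le> (K1 + K2) * norm (W - V) * norm u"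
          by (simp add: algebra_simps)
      qed
    qed
    then show ?thesis by (simp add: power2_eq_square mult_ac)
  qed
  moreover have "0 < K1 + K2" using 1 2 by simp
  ultimately show thesis using that \<delta>(1) sub by blast
qed

text \<open>
  Independent tangent vectors make \<open>V \<mapsto> \<Delta>(C, V)\<close> injective near \<open>V0\<close>, with a Lipschitz inverse,
  uniformly for \<open>C\<close> near \<open>C0\<close>.
\<close>

lemma Delta_coercive:
  assumes C0: "C0 \<in> regular" and \<tau>: "tau3 k0 C0 V0 \<noteq> 0"
  obtains \<delta> c where "0 < \<delta>" "0 < c" "ball C0 \<delta> \<subseteq> regular"
    "\<And>C V W. C \<in> ball C0 \<delta> \<Longrightarrow> V \<in> ball V0 \<delta> \<Longrightarrow> W \<in> ball V0 \<delta> \<Longrightarrow>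
       c * norm (W - V) \<le> norm (Delta k0 C W - Delta k0 C V)"
proof -
  have mem: "(C0, V0) \<in> config_domain" using C0 by simp
  have lin: "linear (tmap k0 C0 V0)"
    using Delta_has_derivative[OF C0] has_derivative_linear by blast
  have "inj (tmap k0 C0 V0)"
  proof (rule linear_injective_0[OF lin, THEN iffD2], intro allI impI)
    fix u assume "tmap k0 C0 V0 u = 0"
    then have eq: "u $ 1 *\<^sub>R vel1 k0 C0 V0 = u $ 2 *\<^sub>R vel2 k0 C0 V0"
      by (simp add: tmap_def)
    from arg_cong[OF eq, of "\<lambda>v. cross3 v (vel2 k0 C0 V0)"] arg_cong[OF eq, of "cross3 (vel1 k0 C0 V0)"]
    have "u $ 1 *\<^sub>R tau3 k0 C0 V0 = 0" "u $ 2 *\<^sub>R tau3 k0 C0 V0 = 0"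
      using C0 by (simp_all add: tau3_eq cross_mult_left cross_mult_right)
    then have "u $ 1 = 0" "u $ 2 = 0" using \<tau> by auto
    then show "u = 0" by (simp add: vec_eq_iff forall_2)
  qed
  then obtain B where B: "0 < B" "\<And>u. B * norm u \<le> norm (tmap k0 C0 V0 u)"
    using linear_inj_bounded_below_pos[OF lin] by blast
  obtain \<delta> where \<delta>: "0 < \<delta>" "ball (C0, V0) \<delta> \<subseteq> config_domain"
    "\<And>x y. x \<in> ball (C0, V0) \<delta> \<Longrightarrow> y \<in> ball (C0, V0) \<delta> \<Longrightarrow>
       norm (Delta2 k0 y - Delta2 k0 x - fderiv (Delta2 k0) (C0, V0) (y - x)) \<le> B / 2 * norm (y - x)"
    by (rule C1_on_strict[OF C1_on_Delta open_config_domain mem, of "B / 2"]) (use B in auto)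
  have sub: "ball C0 (\<delta> / 2) \<subseteq> regular"
  proof
    fix C assume "C \<in> ball C0 (\<delta> / 2)"
    then have "(C, V0) \<in> ball (C0, V0) \<delta>" using \<delta> by (intro pair_in_ball) auto
    then show "C \<in> regular" using \<delta>(2) by auto
  qed
  have "B / 2 * norm (W - V) \<le> norm (Delta k0 C W - Delta k0 C V)"
    if "C \<in> ball C0 (\<delta> / 2)" "V \<in> ball V0 (\<delta> / 2)" "W \<in> ball V0 (\<delta> / 2)" for C V W
  proof -
    have z: "fderiv (Delta2 k0) (C0, V0) (0, 0) = 0"
      using linear_0[OF C1_on_linear_fderiv[OF C1_on_Delta mem]] by (simp add: zero_prod_def)
    have "fderiv (Delta2 k0) (C0, V0) (0, W - V) = tmap k0 C0 V0 (W - V)"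
      using fderiv_Delta2_split[OF C0, of k0 V0 0 "W - V"] z by simp
    then have "norm (Delta k0 C W - Delta k0 C V - tmap k0 C0 V0 (W - V)) \<le> B / 2 * norm (W - V)"
      using \<delta>(3)[OF pair_in_ball[OF that(1,2)] pair_in_ball[OF that(1,3)]] by (simp add: norm_Pair)
    moreover have "B * norm (W - V) \<le> norm (tmap k0 C0 V0 (W - V))" using B by blast
    moreover have "norm (tmap k0 C0 V0 (W - V)) \<le> norm (Delta k0 C W - Delta k0 C V)
       + norm (Delta k0 C W - Delta k0 C V - tmap k0 C0 V0 (W - V))"
      using norm_triangle_ineq4[of "Delta k0 C W - Delta k0 C V"
          "Delta k0 C W - Delta k0 C V - tmap k0 C0 V0 (W - V)"] by simp
    ultimately show ?thesis by argo
  qed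
  then show thesis using that[of "\<delta> / 2" "B / 2"] \<delta>(1) B(1) sub by simp
qed

text \<open>
  Near a crossing with independent tangent vectors, \<open>d\<^sup>2\<close> grows quadratically away from each
  critical point, uniformly in the configuration.
\<close>

lemma critical_point_quadratic_growth:
  assumes C0: "C0 \<in> regular" and \<tau>: "tau3 k0 C0 V0 \<noteq> 0" and zero: "Delta k0 C0 V0 = 0"
  obtains \<delta> c where "0 < \<delta>" "0 < c" "ball C0 \<delta> \<subseteq> regular"
    "\<And>C V W. C \<in> ball C0 \<delta> \<Longrightarrow> V \<in> ball V0 \<delta> \<Longrightarrow> W \<in> ball V0 \<delta> \<Longrightarrow> critical_point k0 C V \<Longrightarrow>
       orbit_dist2 k0 C V + c * (norm (W - V))\<^sup>2 \<le> orbit_dist2 k0 C W"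
proof -
  obtain d1 K where 1: "0 < d1" "0 < K"
    "\<And>C V W. C \<in> ball C0 d1 \<Longrightarrow> V \<in> ball V0 d1 \<Longrightarrow> W \<in> ball V0 d1 \<Longrightarrow>
       norm (Delta k0 C W - Delta k0 C V - tmap k0 C V (W - V)) \<le> K * (norm (W - V))\<^sup>2"
    by (rule Delta_taylor[OF C0, of V0 k0]) blast
  obtain d2 c where 2: "0 < d2" "0 < c" "ball C0 d2 \<subseteq> regular"
    "\<And>C V W. C \<in> ball C0 d2 \<Longrightarrow> V \<in> ball V0 d2 \<Longrightarrow> W \<in> ball V0 d2 \<Longrightarrow>
       c * norm (W - V) \<le> norm (Delta k0 C W - Delta k0 C V)"
    by (rule Delta_coercive[OF C0 \<tau>]) blast
  have "isCont (Delta2 k0) (C0, V0)"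
    using C1_on_imp_continuous_on[OF C1_on_Delta] open_config_domain C0
    by (subst (asm) continuous_on_eq_continuous_at) auto
  moreover have "0 < c\<^sup>2 / (4 * K)" using 1 2 by simp
  ultimately obtain d3 where 3: "0 < d3"
    "\<And>x. dist x (C0, V0) < d3 \<Longrightarrow> norm (Delta2 k0 x) < c\<^sup>2 / (4 * K)"
    unfolding continuous_at_eps_delta using zero by (metis dist_0_norm dist_commute fst_conv snd_conv)
  define \<delta> where "\<delta> = min d1 (min d2 (d3 / 2))"
  have \<delta>: "0 < \<delta>" "\<delta> \<le> d1" "\<delta> \<le> d2" "\<delta> \<le> d3 / 2" using 1 2 3 by (auto simp: \<delta>_def)
  have "orbit_dist2 k0 C V + c\<^sup>2 / 2 * (norm (W - V))\<^sup>2 \<le> orbit_dist2 k0 C W"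
    if C: "C \<in> ball C0 \<delta>" and V: "V \<in> ball V0 \<delta>" and W: "W \<in> ball V0 \<delta>"
      and crit: "critical_point k0 C V" for C V W
  proof -
    let ?D = "Delta k0 C V" and ?s = "Delta k0 C W - Delta k0 C V" and ?t = "tmap k0 C V (W - V)"
    let ?r = "norm (W - V)"
    have "(C, V) \<in> ball (C0, V0) d3" using C V \<delta> by (intro pair_in_ball) auto
    then have small: "norm ?D \<le> c\<^sup>2 / (4 * K)"
      using 3(2)[of "(C, V)"] by (simp add: dist_commute less_imp_le)
    \<comment> \<open>The first order term of \<open>\<Delta> \<bullet> (\<Delta>(W) - \<Delta>(V))\<close> vanishes at a critical point; the second order
      term is dominated by \<open>|\<Delta>(W) - \<Delta>(V)|\<^sup>2\<close> because \<open>|\<Delta>(V)|\<close> is small.\<close>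
    have "?D \<bullet> ?t = 0"
      using crit by (simp add: critical_point_def tmap_def inner_diff_right)
    then have "\<bar>?D \<bullet> ?s\<bar> = \<bar>?D \<bullet> (?s - ?t)\<bar>" by (simp add: inner_diff_right)
    also have "\<dots> \<le> norm ?D * norm (?s - ?t)" by (rule Cauchy_Schwarz_ineq2)
    also have "\<dots> \<le> c\<^sup>2 / (4 * K) * (K * ?r\<^sup>2)"
      using 1(3)[of C V W] C V W \<delta> small 1(2) by (intro mult_mono) auto
    finally have a: "\<bar>?D \<bullet> ?s\<bar> \<le> c\<^sup>2 / 4 * ?r\<^sup>2" using 1(2) by simp
    have "c * ?r \<le> norm ?s" using 2(4) C V W \<delta> by auto
    then have "(c * ?r)\<^sup>2 \<le> (norm ?s)\<^sup>2" using 2(2) by (intro power_mono) auto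
    then have b: "c\<^sup>2 * ?r\<^sup>2 \<le> ?s \<bullet> ?s" by (simp add: power_mult_distrib power2_norm_eq_inner)
    have "orbit_dist2 k0 C W = (?D + ?s) \<bullet> (?D + ?s)" by (simp add: orbit_dist2_eq)
    also have "\<dots> = orbit_dist2 k0 C V + 2 * (?D \<bullet> ?s) + ?s \<bullet> ?s"
      unfolding orbit_dist2_eq inner_add_left inner_add_right
      using inner_commute[of ?D ?s] by linarith
    finally have e: "orbit_dist2 k0 C W = orbit_dist2 k0 C V + 2 * (?D \<bullet> ?s) + ?s \<bullet> ?s" .
    have "- (2 * (?D \<bullet> ?s)) \<le> 2 * (c\<^sup>2 / 4 * ?r\<^sup>2)" using a by linarith
    then show ?thesis using b e by (simp add: field_simps)
  qed
  moreover have "ball C0 \<delta> \<subseteq> regular" using 2(3) \<delta>(3) by auto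
  moreover have "0 < c\<^sup>2 / 2" using 2(2) by simp
  ultimately show thesis using that \<delta>(1) by blast
qed


section \<open>Integrals over the torus\<close>

abbreviation vec2 :: "real \<Rightarrow> real \<Rightarrow> real ^ 2" where
  "vec2 x y \<equiv> vector [x, y]"

lemma vec2_eq: "vec2 x y = x *\<^sub>R axis 1 1 + y *\<^sub>R axis 2 1"
  by (simp add: vec_eq_iff forall_2 axis_def)

lemma continuous_on_vec2 [continuous_intros]:
  "continuous_on S f \<Longrightarrow> continuous_on S g \<Longrightarrow> continuous_on S (\<lambda>x. vec2 (f x) (g x))"
  unfolding vec2_eq by (intro continuous_intros)

text \<open>Functions of the two mean anomalies that live on the torus.\<close>

definition periodic2 :: "(real ^ 2 \<Rightarrow> 'a) \<Rightarrow> bool" where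
  "periodic2 f \<longleftrightarrow> (\<forall>V. f (V + vec2 (2 * pi) 0) = f V \<and> f (V + vec2 0 (2 * pi)) = f V)"

lemma cbox_vec2: "cbox (vec2 a b) (vec2 c d) = (\<lambda>(x, y). vec2 x y) ` cbox (a, b) (c, d)"
proof -
  have "V = vec2 (V $ 1) (V $ 2)" for V :: "real ^ 2" by (simp add: vec_eq_iff forall_2)
  then show ?thesis
    by (force simp: mem_box_cart forall_2 cbox_Pair_eq image_iff)
qed

text \<open>Fubini's theorem on \<open>\<real>\<^sup>2\<close>, seen as the type of vectors of length two.\<close>

lemma integral_vec2:
  fixes f :: "real ^ 2 \<Rightarrow> real"
  assumes "continuous_on (cbox (vec2 a b) (vec2 c d)) f"
  shows "integral (cbox (vec2 a b) (vec2 c d)) f =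
    integral {a..c} (\<lambda>x. integral {b..d} (\<lambda>y. f (vec2 x y)))"
proof -
  let ?g = "\<lambda>p. vec2 (fst p) (snd p)" and ?h = "\<lambda>V :: real ^ 2. (V $ 1, V $ 2)"
  have g_image: "?g ` cbox u v = cbox (?g u) (?g v)" for u v
    using cbox_vec2[of "fst u" "snd u" "fst v" "snd v"] by (simp add: case_prod_unfold)
  have hg: "?h (?g p) = p" and gh: "?g (?h V) = V" for p V
    by (simp_all add: vec_eq_iff forall_2)
  have h_image: "?h ` cbox u v = cbox (?h u) (?h v)" for u v
  proof -
    have "cbox u v = ?g ` cbox (?h u) (?h v)" unfolding g_image gh ..
    then have "?h ` cbox u v = (\<lambda>p. ?h (?g p)) ` cbox (?h u) (?h v)" by (simp only: image_image)
    then show ?thesis unfolding hg by simp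
  qed
  have content: "measure lborel (?g ` cbox u v) = 1 * measure lborel (cbox u v)" for u v
  proof (cases "cbox u v = {}")
    case False
    then have "cbox (?g u) (?g v) \<noteq> {}" unfolding g_image[symmetric] by simp
    then have "measure lborel (cbox (?g u) (?g v)) = (snd v - snd u) * (fst v - fst u)"
      by (simp add: content_cbox_cart prod_2 UNIV_2)
    moreover have "measure lborel (cbox u v) = (fst v - fst u) * (snd v - snd u)"
    proof -
      have "fst u \<le> fst v" "snd u \<le> snd v"
        using False by (cases u; cases v; auto simp: cbox_Pair_eq)+
      then show ?thesis
        using content_Pair[of "fst u" "snd u" "fst v" "snd v"] by simp
    qed
    ultimately show ?thesis unfolding g_image by simp
  qed simp
  have "(f has_integral integral (cbox (vec2 a b) (vec2 c d)) f) (cbox (vec2 a b) (vec2 c d))"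
    using integrable_continuous[OF assms] by (simp add: integrable_integral)
  then have "((\<lambda>p. f (?g p)) has_integral (1 / 1) *\<^sub>R integral (cbox (vec2 a b) (vec2 c d)) f)
      (?h ` cbox (vec2 a b) (vec2 c d))"
  proof (intro has_integral_twiddle[where h = ?h and g = ?g])
    show "continuous (at p) ?g" for p
      unfolding vec2_eq by (intro continuous_intros)
    show "\<exists>w z. ?g ` cbox u v = cbox w z" for u v using g_image by blast
    show "\<exists>w z. ?h ` cbox u v = cbox w z" for u v using h_image by blast
  qed (use content hg gh in auto)
  then have "integral (cbox (a, b) (c, d)) (\<lambda>p. f (?g p)) = integral (cbox (vec2 a b) (vec2 c d)) f"
    unfolding h_image by (simp add: integral_unique)
  moreover have "continuous_on (cbox (a, b) (c, d)) (\<lambda>p. f (?g p))"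
  proof (rule continuous_on_compose2[OF assms])
    show "continuous_on (cbox (a, b) (c, d)) ?g" by (intro continuous_intros)
    show "?g ` cbox (a, b) (c, d) \<subseteq> cbox (vec2 a b) (vec2 c d)" by (simp add: g_image)
  qed
  ultimately show ?thesis
    using integral_prod_continuous[of a b c d "\<lambda>p. f (?g p)"] by simp
qed

lemma integral_torus:
  fixes f :: "real ^ 2 \<Rightarrow> 'a::euclidean_space"
  assumes "continuous_on UNIV f"
  shows "f integrable_on torus"
    and "integral torus f = integral (cbox (vec2 0 0) (vec2 (2 * pi) (2 * pi))) f"
proof -
  let ?B = "cbox (vec2 0 0) (vec2 (2 * pi) (2 * pi))"
  have hyp: "negligible {V :: real ^ 2. V $ i = 2 * pi}" for i
    using negligible_standard_hyperplane[of "axis i 1 :: real ^ 2" "2 * pi"]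
    by (simp add: axis_in_Basis_iff inner_axis)
  have "negligible ({V :: real ^ 2. V $ 1 = 2 * pi} \<union> {V. V $ 2 = 2 * pi})"
    by (rule negligible_Un[OF hyp hyp])
  then have neg: "negligible ((torus - ?B) \<union> (?B - torus))"
    by (rule negligible_subset) (auto simp: torus_def mem_box_cart forall_2)
  have "f integrable_on ?B"
    using assms by (intro integrable_continuous) (auto intro: continuous_on_subset)
  then show "f integrable_on torus"
    by (rule integrable_spike_set) (rule negligible_subset[OF neg], blast)+
  show "integral torus f = integral ?B f"
    by (rule integral_spike_set; rule negligible_subset[OF neg]; auto)
qed

lemma integral_periodic_shift:
  fixes f :: "real \<Rightarrow> real"
  assumes cont: "continuous_on UNIV f" and per: "\<And>x. f (x + p) = f x" and "0 < p"
  shows "integral {a..a + p} f = integral {0..p} f"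
proof -
  have shift: "integral {a..a + p} f = integral {0..p} f" if "0 \<le> a" for a
  proof -
    have int: "f integrable_on {u..v}" for u v
      using cont by (intro integrable_continuous_real) (auto intro: continuous_on_subset)
    have "integral {p..a + p} f = integral {0..a} f"
    proof -
      have "(f has_integral integral {p..a + p} f) {p..a + p}"
        using int by (simp add: integrable_integral)
      then have "((\<lambda>x. f (x + p)) has_integral integral {p..a + p} f) {0..a}"
        using has_integral_affinity[of f _ p "a + p" 1 p] by (simp add: image_diff_atLeastAtMost add.commute)
      then show ?thesis by (simp add: per integral_unique)
    qed
    moreover have "integral {0..a} f + integral {a..a + p} f = integral {0..a + p} f"
      "integral {0..p} f + integral {p..a + p} f = integral {0..a + p} f"
      using int that \<open>0 < p\<close> by (auto intro!: Henstock_Kurzweil_Integration.integral_combine)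
    ultimately show ?thesis by simp
  qed
  \<comment> \<open>A translation by a multiple of the period reduces the claim to \<open>0 \<le> a\<close>.\<close>
  obtain n :: nat where n: "- a / p < n" using reals_Archimedean2 by blast
  have per_n: "f (x + real n * p) = f x" for n x
  proof (induction n)
    case (Suc n)
    have "f (x + real (Suc n) * p) = f ((x + real n * p) + p)" by (simp add: algebra_simps)
    then show ?case using per Suc by simp
  qed simp
  have "(f has_integral integral {a + n * p..a + n * p + p} f) {a + n * p..a + n * p + p}"
    using cont by (intro integrable_integral integrable_continuous_real) (auto intro: continuous_on_subset)
  then have "((\<lambda>x. f (x + n * p)) has_integral integral {a + n * p..a + n * p + p} f) {a..a + p}"
    using has_integral_affinity[of f _ "a + n * p" "a + n * p + p" 1 "n * p"]
    by (simp add: image_diff_atLeastAtMost add.commute)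
  then have "integral {a..a + p} f = integral {a + n * p..a + n * p + p} f"
    by (simp add: per_n integral_unique)
  also have "\<dots> = integral {0..p} f"
    using n \<open>0 < p\<close> by (intro shift) (simp add: field_simps)
  finally show ?thesis .
qed

lemma integral_periodic_centered:
  fixes f :: "real \<Rightarrow> real"
  assumes cont: "continuous_on UNIV f" and per: "\<And>x. f (x + 2 * pi) = f x"
  shows "integral {- pi..pi} (\<lambda>x. f (c + x)) = integral {0..2 * pi} f"
proof -
  have "(f has_integral integral {c - pi..c - pi + 2 * pi} f) {c - pi..c - pi + 2 * pi}"
    using cont by (intro integrable_integral integrable_continuous_real) (auto intro: continuous_on_subset)
  then have "((\<lambda>x. f (x + c)) has_integral integral {c - pi..c - pi + 2 * pi} f) {- pi..pi}"
    using has_integral_affinity[of f _ "c - pi" "c - pi + 2 * pi" 1 c]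
    by (simp add: image_diff_atLeastAtMost add.commute)
  then have "integral {- pi..pi} (\<lambda>x. f (c + x)) = integral {c - pi..c - pi + 2 * pi} f"
    by (simp add: integral_unique add.commute)
  also have "\<dots> = integral {0..2 * pi} f"
    by (rule integral_periodic_shift[OF cont per]) simp
  finally show ?thesis .
qed

lemma integral_torus_centered:
  fixes f :: "real ^ 2 \<Rightarrow> real"
  assumes cont: "continuous_on UNIV f" and per: "periodic2 f"
  shows "integral torus f =
    integral {- pi..pi} (\<lambda>x. integral {- pi..pi} (\<lambda>y. f (V + vec2 x y)))"
proof -
  have add: "vec2 a b + vec2 c d = vec2 (a + c) (b + d)" for a b c d
    by (simp add: vec_eq_iff forall_2)
  have per1: "f (vec2 (x + 2 * pi) y) = f (vec2 x y)" and per2: "f (vec2 x (y + 2 * pi)) = f (vec2 x y)"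
    for x y
    using per[unfolded periodic2_def, rule_format, of "vec2 x y"] by (simp_all add: add)
  have cont2: "continuous_on UNIV (\<lambda>y. f (vec2 x y))" for x
    by (rule continuous_on_compose2[OF cont]) (auto intro!: continuous_intros)
  have "continuous_on (UNIV \<times> cbox 0 (2 * pi)) (\<lambda>(x, y). f (vec2 x y))"
    unfolding case_prod_unfold
    by (rule continuous_on_compose2[OF cont]) (auto intro!: continuous_intros)
  then have cont1: "continuous_on UNIV (\<lambda>x. integral {0..2 * pi} (\<lambda>y. f (vec2 x y)))"
    using integral_continuous_on_param[of UNIV 0 "2 * pi" "\<lambda>x y. f (vec2 x y)"] by simp
  have V: "V + vec2 x y = vec2 (V $ 1 + x) (V $ 2 + y)" for x y
    by (simp add: vec_eq_iff forall_2)
  have "integral torus f = integral {0..2 * pi} (\<lambda>x. integral {0..2 * pi} (\<lambda>y. f (vec2 x y)))"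
    unfolding integral_torus(2)[OF cont]
    by (rule integral_vec2) (rule continuous_on_subset[OF cont], simp)
  also have "\<dots> = integral {- pi..pi} (\<lambda>x. integral {0..2 * pi} (\<lambda>y. f (vec2 (V $ 1 + x) y)))"
    by (rule integral_periodic_centered[OF cont1, symmetric]) (simp add: per1)
  also have "\<dots> = integral {- pi..pi} (\<lambda>x. integral {- pi..pi} (\<lambda>y. f (vec2 (V $ 1 + x) (V $ 2 + y))))"
    by (subst integral_periodic_centered[OF cont2]) (simp_all add: per2)
  finally show ?thesis by (simp add: V)
qed

text \<open>The derivative of a periodic function in a fixed direction has mean zero.\<close>

lemma integral_periodic_derivative:
  fixes \<phi> :: "real ^ 2 \<Rightarrow> real"
  assumes C1: "C1_on \<phi> UNIV" and per: "periodic2 \<phi>"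
  shows "integral {- pi..pi} (\<lambda>x. integral {- pi..pi} (\<lambda>y. fderiv \<phi> (V + vec2 x y) u)) = 0"
proof -
  have D: "(\<phi> has_derivative fderiv \<phi> W) (at W)" for W
    using C1_on_has_derivative[OF C1] by simp
  have lin: "linear (fderiv \<phi> W)" for W using has_derivative_linear[OF D] .
  have D1: "((\<lambda>x. \<phi> (V + vec2 x y)) has_vector_derivative fderiv \<phi> (V + vec2 x y) (axis 1 1)) (at x)" for x y
  proof -
    have "((\<lambda>x. V + vec2 x y) has_derivative (\<lambda>h. h *\<^sub>R axis 1 1)) (at x)"
      unfolding vec2_eq by (auto intro!: derivative_eq_intros)
    from has_derivative_compose[OF this D] show ?thesis
      by (simp add: has_vector_derivative_def linear_scale[OF lin])
  qed
  have D2: "((\<lambda>y. \<phi> (V + vec2 x y)) has_vector_derivative fderiv \<phi> (V + vec2 x y) (axis 2 1)) (at y)" for x y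
  proof -
    have "((\<lambda>y. V + vec2 x y) has_derivative (\<lambda>h. h *\<^sub>R axis 2 1)) (at y)"
      unfolding vec2_eq by (auto intro!: derivative_eq_intros)
    from has_derivative_compose[OF this D] show ?thesis
      by (simp add: has_vector_derivative_def linear_scale[OF lin])
  qed
  have cont: "continuous_on S (\<lambda>p. fderiv \<phi> (V + vec2 (fst p) (snd p)) v)" for S v
    by (rule continuous_on_fderiv[OF C1]) (auto intro!: continuous_intros)
  have shift: "\<phi> (V + vec2 pi y) = \<phi> (V + vec2 (- pi) y)" "\<phi> (V + vec2 x pi) = \<phi> (V + vec2 x (- pi))" for x y
  proof -
    have "V + vec2 pi y = (V + vec2 (- pi) y) + vec2 (2 * pi) 0"
      "V + vec2 x pi = (V + vec2 x (- pi)) + vec2 0 (2 * pi)"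
      by (simp_all add: vec_eq_iff forall_2)
    then show "\<phi> (V + vec2 pi y) = \<phi> (V + vec2 (- pi) y)" "\<phi> (V + vec2 x pi) = \<phi> (V + vec2 x (- pi))"
      using per unfolding periodic2_def by metis+
  qed
  have I2: "integral {- pi..pi} (\<lambda>y. fderiv \<phi> (V + vec2 x y) (axis 2 1)) = 0" for x
    using fundamental_theorem_of_calculus[of "- pi" pi "\<lambda>y. \<phi> (V + vec2 x y)"] D2 shift(2)
    by (simp add: has_vector_derivative_at_within integral_unique)
  have I1: "integral {- pi..pi} (\<lambda>x. fderiv \<phi> (V + vec2 x y) (axis 1 1)) = 0" for y
    using fundamental_theorem_of_calculus[of "- pi" pi "\<lambda>x. \<phi> (V + vec2 x y)"] D1 shift(1)
    by (simp add: has_vector_derivative_at_within integral_unique)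
  have "fderiv \<phi> W u = u $ 1 * fderiv \<phi> W (axis 1 1) + u $ 2 * fderiv \<phi> W (axis 2 1)" for W
  proof -
    have "u = u $ 1 *\<^sub>R axis 1 1 + u $ 2 *\<^sub>R axis 2 1" by (simp add: vec_eq_iff forall_2 axis_def)
    then have "fderiv \<phi> W u = fderiv \<phi> W (u $ 1 *\<^sub>R axis 1 1 + u $ 2 *\<^sub>R axis 2 1)" by simp
    then show ?thesis by (simp add: linear_add[OF lin] linear_scale[OF lin])
  qed
  moreover have "((\<lambda>y. u $ 1 * fderiv \<phi> (V + vec2 x y) (axis 1 1) + u $ 2 * fderiv \<phi> (V + vec2 x y) (axis 2 1))
      has_integral u $ 1 * integral {- pi..pi} (\<lambda>y. fderiv \<phi> (V + vec2 x y) (axis 1 1)) + u $ 2 * 0) {- pi..pi}" for x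
  proof -
    have "(\<lambda>y. fderiv \<phi> (V + vec2 x y) v) integrable_on {- pi..pi}" for v
      by (intro integrable_continuous_real continuous_on_fderiv[OF C1]) (auto intro!: continuous_intros)
    then show ?thesis
      using I2[of x] by (intro has_integral_add has_integral_mult_right) (auto simp: has_integral_iff)
  qed
  ultimately have inner: "integral {- pi..pi} (\<lambda>y. fderiv \<phi> (V + vec2 x y) u) =
      u $ 1 * integral {- pi..pi} (\<lambda>y. fderiv \<phi> (V + vec2 x y) (axis 1 1))" for x
    by (auto intro!: integral_unique)
  have "integral {- pi..pi} (\<lambda>x. integral {- pi..pi} (\<lambda>y. fderiv \<phi> (V + vec2 x y) (axis 1 1)))
    = integral {- pi..pi} (\<lambda>y. integral {- pi..pi} (\<lambda>x. fderiv \<phi> (V + vec2 x y) (axis 1 1)))"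
    using integral_swap_continuous[of "- pi" "- pi" pi pi "\<lambda>x y. fderiv \<phi> (V + vec2 x y) (axis 1 1)"]
      cont by (simp add: case_prod_unfold)
  then show ?thesis by (simp add: inner I1)
qed

section \<open>Continuity of integrals with a weak point singularity\<close>

text \<open>
  The bound by \<open>1 / |(x, y)|\<close> is weakened to \<open>1 / (\<surd>|x| \<surd>|y|)\<close>, so that dominated convergence
  is only needed in one variable.
\<close>

lemma has_integral_inverse_sqrt_abs:
  "((\<lambda>x. 1 / sqrt \<bar>x\<bar>) has_integral 4 * sqrt b) {- b..b}" if "0 \<le> b"
proof -
  have "((\<lambda>x. 1 / sqrt \<bar>x\<bar>) has_integral 2 * (sgn b * sqrt \<bar>b\<bar>) - 2 * (sgn (- b) * sqrt \<bar>- b\<bar>)) {- b..b}"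
  proof (rule fundamental_theorem_of_calculus_interior_strong[of "{0}"])
    show "((\<lambda>x. 2 * (sgn x * sqrt \<bar>x\<bar>)) has_vector_derivative 1 / sqrt \<bar>x\<bar>) (at x)"
      if "x \<in> {- b<..<b} - {0}" for x
    proof (cases "0 < x")
      case True
      have "((\<lambda>x. 2 * sqrt x) has_real_derivative 1 / sqrt x) (at x)"
        using True by (auto intro!: derivative_eq_intros simp: field_simps)
      then have "((\<lambda>x. 2 * (sgn x * sqrt \<bar>x\<bar>)) has_real_derivative 1 / sqrt x) (at x)"
        by (rule has_field_derivative_transform_within_open[where S = "{0<..}"]) (use True in auto)
      then show ?thesis using True by (simp add: has_real_derivative_iff_has_vector_derivative)
    next
      case False
      then have x: "x < 0" using that by auto
      have "((\<lambda>x. - (2 * sqrt (- x))) has_real_derivative 1 / sqrt (- x)) (at x)"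
        using x by (auto intro!: derivative_eq_intros simp: field_simps)
      then have "((\<lambda>x. 2 * (sgn x * sqrt \<bar>x\<bar>)) has_real_derivative 1 / sqrt (- x)) (at x)"
        by (rule has_field_derivative_transform_within_open[where S = "{..<0}"]) (use x in auto)
      then show ?thesis using x by (simp add: has_real_derivative_iff_has_vector_derivative)
    qed
    have "sgn x * sqrt \<bar>x\<bar> = sqrt (max x 0) - sqrt (max (- x) 0)" for x :: real
      by (auto simp: sgn_if max_def)
    then show "continuous_on {- b..b} (\<lambda>x. 2 * (sgn x * sqrt \<bar>x\<bar>))"
      by (simp only:) (intro continuous_intros)
  qed (use that in auto)
  then show ?thesis using that by (cases "b = 0") (auto simp: sgn_if)
qed

lemma sqrt_abs_mult_le_norm: "sqrt \<bar>x\<bar> * sqrt \<bar>y\<bar> \<le> norm (vec2 x y)"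
proof -
  have "\<bar>x\<bar> \<le> norm (vec2 x y)" "\<bar>y\<bar> \<le> norm (vec2 x y)"
    using component_le_norm_cart[of "vec2 x y" 1] component_le_norm_cart[of "vec2 x y" 2] by simp_all
  then have "sqrt \<bar>x\<bar> * sqrt \<bar>y\<bar> \<le> sqrt (norm (vec2 x y)) * sqrt (norm (vec2 x y))"
    by (intro mult_mono) auto
  then show ?thesis by simp
qed

lemma continuous_on_integral_weak_singularity:
  fixes \<kappa> :: "'a::metric_space \<Rightarrow> real \<Rightarrow> real \<Rightarrow> real"
  assumes cont: "continuous_on (B \<times> ({- b..b} \<times> {- b..b} - {(0, 0)})) (\<lambda>(C, x, y). \<kappa> C x y)"
    and bound: "\<And>C x y. C \<in> B \<Longrightarrow> \<bar>x\<bar> \<le> b \<Longrightarrow> \<bar>y\<bar> \<le> b \<Longrightarrow> (x, y) \<noteq> (0, 0) \<Longrightarrow>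
      \<bar>\<kappa> C x y\<bar> \<le> M / norm (vec2 x y)"
    and "0 \<le> b" "0 \<le> M"
  shows "continuous_on B (\<lambda>C. integral {- b..b} (\<lambda>x. integral {- b..b} (\<lambda>y. \<kappa> C x y)))"
proof -
  let ?S = "{- b..b} - {0}"
  define G where "G C x = integral {- b..b} (\<lambda>y. \<kappa> C x y)" for C x
  have "continuous_on ((B \<times> ?S) \<times> cbox (- b) b) (\<lambda>(p, y). \<kappa> (fst p) (snd p) y)"
    unfolding case_prod_unfold
    by (rule continuous_on_compose2[OF cont[unfolded case_prod_unfold],
          where f = "\<lambda>p. (fst (fst p), snd (fst p), snd p)", unfolded fst_conv snd_conv])
       (auto intro!: continuous_intros)
  then have G_cont: "continuous_on (B \<times> ?S) (\<lambda>p. G (fst p) (snd p))"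
    using integral_continuous_on_param[of "B \<times> ?S" "- b" b "\<lambda>p y. \<kappa> (fst p) (snd p) y"]
    by (simp add: G_def)
  define h where "h x = M / sqrt \<bar>x\<bar> * (4 * sqrt b)" for x
  have G_bound: "norm (G C x) \<le> h x" if C: "C \<in> B" and x: "x \<in> ?S" for C x
  proof -
    have "continuous_on {- b..b} (\<lambda>y. \<kappa> C x y)"
      by (rule continuous_on_compose2[OF cont[unfolded case_prod_unfold],
          where f = "\<lambda>y. (C, x, y)", unfolded fst_conv snd_conv])
         (use C x in \<open>auto intro!: continuous_intros\<close>)
    then have int: "(\<lambda>y. \<kappa> C x y) integrable_on {- b..b}" by (rule integrable_continuous_real)
    have dom: "((\<lambda>y. M / sqrt \<bar>x\<bar> * (1 / sqrt \<bar>y\<bar>)) has_integral h x) {- b..b}"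
      unfolding h_def using has_integral_inverse_sqrt_abs[OF \<open>0 \<le> b\<close>] by (rule has_integral_mult_right)
    have "norm (\<kappa> C x y) \<le> M / sqrt \<bar>x\<bar> * (1 / sqrt \<bar>y\<bar>)" if "y \<in> ?S" for y
    proof -
      have "\<bar>\<kappa> C x y\<bar> \<le> M / norm (vec2 x y)" using bound[of C x y] C x that by auto
      also have "\<dots> \<le> M / (sqrt \<bar>x\<bar> * sqrt \<bar>y\<bar>)"
        using x that \<open>0 \<le> M\<close> by (intro divide_left_mono sqrt_abs_mult_le_norm mult_pos_pos)
          (auto simp: vec_eq_iff forall_2)
      finally show ?thesis by simp
    qed
    moreover have "(f has_integral I) {- b..b} \<longleftrightarrow> (f has_integral I) ?S" for f :: "real \<Rightarrow> real" and I
      by (rule has_integral_spike_set_eq; rule negligible_subset[of "{0}"]) auto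
    then have "((\<lambda>y. \<kappa> C x y) has_integral G C x) ?S"
      "((\<lambda>y. M / sqrt \<bar>x\<bar> * (1 / sqrt \<bar>y\<bar>)) has_integral h x) ?S"
      using integrable_integral[OF int] dom unfolding G_def by blast+
    ultimately show ?thesis
      using integral_norm_bound_integral[of "\<lambda>y. \<kappa> C x y" ?S "\<lambda>y. M / sqrt \<bar>x\<bar> * (1 / sqrt \<bar>y\<bar>)"]
      by (simp add: has_integral_iff)
  qed
  have "(\<lambda>x. (M * (4 * sqrt b)) * (1 / sqrt \<bar>x\<bar>)) integrable_on {- b..b}"
    using has_integral_inverse_sqrt_abs[OF \<open>0 \<le> b\<close>]
    by (intro integrable_on_mult_right) (auto simp: has_integral_integrable)
  then have "h integrable_on {- b..b}" by (simp add: h_def[abs_def] mult_ac)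
  then have h_int: "h integrable_on ?S"
    by (rule integrable_spike_set) (auto intro: negligible_subset[of "{0}"])
  have G_int: "G C integrable_on ?S" if "C \<in> B" for C
  proof (rule measurable_bounded_by_integrable_imp_integrable[OF _ h_int])
    have "continuous_on ?S (G C)"
      by (rule continuous_on_compose2[OF G_cont, where f = "\<lambda>x. (C, x)", unfolded fst_conv snd_conv])
         (use that in \<open>auto intro!: continuous_intros\<close>)
    then show "G C \<in> borel_measurable (lebesgue_on ?S)"
      by (rule continuous_imp_measurable_on_sets_lebesgue) auto
  qed (use that G_bound in auto)
  have "(\<lambda>n. integral ?S (G (s n))) \<longlonglongrightarrow> integral ?S (G C)"
    if "C \<in> B" "\<And>n. s n \<in> B" "s \<longlonglongrightarrow> C" for s C
  proof (rule dominated_convergence(2)[OF _ h_int])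
    show "(\<lambda>n. G (s n) x) \<longlonglongrightarrow> G C x" if "x \<in> ?S" for x
    proof -
      have "continuous_on B (\<lambda>C. G C x)"
        by (rule continuous_on_compose2[OF G_cont, where f = "\<lambda>C. (C, x)", unfolded fst_conv snd_conv])
           (use that in \<open>auto intro!: continuous_intros\<close>)
      then show ?thesis
        using \<open>C \<in> B\<close> \<open>\<And>n. s n \<in> B\<close> \<open>s \<longlonglongrightarrow> C\<close> by (auto simp: continuous_on_sequentially o_def)
    qed
  qed (use that G_int G_bound in auto)
  then have "continuous_on B (\<lambda>C. integral ?S (G C))"
    by (auto simp: continuous_on_sequentially o_def)
  moreover have "integral ?S (G C) = integral {- b..b} (G C)" for C
    by (rule integral_spike_set) (auto intro: negligible_subset[of "{0}"])
  ultimately show ?thesis by (simp add: G_def[abs_def])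
qed


section \<open>The signed distance near a crossing\<close>

lemma orthogonal_to_pair_eq:
  fixes a b x :: "real ^ 3"
  assumes "x \<bullet> a = 0" "x \<bullet> b = 0" "cross3 a b \<noteq> 0"
  shows "x = (sgn (cross3 a b) \<bullet> x) *\<^sub>R sgn (cross3 a b)"
proof -
  let ?n = "sgn (cross3 a b)"
  define y where "y = x - (?n \<bullet> x) *\<^sub>R ?n"
  have nn: "?n \<bullet> ?n = 1"
    using assms(3) by (simp add: dot_square_norm norm_sgn)
  have na: "?n \<bullet> a = 0" "?n \<bullet> b = 0"
    by (simp_all add: sgn_div_norm inner_commute dot_cross_self)
  have y: "y \<bullet> a = 0" "y \<bullet> b = 0" "y \<bullet> ?n = 0"
    using assms(1,2) na nn by (simp_all add: y_def inner_diff_left inner_commute[of ?n x])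
  have "cross3 a b = norm (cross3 a b) *\<^sub>R ?n"
    by (simp add: sgn_div_norm assms(3))
  then have "y \<bullet> cross3 a b = 0" using y(3) by (metis inner_scaleR_right mult_zero_right)
  moreover have "cross3 y (cross3 a b) = 0" using y(1,2) by (simp add: Lagrange)
  ultimately have "y = 0" using assms(3) norm_and_cross_eq_0 by blast
  then show ?thesis by (simp add: y_def)
qed

lemma critical_point_Delta_eq:
  assumes "C \<in> regular" "critical_point k0 C V" "tau3 k0 C V \<noteq> 0"
  shows "Delta k0 C V = (sgn (tau3 k0 C V) \<bullet> Delta k0 C V) *\<^sub>R sgn (tau3 k0 C V)"
  using orthogonal_to_pair_eq[of "Delta k0 C V" "vel1 k0 C V" "vel2 k0 C V"] assms
  by (simp add: critical_point_def tau3_eq)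

lemma continuous_on_tau3:
  assumes "S \<subseteq> regular" "continuous_on S Vh"
  shows "continuous_on S (\<lambda>C. tau3 k0 C (Vh C))"
proof -
  have "continuous_on S (\<lambda>C. (C, Vh C))" using assms(2) by (intro continuous_intros)
  then have "continuous_on S (\<lambda>C. vel1 k0 C (Vh C))" "continuous_on S (\<lambda>C. vel2 k0 C (Vh C))"
    using continuous_on_compose2[OF C1_on_imp_continuous_on[OF C1_on_vel1], of S "\<lambda>C. (C, Vh C)" k0]
      continuous_on_compose2[OF C1_on_imp_continuous_on[OF C1_on_vel2], of S "\<lambda>C. (C, Vh C)" k0]
      assms(1) by auto
  then have "continuous_on S (\<lambda>C. cross3 (vel1 k0 C (Vh C)) (vel2 k0 C (Vh C)))"
    by (rule continuous_on_cross)
  then show ?thesis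
    by (rule continuous_on_eq) (use assms(1) tau3_eq in auto)
qed

lemma continuous_on_Delta:
  assumes "S \<subseteq> regular \<times> UNIV"
  shows "continuous_on S (Delta2 k0)"
  using C1_on_imp_continuous_on[OF C1_on_Delta] assms continuous_on_subset by blast

lemma continuous_on_signed_dist:
  assumes "S \<subseteq> regular" "continuous_on S Vh" "\<And>C. C \<in> S \<Longrightarrow> tau3 k0 C (Vh C) \<noteq> 0"
  shows "continuous_on S (signed_dist k0 Vh)"
proof -
  have "continuous_on S (\<lambda>C. Delta2 k0 (C, Vh C))"
    by (rule continuous_on_compose2[OF continuous_on_Delta[OF subset_refl], of S "\<lambda>C. (C, Vh C)"])
       (use assms in \<open>auto intro!: continuous_intros\<close>)
  then show ?thesis
    unfolding signed_dist_eq[abs_def]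
    using assms by (intro continuous_on_inner continuous_on_sgn continuous_on_tau3) auto
qed

subsection \<open>Differentiability away from crossings\<close>

text \<open>
  An envelope theorem: the derivative of a minimum value does not see the motion of the
  minimum point, of which only the continuity is used.
\<close>

lemma has_derivative_minimum_value:
  fixes G :: "'a::euclidean_space \<times> 'b::euclidean_space \<Rightarrow> real"
  assumes G: "C1_on G (S \<times> UNIV)" and S: "open S" "C \<in> S" and v: "continuous_on S v"
    and min: "\<And>x y. x \<in> S \<Longrightarrow> y \<in> S \<Longrightarrow> G (x, v x) \<le> G (x, v y)"
  shows "((\<lambda>x. G (x, v x)) has_derivative (\<lambda>h. fderiv G (C, v C) (h, 0))) (at C)"
  unfolding has_derivative_at_alt
proof (intro conjI allI impI)
  have mem: "(C, v C) \<in> S \<times> UNIV" using S by simp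
  have bl: "bounded_linear (fderiv G (C, v C))"
    using C1_on_linear_fderiv[OF G mem] by (simp add: linear_conv_bounded_linear)
  show "bounded_linear (\<lambda>h. fderiv G (C, v C) (h, 0))"
    by (rule bounded_linear_compose[OF bl])
       (intro bounded_linear_Pair bounded_linear_ident bounded_linear_zero)
  fix e :: real assume "0 < e"
  obtain \<delta> where \<delta>: "0 < \<delta>" "ball (C, v C) \<delta> \<subseteq> S \<times> UNIV"
    "\<And>x y. x \<in> ball (C, v C) \<delta> \<Longrightarrow> y \<in> ball (C, v C) \<delta> \<Longrightarrow>
       norm (G y - G x - fderiv G (C, v C) (y - x)) \<le> e * norm (y - x)"
    by (rule C1_on_strict[OF G _ mem \<open>0 < e\<close>]) (use S open_Times in blast)+
  have "isCont v C" using v S continuous_on_eq_continuous_at by blast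
  then obtain d1 where d1: "0 < d1" "\<And>x. dist x C < d1 \<Longrightarrow> dist (v x) (v C) < \<delta> / 2"
    unfolding continuous_at_eps_delta using \<delta>(1) half_gt_zero by blast
  obtain d2 where d2: "0 < d2" "ball C d2 \<subseteq> S" using S openE by blast
  have "norm (G (y, v y) - G (C, v C) - fderiv G (C, v C) (y - C, 0)) \<le> e * norm (y - C)"
    if y: "norm (y - C) < min (\<delta> / 2) (min d1 d2)" for y
  proof -
    have yS: "y \<in> S" using y d2(2) by (auto simp: dist_norm norm_minus_commute)
    have "v y \<in> ball (v C) (\<delta> / 2)" using d1(2)[of y] y by (simp add: dist_norm norm_minus_commute)
    moreover have "y \<in> ball C (\<delta> / 2)" using y by (simp add: dist_norm norm_minus_commute)
    ultimately have m: "(y, v y) \<in> ball (C, v C) \<delta>" "(C, v y) \<in> ball (C, v C) \<delta>"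
      "(y, v C) \<in> ball (C, v C) \<delta>" "(C, v C) \<in> ball (C, v C) \<delta>"
      using \<delta>(1) by (intro pair_in_ball; simp)+
    have "norm (G (y, v C) - G (C, v C) - fderiv G (C, v C) (y - C, 0)) \<le> e * norm (y - C)"
      using \<delta>(3)[OF m(4,3)] by (simp add: norm_Pair)
    moreover have "norm (G (y, v y) - G (C, v y) - fderiv G (C, v C) (y - C, 0)) \<le> e * norm (y - C)"
      using \<delta>(3)[OF m(2,1)] by (simp add: norm_Pair)
    moreover have "G (y, v y) \<le> G (y, v C)" "G (C, v C) \<le> G (C, v y)"
      using min yS S(2) by blast+
    ultimately show ?thesis unfolding real_norm_def by linarith
  qed
  then show "\<exists>d>0. \<forall>y. norm (y - C) < d \<longrightarrow>
      norm (G (y, v y) - G (C, v C) - fderiv G (C, v C) (y - C, 0)) \<le> e * norm (y - C)"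
    using \<delta>(1) d1(1) d2(1) by (intro exI[of _ "min (\<delta> / 2) (min d1 d2)"]) auto
qed

lemma signed_dist_has_derivative:
  assumes S: "open S" "C \<in> S" "S \<subseteq> regular" and Vh: "continuous_on S Vh"
    and crit: "\<And>C. C \<in> S \<Longrightarrow> critical_point k0 C (Vh C)"
    and \<tau>: "\<And>C. C \<in> S \<Longrightarrow> tau3 k0 C (Vh C) \<noteq> 0"
    and min: "\<And>x y. x \<in> S \<Longrightarrow> y \<in> S \<Longrightarrow> orbit_dist2 k0 x (Vh x) \<le> orbit_dist2 k0 x (Vh y)"
    and nz: "Delta k0 C (Vh C) \<noteq> 0"
  shows "(signed_dist k0 Vh has_derivative
     (\<lambda>h. sgn (tau3 k0 C (Vh C)) \<bullet> fderiv (Delta2 k0) (C, Vh C) (h, 0))) (at C)"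
proof -
  let ?s = "signed_dist k0 Vh" and ?D = "Delta k0 C (Vh C)" and ?n = "sgn (tau3 k0 C (Vh C))"
  let ?G = "\<lambda>x. Delta2 k0 x \<bullet> Delta2 k0 x" and ?L = "fderiv (Delta2 k0) (C, Vh C)"
  let ?f = "\<lambda>C. ?G (C, Vh C)"
  \<comment> \<open>The squared signed distance is \<open>d\<^sup>2\<close> at the minimum point, and the sign is locally constant.\<close>
  have D_eq: "Delta k0 x (Vh x) = ?s x *\<^sub>R sgn (tau3 k0 x (Vh x))" if "x \<in> S" for x
    unfolding signed_dist_eq by (rule critical_point_Delta_eq) (use that S crit \<tau> in auto)
  have s2: "?f x = (?s x)\<^sup>2" if "x \<in> S" for x
    using D_eq[OF that] \<tau>[OF that] by (simp add: dot_square_norm norm_sgn power_mult_distrib)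
  have sC: "?s C \<noteq> 0" using D_eq[OF S(2)] nz by auto
  have DD: "(Delta2 k0 has_derivative ?L) (at (C, Vh C))"
    using S by (intro C1_on_has_derivative[OF C1_on_Delta]) auto
  have "(?G has_derivative (\<lambda>h. ?D \<bullet> ?L h + ?L h \<bullet> ?D)) (at (C, Vh C))"
    using has_derivative_inner[OF DD DD] by simp
  then have "fderiv ?G (C, Vh C) h = 2 * (?D \<bullet> ?L h)" for h
    by (simp add: fderiv_eqI inner_commute)
  moreover have "(?f has_derivative (\<lambda>h. fderiv ?G (C, Vh C) (h, 0))) (at C)"
  proof (rule has_derivative_minimum_value[where S = S and G = ?G and v = Vh])
    show "C1_on ?G (S \<times> UNIV)"
      by (intro C1_on_inner C1_on_subset[OF C1_on_Delta]) (use S(3) in auto)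
    show "?G (x, Vh x) \<le> ?G (x, Vh y)" if "x \<in> S" "y \<in> S" for x y
      using min[OF that] by (simp add: orbit_dist2_eq)
  qed (use S Vh in auto)
  ultimately have f': "(?f has_derivative (\<lambda>h. 2 * (?D \<bullet> ?L (h, 0)))) (at C)" by simp
  have fC: "?f C = (?s C)\<^sup>2" "0 < ?f C" using s2[OF S(2)] sC by auto
  have "((\<lambda>x. sqrt (?f x)) has_derivative
      (\<lambda>h. 2 * (?D \<bullet> ?L (h, 0)) * (inverse (sqrt (?f C)) / 2))) (at C)"
    by (rule DERIV_compose_FDERIV[OF DERIV_real_sqrt f']) (use fC in simp)
  then have "((\<lambda>x. sgn (?s C) * sqrt (?f x)) has_derivative
      (\<lambda>h. sgn (?s C) * (2 * (?D \<bullet> ?L (h, 0)) * (inverse (sqrt (?f C)) / 2)))) (at C)"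
    by (rule has_derivative_mult_right)
  moreover have "sgn (?s C) * (2 * (?D \<bullet> ?L (h, 0)) * (inverse (sqrt (?f C)) / 2)) = ?n \<bullet> ?L (h, 0)"
    for h
  proof -
    have "sgn (?s C) * inverse \<bar>?s C\<bar> = inverse (?s C)"
      using sC by (simp add: sgn_if)
    then have "sgn (?s C) * (2 * (?D \<bullet> ?L (h, 0)) * (inverse (sqrt (?f C)) / 2))
        = inverse (?s C) * (?D \<bullet> ?L (h, 0))"
      unfolding fC(1) by (simp add: mult_ac)
    also have "\<dots> = inverse (?s C) * (?s C * (?n \<bullet> ?L (h, 0)))"
      using arg_cong[OF D_eq[OF S(2)], of "\<lambda>d. d \<bullet> ?L (h, 0)"] by simp
    finally show ?thesis using sC by simp
  qed
  ultimately have main: "((\<lambda>x. sgn (?s C) * sqrt (?f x)) has_derivative (\<lambda>h. ?n \<bullet> ?L (h, 0))) (at C)"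
    by simp
  have "continuous_on S ?s"
    by (rule continuous_on_signed_dist) (use S Vh \<tau> in auto)
  then have "open {x \<in> S. 0 < ?s x * ?s C}"
    using S(1) continuous_open_preimage[of S "\<lambda>x. ?s x * ?s C" "{0<..}"]
    by (simp add: vimage_def Int_def continuous_on_mult continuous_on_const)
  then show ?thesis
  proof (rule has_derivative_transform_within_open[OF main])
    show "C \<in> {x \<in> S. 0 < ?s x * ?s C}" using S(2) sC by (simp add: zero_less_mult_iff) linarith
    show "sgn (?s C) * sqrt (?f x) = ?s x" if "x \<in> {x \<in> S. 0 < ?s x * ?s C}" for x
      using that s2[of x] by (auto simp: zero_less_mult_iff sgn_if)
  qed
qed

subsection \<open>Separation of the orbits away from the minimum point\<close>

lemma position_add_int_2pi:
  assumes "E \<in> delaunay_domain"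
  shows "position k0 E (l + 2 * pi * of_int n) = position k0 E l"
proof -
  have nat: "position k0 E (l + 2 * pi * real m) = position k0 E l" for l m
  proof (induction m)
    case (Suc m)
    have "position k0 E (l + 2 * pi * real (Suc m)) = position k0 E ((l + 2 * pi * real m) + 2 * pi)"
      by (simp add: algebra_simps)
    then show ?case using Suc position_add_2pi[OF assms] by simp
  qed simp
  show ?thesis
  proof (cases "0 \<le> n")
    case True
    then show ?thesis using nat[of l "nat n"] by simp
  next
    case False
    then show ?thesis using nat[of "l + 2 * pi * of_int n" "nat (- n)"] by simp
  qed
qed

text \<open>
  Seen from a crossing point, the centred fundamental domain \<open>|u\<^sub>i| \<le> \<pi>\<close> contains no other one.
\<close>

lemma unique_crossing_point:
  assumes C: "C \<in> regular" and one: "only_one_crossing_point k0 C"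
    and zero: "Delta k0 C V = 0" "Delta k0 C (V + u) = 0" and u: "\<bar>u $ 1\<bar> \<le> pi" "\<bar>u $ 2\<bar> \<le> pi"
  shows "u = 0"
proof -
  \<comment> \<open>\<open>r W\<close> is the representative of \<open>W\<close> in the torus.\<close>
  define m where "m W i = \<lfloor>W $ i / (2 * pi)\<rfloor>" for W :: "real ^ 2" and i
  define r where "r W = (\<chi> i. W $ i + 2 * pi * of_int (- m W i))" for W :: "real ^ 2"
  have "r W \<in> torus" for W
  proof -
    have "of_int (m W i) \<le> W $ i / (2 * pi)" "W $ i / (2 * pi) < of_int (m W i) + 1" for i
      unfolding m_def using floor_correct[of "W $ i / (2 * pi)"] by simp_all
    then have "of_int (m W i) * (2 * pi) \<le> W $ i" "W $ i < (of_int (m W i) + 1) * (2 * pi)" for i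
      using pos_le_divide_eq[of "2 * pi"] pos_divide_less_eq[of "2 * pi"] by simp_all
    then show ?thesis unfolding torus_def r_def by (auto simp: algebra_simps)
  qed
  moreover have "Delta k0 C (r W) = Delta k0 C W" for W
    unfolding Delta_def r_def vec_lambda_beta
    using C position_add_int_2pi[of "fst C" k0] position_add_int_2pi[of "snd C" k0]
    by (simp only: regular_iff)
  ultimately have "r (V + u) = r V"
    using one zero unfolding only_one_crossing_point_def orbit_dist_def by (metis norm_zero)
  then have eq: "u $ i = 2 * pi * of_int (m (V + u) i - m V i)" for i
    by (simp add: r_def vec_eq_iff algebra_simps)
  have "u $ i = 0" if "\<bar>u $ i\<bar> \<le> pi" for i
  proof -
    have "pi * (2 * \<bar>of_int (m (V + u) i - m V i)\<bar>) \<le> pi * 1"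
      using that unfolding eq[of i] by (simp add: abs_mult)
    then have "2 * \<bar>of_int (m (V + u) i - m V i)\<bar> \<le> (1 :: real)"
      using mult_le_cancel_left_pos[OF pi_gt_zero] by blast
    moreover have "k = 0" if "2 * \<bar>of_int k\<bar> \<le> (1 :: real)" for k :: int
    proof (rule ccontr)
      assume "k \<noteq> 0"
      then have "1 \<le> \<bar>k\<bar>" by simp
      then have "1 \<le> \<bar>real_of_int k\<bar>" by (metis of_int_abs of_int_1_le_iff)
      then show False using that by linarith
    qed
    ultimately have "m (V + u) i - m V i = 0" by blast
    then show ?thesis using eq[of i] by simp
  qed
  then show ?thesis using u by (simp add: vec_eq_iff forall_2)
qed

text \<open>
  Near the crossing configuration the continuation \<open>V\<^sub>h\<close> minimizes \<open>d\<^sup>2\<close> among its own nearby values,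
  the distance is bounded below by a multiple of \<open>|V - V\<^sub>h|\<close> for \<open>V\<close> near \<open>V\<^sub>h\<close>, and it does not vanish
  elsewhere on the fundamental domain centred at \<open>V\<^sub>h\<close>.
\<close>

lemma neighbourhood_of_crossing:
  assumes Vh: "min_point_continuation k0 U Vh" and Cc: "Cc \<in> U"
    and zero: "Delta k0 Cc (Vh Cc) = 0" and \<tau>: "tau3 k0 Cc (Vh Cc) \<noteq> 0"
    and one: "only_one_crossing_point k0 Cc"
  obtains \<delta> \<rho> c where "0 < \<delta>" "0 < \<rho>" "0 < c" "cball Cc \<delta> \<subseteq> U"
    "\<And>C. C \<in> cball Cc \<delta> \<Longrightarrow> critical_point k0 C (Vh C) \<and> tau3 k0 C (Vh C) \<noteq> 0"
    "\<And>C C'. C \<in> cball Cc \<delta> \<Longrightarrow> C' \<in> cball Cc \<delta> \<Longrightarrow>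
       orbit_dist2 k0 C (Vh C) \<le> orbit_dist2 k0 C (Vh C')"
    "\<And>C u. C \<in> cball Cc \<delta> \<Longrightarrow> norm u < \<rho> \<Longrightarrow> c * norm u \<le> norm (Delta k0 C (Vh C + u))"
    "\<And>C u. C \<in> cball Cc \<delta> \<Longrightarrow> \<bar>u $ 1\<bar> \<le> pi \<Longrightarrow> \<bar>u $ 2\<bar> \<le> pi \<Longrightarrow> u \<noteq> 0 \<Longrightarrow>
       Delta k0 C (Vh C + u) \<noteq> 0"
proof -
  have U: "open U" "U \<subseteq> regular" "continuous_on U Vh"
    and crit: "\<And>C. C \<in> U \<Longrightarrow> critical_point k0 C (Vh C)"
    using Vh local_min_imp_critical unfolding min_point_continuation_def by blast+
  have Ccr: "Cc \<in> regular" using U(2) Cc by blast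
  obtain d1 c where 1: "0 < d1" "0 < c" 
    "\<And>C V W. C \<in> ball Cc d1 \<Longrightarrow> V \<in> ball (Vh Cc) d1 \<Longrightarrow> W \<in> ball (Vh Cc) d1 \<Longrightarrow>
       critical_point k0 C V \<Longrightarrow> orbit_dist2 k0 C V + c * (norm (W - V))\<^sup>2 \<le> orbit_dist2 k0 C W"
    by (rule critical_point_quadratic_growth[OF Ccr \<tau> zero]) blast
  have "isCont Vh Cc" using U Cc continuous_on_eq_continuous_at by blast
  then obtain d2 where 2: "0 < d2" "\<And>C. dist C Cc < d2 \<Longrightarrow> dist (Vh C) (Vh Cc) < d1 / 2"
    unfolding continuous_at_eps_delta using 1(1) half_gt_zero by blast
  have "isCont (\<lambda>C. tau3 k0 C (Vh C)) Cc"
    using continuous_on_tau3[OF U(2,3)] U(1) Cc continuous_on_eq_continuous_at by blast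
  then have "\<forall>\<^sub>F C in nhds Cc. tau3 k0 C (Vh C) \<noteq> 0"
    using \<tau> tendsto_at_iff_tendsto_nhds[of "\<lambda>C. tau3 k0 C (Vh C)" Cc]
    by (intro tendsto_imp_eventually_ne) (auto simp: isCont_def)
  then obtain d3 where 3: "0 < d3" "\<And>C. dist C Cc < d3 \<Longrightarrow> tau3 k0 C (Vh C) \<noteq> 0"
    unfolding eventually_nhds_metric by blast
  obtain d4 where 4: "0 < d4" "cball Cc d4 \<subseteq> U" using U(1) Cc open_contains_cball by blast
  \<comment> \<open>Away from \<open>V\<^sub>h\<close>, on the compact set \<open>K\<close>, positivity of \<open>d\<close> is inherited by nearby configurations.\<close>
  define \<rho> where "\<rho> = d1 / 2"
  define K where "K = {u :: real ^ 2. \<bar>u $ 1\<bar> \<le> pi \<and> \<bar>u $ 2\<bar> \<le> pi \<and> \<rho> \<le> norm u}"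
  have "K = cbox (vec2 (- pi) (- pi)) (vec2 pi pi) \<inter> {u. \<rho> \<le> norm u}"
    by (auto simp: K_def mem_box_cart forall_2)
  moreover have "closed {u :: real ^ 2. \<rho> \<le> norm u}"
    by (intro closed_Collect_le continuous_intros)
  ultimately have K: "compact K" by auto
  let ?f = "\<lambda>p. Delta k0 (fst p) (Vh (fst p) + snd p)"
  have "continuous_on (cball Cc d4 \<times> K) (\<lambda>p. Delta2 k0 (fst p, Vh (fst p) + snd p))"
    by (rule continuous_on_compose2[OF continuous_on_Delta[OF subset_refl]])
       (use 4(2) U in \<open>auto intro!: continuous_intros continuous_on_compose2[OF U(3)]\<close>)
  then have f: "continuous_on (cball Cc d4 \<times> K) ?f" by simp
  have "\<exists>d5>0. d5 \<le> d4 \<and> (\<forall>C u. dist C Cc \<le> d5 \<longrightarrow> u \<in> K \<longrightarrow> ?f (C, u) \<noteq> 0)"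
  proof (cases "K = {}")
    case False
    have "continuous_on K (\<lambda>u. norm (?f (Cc, u)))"
      by (intro continuous_on_norm continuous_on_compose2[OF f]) (use 4(1) in \<open>auto intro!: continuous_intros\<close>)
    then obtain u0 where u0: "u0 \<in> K" "\<And>u. u \<in> K \<Longrightarrow> norm (?f (Cc, u0)) \<le> norm (?f (Cc, u))"
      using continuous_attains_inf[OF K False] by blast
    have "?f (Cc, u0) \<noteq> 0"
    proof
      assume "?f (Cc, u0) = 0"
      then have "u0 = 0"
        using unique_crossing_point[OF Ccr one zero, of u0] u0(1) by (simp add: K_def)
      then show False using u0(1) 1(1) by (simp add: K_def \<rho>_def)
    qed
    then have pos: "0 < norm (?f (Cc, u0))" by simp
    have "uniformly_continuous_on (cball Cc d4 \<times> K) ?f"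
      using f K by (intro compact_uniformly_continuous compact_Times) auto
    then obtain d where d: "0 < d" "\<And>p q. p \<in> cball Cc d4 \<times> K \<Longrightarrow> q \<in> cball Cc d4 \<times> K \<Longrightarrow>
        dist q p < d \<Longrightarrow> dist (?f q) (?f p) < norm (?f (Cc, u0))"
      using pos unfolding uniformly_continuous_on_def by blast
    have "?f (C, u) \<noteq> 0" if "dist C Cc \<le> min (d / 2) d4" "u \<in> K" for C u
    proof
      assume z: "?f (C, u) = 0"
      have "dist (?f (C, u)) (?f (Cc, u)) < norm (?f (Cc, u0))"
        using that 4(1) d(1) by (intro d(2)) (auto simp: dist_commute dist_Pair_Pair)
      then show False using u0(2)[OF that(2)] z by simp
    qed
    then show ?thesis using d(1) 4(1) by (intro exI[of _ "min (d / 2) d4"]) auto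
  qed (use 4 in auto)
  then obtain d5 where 5: "0 < d5" "\<And>C u. dist C Cc \<le> d5 \<Longrightarrow> u \<in> K \<Longrightarrow> ?f (C, u) \<noteq> 0" by blast
  define \<delta> where "\<delta> = min (d1 / 2) (min (d2 / 2) (min (d3 / 2) (min d4 d5)))"
  have \<delta>: "0 < \<delta>" "\<delta> < d1" "\<delta> < d2" "\<delta> < d3" "\<delta> \<le> d4" "\<delta> \<le> d5"
    using 1 2 3 4 5 by (auto simp: \<delta>_def min_def)
  have CU: "C \<in> U" "C \<in> ball Cc d1" "Vh C \<in> ball (Vh Cc) (d1 / 2)" "Vh C \<in> ball (Vh Cc) d1"
    if "C \<in> cball Cc \<delta>" for C
    using that \<delta> 4(2) 2(2)[of C] 1(1) by (auto simp: dist_commute)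
  have near: "sqrt c * norm u \<le> norm (Delta k0 C (Vh C + u))" if C: "C \<in> cball Cc \<delta>" and u: "norm u < \<rho>" for C u
  proof -
    have "dist (Vh Cc) (Vh C + u) \<le> dist (Vh Cc) (Vh C) + norm u"
      using dist_triangle[of "Vh Cc" "Vh C + u" "Vh C"] by (simp add: dist_norm)
    then have "Vh C + u \<in> ball (Vh Cc) d1" using CU(3)[OF C] u by (simp add: \<rho>_def)
    then have "orbit_dist2 k0 C (Vh C) + c * (norm u)\<^sup>2 \<le> orbit_dist2 k0 C (Vh C + u)"
      using 1(3)[OF CU(2,4)[OF C] _ crit[OF CU(1)[OF C]], of "Vh C + u"] by simp
    moreover have "0 \<le> orbit_dist2 k0 C (Vh C)" by (simp add: orbit_dist2_eq)
    moreover have "(sqrt c * norm u)\<^sup>2 = c * (norm u)\<^sup>2" using 1(2) by (simp add: power_mult_distrib)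
    ultimately have "(sqrt c * norm u)\<^sup>2 \<le> (norm (Delta k0 C (Vh C + u)))\<^sup>2"
      unfolding orbit_dist2_def orbit_dist_def by linarith
    then show ?thesis by (rule power2_le_imp_le) simp
  qed
  show thesis
  proof (rule that[of \<delta> \<rho> "sqrt c"])
    show "cball Cc \<delta> \<subseteq> U" using CU(1) by blast
    show "critical_point k0 C (Vh C) \<and> tau3 k0 C (Vh C) \<noteq> 0" if "C \<in> cball Cc \<delta>" for C
      using CU(1)[OF that] crit 3(2)[of C] that \<delta>(4) by (auto simp: dist_commute)
    show "orbit_dist2 k0 C (Vh C) \<le> orbit_dist2 k0 C (Vh C')"
      if C: "C \<in> cball Cc \<delta>" and C': "C' \<in> cball Cc \<delta>" for C C'
    proof -
      have "0 \<le> c * (norm (Vh C' - Vh C))\<^sup>2" using 1(2) by simp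
      then show ?thesis
        using 1(3)[OF CU(2,4)[OF C] CU(4)[OF C'] crit[OF CU(1)[OF C]]] by linarith
    qed
    show "Delta k0 C (Vh C + u) \<noteq> 0"
      if C: "C \<in> cball Cc \<delta>" and u: "\<bar>u $ 1\<bar> \<le> pi" "\<bar>u $ 2\<bar> \<le> pi" "u \<noteq> 0" for C u
    proof (cases "norm u < \<rho>")
      case True
      have "0 < sqrt c * norm u" using 1(2) u(3) by simp
      then show ?thesis using near[OF C True] by auto
    next
      case False
      then have "u \<in> K" using u by (simp add: K_def)
      then show ?thesis using 5(2)[of C u] C \<delta>(6) by (simp add: dist_commute)
    qed
  qed (use \<delta> 1 near in \<open>auto simp: \<rho>_def\<close>)
qed


section \<open>The averaged gradient along the level set of the signed distance\<close>

subsection \<open>Derivatives with respect to the elements\<close>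

text \<open>The derivative of the position of the asteroid, hence of \<open>\<Delta>\<close>, in the direction \<open>w\<close> of \<open>Y\<close>.\<close>

definition shiftY :: "real \<Rightarrow> config \<Rightarrow> real ^ 2 \<Rightarrow> real ^ 4 \<Rightarrow> real ^ 3" where
  "shiftY k0 C V w = fderiv (pos k0) (fst C, V $ 1) ((0, w), 0)"

lemma linear_shiftY:
  assumes "C \<in> regular" shows "linear (shiftY k0 C V)"
proof -
  have l: "linear (fderiv (pos k0) (fst C, V $ 1))"
    using assms by (intro C1_on_linear_fderiv[OF C1_on_position]) (auto simp: regular_iff)
  show ?thesis
  proof (rule linearI)
    show "shiftY k0 C V (x + y) = shiftY k0 C V x + shiftY k0 C V y" for x y
      using linear_add[OF l, of "((0, x), 0)" "((0, y), 0)"] by (simp add: shiftY_def)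
    show "shiftY k0 C V (r *\<^sub>R x) = r *\<^sub>R shiftY k0 C V x" for r x
      using linear_scale[OF l, of r "((0, x), 0)"] by (simp add: shiftY_def)
  qed
qed

lemma continuous_on_shiftY:
  assumes "continuous_on S c" "continuous_on S v" "continuous_on S w" "c ` S \<subseteq> regular"
  shows "continuous_on S (\<lambda>s. shiftY k0 (c s) (v s) (w s))"
  unfolding shiftY_def
proof (rule continuous_on_fderiv[OF C1_on_position])
  show "continuous_on S (\<lambda>s. (fst (c s), v s $ 1))" using assms by (intro continuous_intros)
  show "continuous_on S (\<lambda>s. ((0, w s), 0))" using assms by (intro continuous_intros)
  show "(\<lambda>s. (fst (c s), v s $ 1)) ` S \<subseteq> kepler_domain" using assms(4) by (auto simp: regular_iff)
qed

lemma continuous_on_vel: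
  fixes c :: "'s::t2_space \<Rightarrow> config"
  assumes "continuous_on S c" "continuous_on S v" "c ` S \<subseteq> regular"
  shows "continuous_on S (\<lambda>s. vel1 k0 (c s) (v s))" "continuous_on S (\<lambda>s. vel2 k0 (c s) (v s))"
    "continuous_on S (\<lambda>s. Delta k0 (c s) (v s))" "continuous_on S (\<lambda>s. tau3 k0 (c s) (v s))"
    "continuous_on S (\<lambda>s. position k0 (snd (c s)) (v s $ 2))"
proof -
  have cv: "continuous_on S (\<lambda>s. (c s, v s))" using assms by (intro continuous_intros)
  have sub: "(\<lambda>s. (c s, v s)) ` S \<subseteq> config_domain" using assms(3) by auto
  show v: "continuous_on S (\<lambda>s. vel1 k0 (c s) (v s))" "continuous_on S (\<lambda>s. vel2 k0 (c s) (v s))"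
    "continuous_on S (\<lambda>s. Delta k0 (c s) (v s))"
    using continuous_on_compose2[OF C1_on_imp_continuous_on[OF C1_on_vel1] cv sub]
      continuous_on_compose2[OF C1_on_imp_continuous_on[OF C1_on_vel2] cv sub]
      continuous_on_compose2[OF C1_on_imp_continuous_on[OF C1_on_Delta] cv sub] by simp_all
  have "continuous_on S (\<lambda>s. cross3 (vel1 k0 (c s) (v s)) (vel2 k0 (c s) (v s)))"
    by (rule continuous_on_cross[OF v(1,2)])
  then show "continuous_on S (\<lambda>s. tau3 k0 (c s) (v s))"
  proof (rule continuous_on_eq)
    show "cross3 (vel1 k0 (c s) (v s)) (vel2 k0 (c s) (v s)) = tau3 k0 (c s) (v s)" if "s \<in> S" for s
      by (rule tau3_eq[symmetric]) (use assms(3) that in blast)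
  qed
  show "continuous_on S (\<lambda>s. position k0 (snd (c s)) (v s $ 2))"
    by (rule continuous_on_compose2[OF C1_on_imp_continuous_on[OF C1_on_position[of k0]],
          where f = "\<lambda>s. (snd (c s), v s $ 2)", unfolded fst_conv snd_conv])
       (use assms in \<open>auto simp: regular_iff intro!: continuous_intros\<close>)
qed

lemma has_derivative_inverse_norm:
  fixes f :: "'a::real_normed_vector \<Rightarrow> 'b::real_inner"
  assumes "(f has_derivative f') (at x)" "f x \<noteq> 0"
  shows "((\<lambda>x. 1 / norm (f x)) has_derivative (\<lambda>h. - (f x \<bullet> f' h) / norm (f x) ^ 3)) (at x)"
proof -
  have "((\<lambda>x. norm (f x)) has_derivative (\<lambda>h. f' h \<bullet> sgn (f x))) (at x)"
    using has_derivative_compose[OF assms(1) has_derivative_norm[OF assms(2)]] by simp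
  from DERIV_compose_FDERIV[OF DERIV_inverse this] assms(2)
  have "((\<lambda>x. inverse (norm (f x))) has_derivative
      (\<lambda>h. (f' h \<bullet> sgn (f x)) * - (inverse (norm (f x)) ^ Suc (Suc 0)))) (at x)" by simp
  moreover have "(f' h \<bullet> sgn (f x)) * - (inverse (norm (f x)) ^ Suc (Suc 0))
      = - (f x \<bullet> f' h) / norm (f x) ^ 3" for h
    by (simp add: sgn_div_norm inner_commute power3_eq_cube field_simps)
  ultimately show ?thesis by (simp add: inverse_eq_divide)
qed

lemma inner_grad:
  assumes "(f has_derivative f') (at x)"
  shows "w \<bullet> grad f x = f' w"
proof -
  have l: "linear f'" using has_derivative_linear[OF assms] .
  have "f' w = f' (\<Sum>i\<in>UNIV. (w $ i) *\<^sub>R axis i 1)"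
    using basis_expansion[of w] by (simp add: scalar_mult_eq_scaleR)
  also have "\<dots> = (\<Sum>i\<in>UNIV. w $ i * f' (axis i 1))"
    by (simp add: linear_sum[OF l] linear_scale[OF l])
  finally show ?thesis by (simp add: grad_def inner_vec_def fderiv_eqI[OF assms])
qed

text \<open>
  Up to the factor \<open>- \<mu> k\<^sub>0\<^sup>2\<close>, the derivative of the perturbing function in the direction \<open>w\<close> of \<open>Y\<close>,
  where \<open>d \<noteq> 0\<close>.
\<close>

definition forcing :: "real \<Rightarrow> config \<Rightarrow> real ^ 4 \<Rightarrow> real ^ 2 \<Rightarrow> real" where
  "forcing k0 C w V = (Delta k0 C V \<bullet> shiftY k0 C V w) / norm (Delta k0 C V) ^ 3
     + (shiftY k0 C V w \<bullet> position k0 (snd C) (V $ 2)) / norm (position k0 (snd C) (V $ 2)) ^ 3"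

lemma inner_grad_Y_R:
  assumes C: "C \<in> regular" and nz: "Delta k0 C V \<noteq> 0"
  shows "w \<bullet> grad_Y_R k0 \<mu> C V = - (\<mu> * k0\<^sup>2) * forcing k0 C w V"
proof -
  obtain L Y E' where C_eq: "C = ((L, Y), E')" by (metis prod.collapse)
  define X' where "X' = position k0 E' (V $ 2)"
  have mem: "((L, Y), V $ 1) \<in> kepler_domain" using C by (simp add: C_eq regular_iff)
  have "((\<lambda>Y. ((L, Y), V $ 1)) has_derivative (\<lambda>h. ((0, h), 0))) (at Y)"
    by (auto intro!: derivative_eq_intros)
  from has_derivative_compose[OF this C1_on_has_derivative[OF C1_on_position mem]]
  have X: "((\<lambda>Y. position k0 (L, Y) (V $ 1)) has_derivative shiftY k0 C V) (at Y)"
    by (simp add: shiftY_def[abs_def] C_eq)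
  then have D: "((\<lambda>Y. position k0 (L, Y) (V $ 1) - X') has_derivative shiftY k0 C V) (at Y)"
    using has_derivative_diff[OF X has_derivative_const] by simp
  have Dl: "position k0 (L, Y) (V $ 1) - X' = Delta k0 C V" by (simp add: Delta_def C_eq X'_def)
  have 1: "((\<lambda>Y. 1 / norm (position k0 (L, Y) (V $ 1) - X')) has_derivative
      (\<lambda>h. - (Delta k0 C V \<bullet> shiftY k0 C V h) / norm (Delta k0 C V) ^ 3)) (at Y)"
    using has_derivative_inverse_norm[OF D] nz unfolding Dl by simp
  have 2: "((\<lambda>Y. (position k0 (L, Y) (V $ 1) \<bullet> X') / norm X' ^ 3) has_derivative
      (\<lambda>h. (shiftY k0 C V h \<bullet> X') / norm X' ^ 3)) (at Y)"
    unfolding divide_inverse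
    by (rule has_derivative_mult_left[OF has_derivative_inner_left[OF X]])
  from has_derivative_mult_right[OF has_derivative_diff[OF 1 2], of "\<mu> * k0\<^sup>2"]
  have "((\<lambda>Y. perturbing_function k0 \<mu> ((L, Y), E') V) has_derivative
      (\<lambda>h. \<mu> * k0\<^sup>2 * (- (Delta k0 C V \<bullet> shiftY k0 C V h) / norm (Delta k0 C V) ^ 3
        - (shiftY k0 C V h \<bullet> X') / norm X' ^ 3))) (at Y)"
    by (simp add: perturbing_function_def Let_def X'_def)
  from inner_grad[OF this, of w] show ?thesis
    by (simp add: grad_Y_R_def C_eq forcing_def X'_def algebra_simps)
qed

lemma continuous_on_forcing:
  assumes C: "C \<in> regular" and k0: "0 < k0" and nz: "\<And>V. V \<in> S \<Longrightarrow> Delta k0 C V \<noteq> 0"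
  shows "continuous_on S (forcing k0 C w)"
proof -
  have "position k0 (snd C) l \<noteq> 0" for l
    using C k0 position_nonzero by (simp add: regular_iff)
  then show ?thesis
    unfolding forcing_def using nz C
    by (intro continuous_on_add continuous_on_divide continuous_on_inner continuous_on_power
        continuous_on_norm continuous_on_shiftY[where c = "\<lambda>_. C" and w = "\<lambda>_. w"]
        continuous_on_vel[where c = "\<lambda>_. C"] continuous_on_const continuous_on_id) auto
qed

lemma fderiv_position_add_2pi:
  assumes "E \<in> delaunay_domain"
  shows "fderiv (pos k0) (E, l + 2 * pi) (v, 0) = fderiv (pos k0) (E, l) (v, 0)"
proof -
  have D: "((\<lambda>E. position k0 E l) has_derivative (\<lambda>v. fderiv (pos k0) (E, l) (v, 0))) (at E)" for l
  proof -
    have "((\<lambda>E. (E, l)) has_derivative (\<lambda>v. (v, 0))) (at E)" by (auto intro!: derivative_eq_intros)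
    from has_derivative_compose[OF this C1_on_has_derivative[OF C1_on_position]] show ?thesis
      using assms by simp
  qed
  have "((\<lambda>E. position k0 E (l + 2 * pi)) has_derivative (\<lambda>v. fderiv (pos k0) (E, l) (v, 0))) (at E)"
    by (rule has_derivative_transform_within_open[OF D open_delaunay_domain assms])
       (simp add: position_add_2pi)
  from has_derivative_unique[OF this D] show ?thesis by (metis (no_types))
qed

lemma periodic2_Delta: "C \<in> regular \<Longrightarrow> periodic2 (Delta k0 C)"
  by (simp add: periodic2_def Delta_def regular_iff position_add_2pi)

lemma periodic2_forcing: "C \<in> regular \<Longrightarrow> periodic2 (forcing k0 C w)"
  using periodic2_Delta[of C k0]
  by (simp add: periodic2_def forcing_def shiftY_def regular_iff position_add_2pi fderiv_position_add_2pi)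

text \<open>The averaged gradient in a direction \<open>w\<close>, over a fundamental domain centred at any \<open>V\<close>.\<close>

lemma inner_averaged_grad_Y_R:
  assumes C: "C \<in> regular" and k0: "0 < k0" and nz: "\<And>V. Delta k0 C V \<noteq> 0"
  shows "w \<bullet> averaged_grad_Y_R k0 \<mu> C = - (\<mu> * k0\<^sup>2 / (2 * pi)\<^sup>2) *
    integral {- pi..pi} (\<lambda>x. integral {- pi..pi} (\<lambda>y. forcing k0 C w (V + vec2 x y)))"
proof -
  have comp: "grad_Y_R k0 \<mu> C V = (\<chi> i. - (\<mu> * k0\<^sup>2) * forcing k0 C (axis i 1) V)" for V
    using inner_grad_Y_R[OF C nz, of "axis _ 1" \<mu> V] by (simp add: vec_eq_iff inner_axis')
  have "continuous_on UNIV (grad_Y_R k0 \<mu> C)"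
    unfolding comp[abs_def] using C k0 nz
    by (intro continuous_on_vec_lambda continuous_on_mult continuous_on_const
        continuous_on_forcing) auto
  then have "grad_Y_R k0 \<mu> C integrable_on torus" by (rule integral_torus(1))
  from integral_linear[OF this bounded_linear_inner_right[of w]]
  have "w \<bullet> integral torus (grad_Y_R k0 \<mu> C) = integral torus (\<lambda>V. w \<bullet> grad_Y_R k0 \<mu> C V)"
    by (simp add: o_def)
  also have "\<dots> = - (\<mu> * k0\<^sup>2) * integral torus (forcing k0 C w)"
    unfolding inner_grad_Y_R[OF C nz] by (rule integral_mult_right)
  also have "integral torus (forcing k0 C w)
      = integral {- pi..pi} (\<lambda>x. integral {- pi..pi} (\<lambda>y. forcing k0 C w (V + vec2 x y)))"
    by (intro integral_torus_centered continuous_on_forcing periodic2_forcing C k0 nz)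
  finally show ?thesis by (simp add: averaged_grad_Y_R_def)
qed

lemma integral_box_add:
  fixes f g :: "real ^ 2 \<Rightarrow> real"
  assumes f: "continuous_on UNIV f" and g: "continuous_on UNIV g"
  shows "integral {- pi..pi} (\<lambda>x. integral {- pi..pi} (\<lambda>y. f (V + vec2 x y) + g (V + vec2 x y))) =
    integral {- pi..pi} (\<lambda>x. integral {- pi..pi} (\<lambda>y. f (V + vec2 x y))) +
    integral {- pi..pi} (\<lambda>x. integral {- pi..pi} (\<lambda>y. g (V + vec2 x y)))"
proof -
  have inner: "(\<lambda>y. h (V + vec2 x y)) integrable_on {- pi..pi}"
    and outer: "(\<lambda>x. integral {- pi..pi} (\<lambda>y. h (V + vec2 x y))) integrable_on {- pi..pi}"
    if h: "continuous_on UNIV h" for h :: "real ^ 2 \<Rightarrow> real" and x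
  proof -
    show "(\<lambda>y. h (V + vec2 x y)) integrable_on {- pi..pi}"
      by (intro integrable_continuous_real continuous_on_compose2[OF h]) (auto intro!: continuous_intros)
    have "continuous_on ({- pi..pi} \<times> cbox (- pi) pi) (\<lambda>(x, y). h (V + vec2 x y))"
      unfolding case_prod_unfold
      by (rule continuous_on_compose2[OF h]) (auto intro!: continuous_intros)
    from integral_continuous_on_param[OF this]
    show "(\<lambda>x. integral {- pi..pi} (\<lambda>y. h (V + vec2 x y))) integrable_on {- pi..pi}"
      by (intro integrable_continuous_real) simp
  qed
  show ?thesis
    using inner[OF f] inner[OF g] outer[OF f] outer[OF g] by (simp add: integral_add)
qed

subsection \<open>The direction tangent to the level set\<close>

text \<open>
  At \<open>V = V\<^sub>h\<close>, the gradient of the signed distance with respect to \<open>Y\<close>, and its image under the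
  transpose of the symplectic matrix; the latter is orthogonal to the former.
\<close>

definition grad_d :: "real \<Rightarrow> config \<Rightarrow> real ^ 2 \<Rightarrow> real ^ 4" where
  "grad_d k0 C V = (\<chi> i. sgn (tau3 k0 C V) \<bullet> shiftY k0 C V (axis i 1))"

definition tangent_dir :: "real \<Rightarrow> config \<Rightarrow> real ^ 2 \<Rightarrow> real ^ 4" where
  "tangent_dir k0 C V = vector [grad_d k0 C V $ 3, grad_d k0 C V $ 4, - grad_d k0 C V $ 1, - grad_d k0 C V $ 2]"

lemma inner_shiftY:
  assumes "C \<in> regular"
  shows "sgn (tau3 k0 C V) \<bullet> shiftY k0 C V w = grad_d k0 C V \<bullet> w"
proof -
  note l = linear_shiftY[OF assms, of k0 V]
  have "shiftY k0 C V w = shiftY k0 C V (\<Sum>i\<in>UNIV. (w $ i) *\<^sub>R axis i 1)"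
    using basis_expansion[of w] by (simp add: scalar_mult_eq_scaleR)
  then have "sgn (tau3 k0 C V) \<bullet> shiftY k0 C V w = (\<Sum>i\<in>UNIV. w $ i * grad_d k0 C V $ i)"
    by (simp add: linear_sum[OF l] linear_scale[OF l] inner_sum_right grad_d_def)
  also have "\<dots> = grad_d k0 C V \<bullet> w"
    by (simp add: inner_vec_def mult.commute)
  finally show ?thesis .
qed

lemma grad_d_inner_J2: "grad_d k0 C V \<bullet> (J2 *v x) = tangent_dir k0 C V \<bullet> x"
proof -
  have "J2 *v x = vector [- x $ 3, - x $ 4, x $ 1, x $ 2]"
    by (simp add: vec_eq_iff forall_4 matrix_vector_mult_def sum_4 J2_def)
  then show ?thesis by (simp add: tangent_dir_def inner_vec_def sum_4)
qed

lemma grad_d_tangent_dir: "grad_d k0 C V \<bullet> tangent_dir k0 C V = 0"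
  by (simp add: tangent_dir_def inner_vec_def sum_4)

text \<open>
  The derivative of \<open>\<Delta>\<close> in that direction is orthogonal to \<open>\<tau>\<^sub>3\<close>, hence lies in the plane of the two
  tangent vectors. Its coordinates with respect to \<open>\<partial>\<Delta>/\<partial>\<ell>\<close> and \<open>\<partial>\<Delta>/\<partial>\<ell>'\<close> are the following; the
  sign in the second one is due to \<open>\<partial>\<Delta>/\<partial>\<ell>' = - \<partial>X'/\<partial>\<ell>'\<close>.
\<close>

definition tangent_coord :: "real \<Rightarrow> config \<Rightarrow> real ^ 2 \<Rightarrow> real ^ 2" where
  "tangent_coord k0 C V = (let w = shiftY k0 C V (tangent_dir k0 C V); t = tau3 k0 C V in
     vec2 ((cross3 w (vel2 k0 C V) \<bullet> t) / (t \<bullet> t)) (- (cross3 (vel1 k0 C V) w \<bullet> t) / (t \<bullet> t)))"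

lemma cross3_expansion:
  fixes a b w :: "real ^ 3"
  assumes "w \<bullet> cross3 a b = 0"
  shows "(cross3 a b \<bullet> cross3 a b) *\<^sub>R w =
    (cross3 w b \<bullet> cross3 a b) *\<^sub>R a + (cross3 a w \<bullet> cross3 a b) *\<^sub>R b"
proof -
  have "(cross3 a b \<bullet> cross3 a b) *\<^sub>R w =
    (cross3 w b \<bullet> cross3 a b) *\<^sub>R a + (cross3 a w \<bullet> cross3 a b) *\<^sub>R b + (w \<bullet> cross3 a b) *\<^sub>R cross3 a b"
    unfolding vec_eq_iff forall_3
    by (simp add: cross_components inner_vec_def sum_3, intro conjI; algebra)
  then show ?thesis using assms by simp
qed

lemma tmap_tangent_coord:
  assumes C: "C \<in> regular" and t: "tau3 k0 C V \<noteq> 0"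
  shows "tmap k0 C V (tangent_coord k0 C V) = shiftY k0 C V (tangent_dir k0 C V)"
proof -
  let ?w = "shiftY k0 C V (tangent_dir k0 C V)" and ?t = "tau3 k0 C V"
  have tt: "?t \<bullet> ?t \<noteq> 0" using t by simp
  have "sgn ?t \<bullet> ?w = 0"
    using inner_shiftY[OF C] grad_d_tangent_dir by simp
  then have "?w \<bullet> ?t = 0" using t by (simp add: sgn_div_norm inner_commute)
  then have e: "(?t \<bullet> ?t) *\<^sub>R ?w = (cross3 ?w (vel2 k0 C V) \<bullet> ?t) *\<^sub>R vel1 k0 C V
      + (cross3 (vel1 k0 C V) ?w \<bullet> ?t) *\<^sub>R vel2 k0 C V"
    unfolding tau3_eq[OF C] by (rule cross3_expansion)
  have "(?t \<bullet> ?t) *\<^sub>R tmap k0 C V (tangent_coord k0 C V) = (?t \<bullet> ?t) *\<^sub>R ?w"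
    unfolding e tmap_def tangent_coord_def Let_def using tt by (simp add: algebra_simps)
  then show ?thesis using tt by simp
qed

text \<open>
  The derivative of \<open>\<Delta>\<close> at \<open>V\<close> in the direction \<open>tangent_dir\<close> taken at \<open>V0\<close>, minus the combination
  of the tangent vectors at \<open>V\<close> with the coordinates taken at \<open>V0\<close>: it vanishes at \<open>V = V0\<close>. In the
  integrand \<open>kappa\<close> it replaces the full derivative in the singular term of \<open>forcing\<close>.
\<close>

definition residual :: "real \<Rightarrow> config \<Rightarrow> real ^ 2 \<Rightarrow> real ^ 2 \<Rightarrow> real ^ 3" where
  "residual k0 C V0 V = shiftY k0 C V (tangent_dir k0 C V0) - tmap k0 C V (tangent_coord k0 C V0)"

definition kappa :: "real \<Rightarrow> config \<Rightarrow> real ^ 2 \<Rightarrow> real ^ 2 \<Rightarrow> real" where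
  "kappa k0 C V0 V = (Delta k0 C V \<bullet> residual k0 C V0 V) / norm (Delta k0 C V) ^ 3
     + (shiftY k0 C V (tangent_dir k0 C V0) \<bullet> position k0 (snd C) (V $ 2))
        / norm (position k0 (snd C) (V $ 2)) ^ 3"

text \<open>
  Replacing the integrand by \<open>kappa\<close> changes it by a derivative of \<open>1/d\<close> along the torus, so the
  integral stays the same.
\<close>

lemma tangent_inner_averaged_grad:
  assumes C: "C \<in> regular" and k0: "0 < k0" and nz: "\<And>V. Delta k0 C V \<noteq> 0"
  shows "tangent_dir k0 C V0 \<bullet> averaged_grad_Y_R k0 \<mu> C = - (\<mu> * k0\<^sup>2 / (2 * pi)\<^sup>2) *
    integral {- pi..pi} (\<lambda>x. integral {- pi..pi} (\<lambda>y. kappa k0 C V0 (V0 + vec2 x y)))"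
proof -
  let ?w = "tangent_dir k0 C V0" and ?c = "tangent_coord k0 C V0"
  let ?\<phi> = "\<lambda>V. 1 / norm (Delta k0 C V)"
  let ?d = "\<lambda>V u. - (Delta k0 C V \<bullet> tmap k0 C V u) / norm (Delta k0 C V) ^ 3"
  have D: "(?\<phi> has_derivative ?d V) (at V)" for V
    by (rule has_derivative_inverse_norm[OF Delta_has_derivative[OF C] nz])
  have cont: "continuous_on UNIV (\<lambda>V. ?d V u)" for u
    unfolding tmap_def using nz C
    by (intro continuous_on_divide continuous_on_minus continuous_on_inner continuous_on_diff
        continuous_on_scaleR continuous_on_power continuous_on_norm
        continuous_on_vel[where c = "\<lambda>_. C"] continuous_on_const continuous_on_id) auto
  have C1: "C1_on ?\<phi> UNIV" by (rule C1_onI[OF D cont])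
  have per: "periodic2 ?\<phi>" using periodic2_Delta[OF C, of k0] by (simp add: periodic2_def)
  have split: "kappa k0 C V0 V = forcing k0 C ?w V + fderiv ?\<phi> V ?c" for V
    unfolding fderiv_eqI[OF D]
    by (simp add: kappa_def forcing_def residual_def inner_diff_right diff_divide_distrib)
  have "integral {- pi..pi} (\<lambda>x. integral {- pi..pi} (\<lambda>y. kappa k0 C V0 (V0 + vec2 x y)))
    = integral {- pi..pi} (\<lambda>x. integral {- pi..pi} (\<lambda>y. forcing k0 C ?w (V0 + vec2 x y)))
     + integral {- pi..pi} (\<lambda>x. integral {- pi..pi} (\<lambda>y. fderiv ?\<phi> (V0 + vec2 x y) ?c))"
    unfolding split
    by (intro integral_box_add continuous_on_forcing C k0 nz)
       (use cont fderiv_eqI[OF D] in simp)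
  also have "\<dots> = integral {- pi..pi} (\<lambda>x. integral {- pi..pi} (\<lambda>y. forcing k0 C ?w (V0 + vec2 x y)))"
    using integral_periodic_derivative[OF C1 per] by simp
  finally show ?thesis
    using inner_averaged_grad_Y_R[OF C k0 nz] by simp
qed

lemma continuous_on_tangent:
  assumes "S \<subseteq> regular" "continuous_on S Vh" "\<And>C. C \<in> S \<Longrightarrow> tau3 k0 C (Vh C) \<noteq> 0"
  shows "continuous_on S (\<lambda>C. tangent_dir k0 C (Vh C))" "continuous_on S (\<lambda>C. tangent_coord k0 C (Vh C))"
    "continuous_on S (\<lambda>C. grad_d k0 C (Vh C))"
proof -
  have id: "continuous_on S (\<lambda>C. C)" "(\<lambda>C. C) ` S \<subseteq> regular" using assms(1) by auto
  note v = continuous_on_vel[OF id(1) assms(2) id(2)]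
  show g: "continuous_on S (\<lambda>C. grad_d k0 C (Vh C))"
    unfolding grad_d_def
    by (intro continuous_on_vec_lambda continuous_on_inner continuous_on_sgn v
        continuous_on_shiftY[OF id(1) assms(2) continuous_on_const id(2)]) (use assms(3) in auto)
  have "continuous_on S (\<lambda>C. \<chi> i. tangent_dir k0 C (Vh C) $ i)"
  proof (rule continuous_on_vec_lambda)
    have "\<forall>i. continuous_on S (\<lambda>C. tangent_dir k0 C (Vh C) $ i)"
      unfolding forall_4 tangent_dir_def using g by (auto intro!: continuous_intros)
    then show "continuous_on S (\<lambda>C. tangent_dir k0 C (Vh C) $ i)" for i by blast
  qed
  then show t: "continuous_on S (\<lambda>C. tangent_dir k0 C (Vh C))" by simp
  note w = continuous_on_shiftY[OF id(1) assms(2) t id(2)]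
  show "continuous_on S (\<lambda>C. tangent_coord k0 C (Vh C))"
    unfolding tangent_coord_def Let_def
    by (intro continuous_on_vec2 continuous_on_divide continuous_on_minus continuous_on_inner
        continuous_on_cross v w) (use assms(3) in auto)
qed

lemma continuous_on_kappa:
  fixes c :: "'s::t2_space \<Rightarrow> config"
  assumes S: "S \<subseteq> regular" "continuous_on S Vh" "\<And>C. C \<in> S \<Longrightarrow> tau3 k0 C (Vh C) \<noteq> 0" and k0: "0 < k0"
    and T: "continuous_on T c" "continuous_on T u" "c ` T \<subseteq> S"
    and nz: "\<And>s. s \<in> T \<Longrightarrow> Delta k0 (c s) (Vh (c s) + u s) \<noteq> 0"
  shows "continuous_on T (\<lambda>s. kappa k0 (c s) (Vh (c s)) (Vh (c s) + u s))"
proof -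
  have reg: "c ` T \<subseteq> regular" using S(1) T(3) by blast
  have V: "continuous_on T (\<lambda>s. Vh (c s) + u s)"
    using T by (intro continuous_on_add continuous_on_compose2[OF S(2) T(1)]) auto
  note v = continuous_on_vel[OF T(1) V reg]
  note t = continuous_on_compose2[OF continuous_on_tangent(1)[OF S(1-3)] T(1,3)]
    continuous_on_compose2[OF continuous_on_tangent(2)[OF S(1-3)] T(1,3)]
  note w = continuous_on_shiftY[OF T(1) V t(1) reg]
  have "continuous_on T (\<lambda>s. residual k0 (c s) (Vh (c s)) (Vh (c s) + u s))"
    unfolding residual_def tmap_def
    by (intro continuous_on_diff continuous_on_scaleR w v continuous_on_component t)
  moreover have "position k0 (snd (c s)) l \<noteq> 0" if "s \<in> T" for s l
    using position_nonzero[of "snd (c s)" k0 l] k0 that reg by (auto simp: regular_iff)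
  ultimately show ?thesis
    unfolding kappa_def using nz
    by (intro continuous_on_add continuous_on_divide continuous_on_inner continuous_on_power
        continuous_on_norm v w) auto
qed


subsection \<open>The singularity of the reduced integrand\<close>

lemma has_vector_derivative_norm_le:
  fixes g :: "real \<Rightarrow> 'a::real_normed_vector"
  assumes g: "(g has_vector_derivative A) (at t)"
    and bound: "\<forall>\<^sub>F h in at 0. norm (g (t + h) - g t) \<le> B * \<bar>h\<bar>"
  shows "norm A \<le> B"
proof -
  have "((\<lambda>h. norm (g (t + h) - g t - h *\<^sub>R A) / norm h) \<longlongrightarrow> 0) (at 0)"
    using g by (simp add: has_vector_derivative_def has_derivative_at)
  moreover have "\<forall>\<^sub>F h in at 0. norm A - B \<le> norm (g (t + h) - g t - h *\<^sub>R A) / norm h"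
    using bound eventually_neq_at_within[of 0]
  proof eventually_elim
    case (elim h)
    have "norm (h *\<^sub>R A) \<le> norm (g (t + h) - g t) + norm (g (t + h) - g t - h *\<^sub>R A)"
      using norm_triangle_ineq4[of "g (t + h) - g t" "g (t + h) - g t - h *\<^sub>R A"] by simp
    then have "(norm A - B) * \<bar>h\<bar> \<le> norm (g (t + h) - g t - h *\<^sub>R A)"
      using elim(1) by (simp add: algebra_simps)
    then show ?case using elim(2) by (simp add: pos_le_divide_eq)
  qed
  ultimately have "norm A - B \<le> 0"
    by (intro tendsto_lowerbound) auto
  then show ?thesis by simp
qed

text \<open>
  Since the velocity is locally Lipschitz in the elements, the derivative of the position with
  respect to the elements is locally Lipschitz in the mean anomaly: the increment of the position
  under a change of the elements has, as a function of the mean anomaly, a derivative bounded by a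
  constant times that change.
\<close>

lemma fderiv_position_lipschitz:
  assumes E0: "E0 \<in> delaunay_domain"
  obtains \<delta> K where "0 < \<delta>" "0 < K"
    "\<And>E l l' v. E \<in> ball E0 \<delta> \<Longrightarrow> l \<in> ball l0 \<delta> \<Longrightarrow> l' \<in> ball l0 \<delta> \<Longrightarrow>
       norm (fderiv (pos k0) (E, l') (v, 0) - fderiv (pos k0) (E, l) (v, 0)) \<le> K * norm v * \<bar>l' - l\<bar>"
proof -
  have mem: "(E0, l0) \<in> kepler_domain" using E0 by simp
  obtain d K where d: "0 < d" "0 < K" "ball (E0, l0) d \<subseteq> kepler_domain"
    "\<And>x y. x \<in> ball (E0, l0) d \<Longrightarrow> y \<in> ball (E0, l0) d \<Longrightarrow>
       norm (velocity k0 y - velocity k0 x) \<le> K * norm (y - x)"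
    by (rule C1_on_locally_lipschitz[OF C1_on_velocity[of k0] open_kepler_domain mem]) blast
  have dom: "E \<in> delaunay_domain" if "E \<in> ball E0 (d / 2)" for E
  proof -
    have "(E, l0) \<in> ball (E0, l0) d" using that d(1) by (intro pair_in_ball) auto
    then show ?thesis using d(3) by auto
  qed
  have "norm (fderiv (pos k0) (E, l') (v, 0) - fderiv (pos k0) (E, l) (v, 0)) \<le> K * norm v * \<bar>l' - l\<bar>"
    if E: "E \<in> ball E0 (d / 2)" and l: "l \<in> ball l0 (d / 2)" and l': "l' \<in> ball l0 (d / 2)" for E l l' v
  proof (rule has_vector_derivative_norm_le)
    let ?g = "\<lambda>s. position k0 (E + s *\<^sub>R v) l' - position k0 (E + s *\<^sub>R v) l"
    have D: "((\<lambda>s. position k0 (E + s *\<^sub>R v) m) has_vector_derivative fderiv (pos k0) (E, m) (v, 0)) (at 0)" for m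
    proof -
      have P: "(pos k0 has_derivative fderiv (pos k0) (E, m)) (at (E, m))"
        using dom[OF E] by (intro C1_on_has_derivative[OF C1_on_position]) simp
      have "((\<lambda>s. (E + s *\<^sub>R v, m)) has_derivative (\<lambda>s. (s *\<^sub>R v, 0))) (at 0)"
        by (auto intro!: derivative_eq_intros)
      from has_derivative_compose[OF this, of "pos k0" "fderiv (pos k0) (E, m)"] P
      have "((\<lambda>s. position k0 (E + s *\<^sub>R v) m) has_derivative (\<lambda>s. fderiv (pos k0) (E, m) (s *\<^sub>R v, 0))) (at 0)"
        by simp
      moreover have "fderiv (pos k0) (E, m) (s *\<^sub>R v, 0) = s *\<^sub>R fderiv (pos k0) (E, m) (v, 0)" for s
        using linear_scale[OF has_derivative_linear[OF P], of s "(v, 0)"] by simp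
      ultimately show ?thesis by (simp add: has_vector_derivative_def)
    qed
    show "(?g has_vector_derivative fderiv (pos k0) (E, l') (v, 0) - fderiv (pos k0) (E, l) (v, 0)) (at 0)"
      by (rule has_vector_derivative_diff[OF D D])
    have "((\<lambda>s. E + s *\<^sub>R v) \<longlongrightarrow> E + 0 *\<^sub>R v) (at 0)" by (intro tendsto_intros)
    then have "\<forall>\<^sub>F s in at 0. E + s *\<^sub>R v \<in> ball E0 (d / 2)"
      using E by (intro topological_tendstoD[of _ E]) auto
    then show "\<forall>\<^sub>F s in at 0. norm (?g (0 + s) - ?g 0) \<le> K * norm v * \<bar>l' - l\<bar> * \<bar>s\<bar>"
    proof eventually_elim
      case (elim s)
      let ?m = "\<lambda>m. position k0 (E + s *\<^sub>R v) m - position k0 E m"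
      have "norm (?m l' - ?m l) \<le> K * norm (s *\<^sub>R v) * norm (l' - l)"
      proof (rule differentiable_bound[where S = "ball l0 (d / 2)"])
        show "(?m has_derivative (\<lambda>h. h *\<^sub>R (velocity k0 (E + s *\<^sub>R v, m) - velocity k0 (E, m))))
            (at m within ball l0 (d / 2))" for m
          using has_vector_derivative_diff[OF position_has_vector_derivative[OF dom[OF elim], of k0 m]
              position_has_vector_derivative[OF dom[OF E], of k0 m]]
          unfolding has_vector_derivative_def by (rule has_derivative_at_withinI)
        show "onorm (\<lambda>h. h *\<^sub>R (velocity k0 (E + s *\<^sub>R v, m) - velocity k0 (E, m))) \<le> K * norm (s *\<^sub>R v)"
          if m: "m \<in> ball l0 (d / 2)" for m
        proof (rule onorm_le)
          fix h :: real
          have "norm (velocity k0 (E + s *\<^sub>R v, m) - velocity k0 (E, m)) \<le> K * norm (s *\<^sub>R v)"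
            using d(4)[OF pair_in_ball[OF E m] pair_in_ball[OF elim m]] by (simp add: norm_Pair)
          then show "norm (h *\<^sub>R (velocity k0 (E + s *\<^sub>R v, m) - velocity k0 (E, m)))
              \<le> K * norm (s *\<^sub>R v) * norm h"
            by (simp add: mult.commute[of _ "\<bar>h\<bar>"] mult_left_mono)
        qed
      qed (use l l' in auto)
      then show ?case by (simp add: algebra_simps)
    qed
  qed
  then show thesis using that[of "d / 2" K] d by simp
qed

lemma continuous_on_compact_bound:
  fixes f :: "'a::topological_space \<Rightarrow> 'b::real_normed_vector"
  assumes "compact S" "continuous_on S f"
  obtains M where "0 < M" "\<And>x. x \<in> S \<Longrightarrow> norm (f x) \<le> M"
  using compact_imp_bounded[OF compact_continuous_image[OF assms(2,1)]]
  unfolding bounded_pos by auto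

lemma norm_combination_le:
  fixes s x y :: "'a::real_normed_vector"
  assumes "norm s \<le> S" "\<bar>a\<bar> \<le> M" "\<bar>b\<bar> \<le> M" "norm x \<le> X" "norm y \<le> Y"
  shows "norm (s - (a *\<^sub>R x - b *\<^sub>R y)) \<le> S + (M * X + M * Y)"
proof -
  have "\<bar>a\<bar> * norm x \<le> M * X" "\<bar>b\<bar> * norm y \<le> M * Y"
    using assms by (intro mult_mono order_trans[OF abs_ge_zero] norm_ge_zero; simp)+
  then have "norm (a *\<^sub>R x - b *\<^sub>R y) \<le> M * X + M * Y"
    using norm_triangle_ineq4[of "a *\<^sub>R x" "b *\<^sub>R y"] by simp
  then show ?thesis
    using norm_triangle_ineq4[of s "a *\<^sub>R x - b *\<^sub>R y"] assms(1) by linarith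
qed

text \<open>The residual is \<open>O(|V - V\<^sub>h|)\<close> near \<open>V\<^sub>h\<close>, uniformly for configurations near \<open>Cc\<close>.\<close>

lemma residual_bound:
  assumes Cc: "Cc \<in> regular" and B: "compact B" "B \<subseteq> regular" and Vh: "continuous_on B Vh" 
    and V_lim: "isCont Vh Cc"
    and \<tau>: "\<And>C. C \<in> B \<Longrightarrow> tau3 k0 C (Vh C) \<noteq> 0"
  obtains d K where "0 < d" "0 < K"
    "\<And>C u. C \<in> B \<Longrightarrow> C \<in> ball Cc d \<Longrightarrow> norm u < d \<Longrightarrow>
       norm (residual k0 C (Vh C) (Vh C + u)) \<le> K * norm u"
proof -
  let ?V = "Vh Cc"
  have mem: "(Cc, ?V) \<in> config_domain" using Cc by simp
  have Cc1: "fst Cc \<in> delaunay_domain" using Cc by (simp add: regular_iff)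
  obtain d1 K1 where 1: "0 < d1" "0 < K1"
    "\<And>E l l' v. E \<in> ball (fst Cc) d1 \<Longrightarrow> l \<in> ball (?V $ 1) d1 \<Longrightarrow> l' \<in> ball (?V $ 1) d1 \<Longrightarrow>
       norm (fderiv (pos k0) (E, l') (v, 0) - fderiv (pos k0) (E, l) (v, 0)) \<le> K1 * norm v * \<bar>l' - l\<bar>"
    by (rule fderiv_position_lipschitz[OF Cc1, of "?V $ 1" k0]) blast
  obtain d2 K2 where 2: "0 < d2" "0 < K2"
    "\<And>x y. x \<in> ball (Cc, ?V) d2 \<Longrightarrow> y \<in> ball (Cc, ?V) d2 \<Longrightarrow>
       norm (vel1 k0 (fst y) (snd y) - vel1 k0 (fst x) (snd x)) \<le> K2 * norm (y - x)"
    by (rule C1_on_locally_lipschitz[OF C1_on_vel1[of k0] open_config_domain mem]) blast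
  obtain d3 K3 where 3: "0 < d3" "0 < K3"
    "\<And>x y. x \<in> ball (Cc, ?V) d3 \<Longrightarrow> y \<in> ball (Cc, ?V) d3 \<Longrightarrow>
       norm (vel2 k0 (fst y) (snd y) - vel2 k0 (fst x) (snd x)) \<le> K3 * norm (y - x)"
    by (rule C1_on_locally_lipschitz[OF C1_on_vel2[of k0] open_config_domain mem]) blast
  obtain M1 where M1: "0 < M1" "\<And>C. C \<in> B \<Longrightarrow> norm (tangent_dir k0 C (Vh C)) \<le> M1"
    by (rule continuous_on_compact_bound[OF B(1) continuous_on_tangent(1)[OF B(2) Vh \<tau>]]) blast+
  obtain M2 where M2: "0 < M2" "\<And>C. C \<in> B \<Longrightarrow> norm (tangent_coord k0 C (Vh C)) \<le> M2"
    by (rule continuous_on_compact_bound[OF B(1) continuous_on_tangent(2)[OF B(2) Vh \<tau>]]) blast+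
  define e where "e = min d1 (min (d2 / 2) (d3 / 2))"
  have e: "0 < e" "e \<le> d1" "e \<le> d2 / 2" "e \<le> d3 / 2" using 1(1) 2(1) 3(1) by (auto simp: e_def)
  obtain d0 where d0: "0 < d0" "\<And>C. dist C Cc < d0 \<Longrightarrow> dist (Vh C) ?V < e / 2"
    using V_lim half_gt_zero[OF e(1)] unfolding continuous_at_eps_delta by blast
  define d where "d = min d0 (e / 2)"
  have d: "0 < d" "d \<le> d0" "d \<le> e / 2" using d0(1) e(1) by (auto simp: d_def)
  have "norm (residual k0 C (Vh C) (Vh C + u)) \<le> (K1 * M1 + M2 * (K2 + K3)) * norm u"
    if CB: "C \<in> B" and C: "C \<in> ball Cc d" and u: "norm u < d" for C u
  proof -
    let ?Va = "Vh C" and ?Vb = "Vh C + u"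
    let ?w = "tangent_dir k0 C ?Va" and ?c = "tangent_coord k0 C ?Va"
    have reg: "C \<in> regular" using B(2) CB by blast
    have V0: "?Va \<in> ball ?V e" and V1: "?Vb \<in> ball ?V e"
    proof -
      have a: "dist ?V ?Va < e / 2" using d0(2)[of C] C d(2) e(1) by (simp add: dist_commute)
      then show "?Va \<in> ball ?V e" using e(1) by simp
      have "dist ?V ?Vb \<le> dist ?V ?Va + norm u"
        using dist_triangle[of ?V ?Vb ?Va] by (simp add: dist_norm)
      then show "?Vb \<in> ball ?V e" using a u d(3) by simp
    qed
    have V_comp: "W $ 1 \<in> ball (?V $ 1) d1" if "W \<in> ball ?V e" for W
      using that e(2) dist_vec_nth_le[of ?V 1 W] by simp
    have E: "fst C \<in> ball (fst Cc) d1"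
      using C d(3) e(1,2) dist_fst_le[of Cc C] by simp
    have m2: "(C, ?Va) \<in> ball (Cc, ?V) d2" "(C, ?Vb) \<in> ball (Cc, ?V) d2"
      and m3: "(C, ?Va) \<in> ball (Cc, ?V) d3" "(C, ?Vb) \<in> ball (Cc, ?V) d3"
      using C V0 V1 d(3) e by (intro pair_in_ball; simp)+
    have "norm (shiftY k0 C ?Vb ?w - shiftY k0 C ?Va ?w) \<le> K1 * norm ((0 :: real), ?w) * \<bar>?Vb $ 1 - ?Va $ 1\<bar>"
      unfolding shiftY_def by (rule 1(3)[OF E V_comp[OF V0] V_comp[OF V1]])
    also have "\<dots> \<le> K1 * M1 * norm u"
      using M1(1) M1(2)[OF CB] 1(2) component_le_norm_cart[of u 1]
      by (intro mult_mono) (auto simp: norm_Pair)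
    finally have s: "norm (shiftY k0 C ?Vb ?w - shiftY k0 C ?Va ?w) \<le> K1 * M1 * norm u" .
    have c: "\<bar>?c $ i\<bar> \<le> M2" for i
      using component_le_norm_cart[of ?c i] M2(2)[OF CB] by linarith
    have v1: "norm (vel1 k0 C ?Vb - vel1 k0 C ?Va) \<le> K2 * norm u"
      using 2(3)[OF m2] by (simp add: norm_Pair)
    have v2: "norm (vel2 k0 C ?Vb - vel2 k0 C ?Va) \<le> K3 * norm u"
      using 3(3)[OF m3] by (simp add: norm_Pair)
    have "residual k0 C ?Va ?Va = 0"
      using tmap_tangent_coord[OF reg \<tau>[OF CB]] by (simp add: residual_def)
    then have "residual k0 C ?Va ?Vb = residual k0 C ?Va ?Vb - residual k0 C ?Va ?Va" by simp
    also have "\<dots> = (shiftY k0 C ?Vb ?w - shiftY k0 C ?Va ?w)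
        - (?c $ 1 *\<^sub>R (vel1 k0 C ?Vb - vel1 k0 C ?Va) - ?c $ 2 *\<^sub>R (vel2 k0 C ?Vb - vel2 k0 C ?Va))"
      by (simp add: residual_def tmap_def algebra_simps)
    also have "norm \<dots> \<le> K1 * M1 * norm u + (M2 * (K2 * norm u) + M2 * (K3 * norm u))"
      by (rule norm_combination_le[OF s c c v1 v2])
    finally show ?thesis by (simp add: distrib_left distrib_right mult.assoc)
  qed
  moreover have "0 < K1 * M1 + M2 * (K2 + K3)" using 1(2) 2(2) 3(2) M1(1) M2(1) by (simp add: add_pos_pos)
  ultimately show thesis using that d(1) by blast
qed

text \<open>
  Near \<open>V\<^sub>h\<close> the singular term is at most \<open>|residual| / d\<^sup>2 \<le> K |u| / (c |u|)\<^sup>2\<close>; everything else is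
  bounded by compactness.
\<close>

lemma kappa_bound:
  assumes B: "0 < \<delta>" "cball Cc \<delta> \<subseteq> regular" and Vh: "continuous_on (cball Cc \<delta>) Vh"
    and \<tau>: "\<And>C. C \<in> cball Cc \<delta> \<Longrightarrow> tau3 k0 C (Vh C) \<noteq> 0" and k0: "0 < k0"
    and near: "0 < \<rho>" "0 < c"
      "\<And>C u. C \<in> cball Cc \<delta> \<Longrightarrow> norm u < \<rho> \<Longrightarrow> c * norm u \<le> norm (Delta k0 C (Vh C + u))"
    and nz: "\<And>C u. C \<in> cball Cc \<delta> \<Longrightarrow> \<bar>u $ 1\<bar> \<le> pi \<Longrightarrow> \<bar>u $ 2\<bar> \<le> pi \<Longrightarrow> u \<noteq> 0 \<Longrightarrow>
       Delta k0 C (Vh C + u) \<noteq> 0"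
  obtains d M where "0 < d" "d \<le> \<delta>" "0 \<le> M"
    "\<And>C u. C \<in> cball Cc d \<Longrightarrow> \<bar>u $ 1\<bar> \<le> pi \<Longrightarrow> \<bar>u $ 2\<bar> \<le> pi \<Longrightarrow> u \<noteq> 0 \<Longrightarrow>
       \<bar>kappa k0 C (Vh C) (Vh C + u)\<bar> \<le> M / norm u"
proof -
  let ?B = "cball Cc \<delta>"
  have Cc: "Cc \<in> ?B" using B(1) by simp
  have Ccr: "Cc \<in> regular" using B(2) Cc by blast
  have lim: "isCont Vh Cc"
    using B(1) by (intro continuous_on_interior[OF Vh]) simp
  obtain d K where K: "0 < d" "0 < K"
    "\<And>C u. C \<in> ?B \<Longrightarrow> C \<in> ball Cc d \<Longrightarrow> norm u < d \<Longrightarrow>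
       norm (residual k0 C (Vh C) (Vh C + u)) \<le> K * norm u"
    by (rule residual_bound[OF Ccr compact_cball B(2) Vh lim \<tau>]) blast+
  define r where "r = min d \<rho>"
  have r: "0 < r" "r \<le> d" "r \<le> \<rho>" using K(1) near(1) by (auto simp: r_def)
  define box where "box = cbox (vec2 (- pi) (- pi)) (vec2 pi pi)"
  have box: "u \<in> box \<longleftrightarrow> \<bar>u $ 1\<bar> \<le> pi \<and> \<bar>u $ 2\<bar> \<le> pi" for u
    by (auto simp: box_def mem_box_cart forall_2)
  have box_norm: "norm u \<le> 2 * pi" if "u \<in> box" for u
    using norm_le_l1_cart[of u] that by (simp add: box sum_2)
  let ?far = "box \<inter> {u. r \<le> norm u}"
  have "compact ?far"
    unfolding box_def by (intro compact_Int_closed compact_cbox closed_Collect_le continuous_intros)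
  then have comp: "compact (?B \<times> ?far)" by (intro compact_Times compact_cball)
  have cont: "continuous_on (?B \<times> ?far) (\<lambda>p. kappa k0 (fst p) (Vh (fst p)) (Vh (fst p) + snd p))"
  proof (rule continuous_on_kappa[OF B(2) Vh \<tau> k0])
    show "Delta k0 (fst s) (Vh (fst s) + snd s) \<noteq> 0" if "s \<in> ?B \<times> ?far" for s
    proof -
      have s: "fst s \<in> ?B" "snd s \<in> box" "r \<le> norm (snd s)" using that by auto
      then have "snd s \<noteq> 0" using r(1) by auto
      then show ?thesis using nz[OF s(1), of "snd s"] s(2) by (simp add: box)
    qed
  qed (auto intro!: continuous_intros)
  obtain M1 where M1: "0 < M1"
    "\<And>p. p \<in> ?B \<times> ?far \<Longrightarrow> norm (kappa k0 (fst p) (Vh (fst p)) (Vh (fst p) + snd p)) \<le> M1"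
    by (rule continuous_on_compact_bound[OF comp cont]) blast
  let ?ind = "\<lambda>C u. (shiftY k0 C (Vh C + u) (tangent_dir k0 C (Vh C))
      \<bullet> position k0 (snd C) ((Vh C + u) $ 2)) / norm (position k0 (snd C) ((Vh C + u) $ 2)) ^ 3"
  have cont2: "continuous_on (?B \<times> box) (\<lambda>p. ?ind (fst p) (snd p))"
  proof -
    have f: "continuous_on (?B \<times> box) fst" and s: "continuous_on (?B \<times> box) snd"
      and im: "fst ` (?B \<times> box) \<subseteq> ?B" by (auto intro!: continuous_intros)
    have V: "continuous_on (?B \<times> box) (\<lambda>p. Vh (fst p) + snd p)"
      by (intro continuous_on_add continuous_on_compose2[OF Vh f im] s)
    have reg: "fst ` (?B \<times> box) \<subseteq> regular" using im B(2) by blast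
    have "position k0 (snd (fst p)) l \<noteq> 0" if "p \<in> ?B \<times> box" for p l
    proof -
      have "fst p \<in> regular" using that B(2) by auto
      then show ?thesis using position_nonzero k0 by (simp add: regular_iff)
    qed
    then show ?thesis
      by (intro continuous_on_divide continuous_on_inner continuous_on_power continuous_on_norm
          continuous_on_shiftY[OF f V _ reg] continuous_on_vel(5)[OF f V reg]
          continuous_on_compose2[OF continuous_on_tangent(1)[OF B(2) Vh \<tau>] f im]) auto
  qed
  have comp2: "compact (?B \<times> box)"
    unfolding box_def by (intro compact_Times compact_cball compact_cbox)
  obtain M2 where M2: "0 < M2"
    "\<And>p. p \<in> ?B \<times> box \<Longrightarrow> norm (?ind (fst p) (snd p)) \<le> M2"
    by (rule continuous_on_compact_bound[OF comp2 cont2]) blast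
  define M where "M = K / c\<^sup>2 + 2 * pi * M2 + 2 * pi * M1"
  have M: "0 \<le> M" using K(2) M1(1) M2(1) by (simp add: M_def)
  have scale: "m \<le> 2 * pi * m / norm u" if "u \<in> box" "u \<noteq> 0" "0 < m" for u and m :: real
    using box_norm[OF that(1)] that by (simp add: pos_le_divide_eq mult.commute mult_left_mono)
  show thesis
  proof (rule that[of "min (d / 2) \<delta>" M])
    fix C and u :: "real ^ 2"
    assume C: "C \<in> cball Cc (min (d / 2) \<delta>)" and u: "\<bar>u $ 1\<bar> \<le> pi" "\<bar>u $ 2\<bar> \<le> pi" "u \<noteq> 0"
    have CB: "C \<in> ?B" "C \<in> ball Cc d" using C K(1) by auto
    have ub: "u \<in> box" using u by (simp add: box)
    have nu: "0 < norm u" using u by simp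
    show "\<bar>kappa k0 C (Vh C) (Vh C + u)\<bar> \<le> M / norm u"
    proof (cases "norm u < r")
      case True
      let ?D = "Delta k0 C (Vh C + u)" and ?R = "residual k0 C (Vh C) (Vh C + u)"
      have D: "c * norm u \<le> norm ?D" using near(3)[OF CB(1)] True r by auto
      have cu: "0 < c * norm u" using near(2) nu by simp
      have Dpos: "0 < norm ?D" using D cu by linarith
      have R: "norm ?R \<le> K * norm u" using K(3)[OF CB] True r by auto
      have "\<bar>(?D \<bullet> ?R) / norm ?D ^ 3\<bar> \<le> (norm ?D * norm ?R) / norm ?D ^ 3"
        using Cauchy_Schwarz_ineq2[of ?D ?R] Dpos by (simp add: divide_right_mono)
      also have "\<dots> = norm ?R / (norm ?D)\<^sup>2"
        using Dpos by (simp add: power3_eq_cube power2_eq_square)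
      also have "\<dots> \<le> (K * norm u) / (c * norm u)\<^sup>2"
        using R D cu K(2) nu by (intro frac_le power_mono) auto
      also have "\<dots> = K / c\<^sup>2 / norm u"
        using nu near(2) by (simp add: power2_eq_square)
      finally have "\<bar>(?D \<bullet> ?R) / norm ?D ^ 3\<bar> \<le> K / c\<^sup>2 / norm u" .
      moreover have "\<bar>?ind C u\<bar> \<le> 2 * pi * M2 / norm u"
        using M2(2)[of "(C, u)"] CB(1) ub scale[OF ub u(3) M2(1)] by auto
      moreover have "\<bar>kappa k0 C (Vh C) (Vh C + u)\<bar> \<le> \<bar>(?D \<bullet> ?R) / norm ?D ^ 3\<bar> + \<bar>?ind C u\<bar>"
        unfolding kappa_def by (rule abs_triangle_ineq)
      moreover have "0 \<le> 2 * pi * M1 / norm u" using M1(1) nu by simp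
      ultimately show ?thesis unfolding M_def add_divide_distrib by linarith
    next
      case False
      then have "\<bar>kappa k0 C (Vh C) (Vh C + u)\<bar> \<le> 2 * pi * M1 / norm u"
        using M1(2)[of "(C, u)"] CB(1) ub scale[OF ub u(3) M1(1)] by auto
      moreover have "0 \<le> K / c\<^sup>2 / norm u" "0 \<le> 2 * pi * M2 / norm u" using K(2) M2(1) nu by simp_all
      ultimately show ?thesis unfolding M_def add_divide_distrib by linarith
    qed
  qed (use K(1) B(1) M in simp_all)
qed


section \<open>The signed distance along a generalized solution\<close>

text \<open>A zero of the distance is one of the local minimum points over which \<open>d_min\<close> is taken.\<close>

lemma noncrossing_Delta:
  assumes "d_min k0 C \<noteq> 0"
  shows "Delta k0 C V \<noteq> 0"
proof
  let ?A = "local_min_points (orbit_dist2 k0 C)"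
  assume "Delta k0 C V = 0"
  then have zero: "orbit_dist k0 C V = 0" by (simp add: orbit_dist_def)
  then have "orbit_dist2 k0 C V \<le> orbit_dist2 k0 C W" for W
    by (simp add: orbit_dist2_def)
  then have V: "V \<in> ?A"
    unfolding local_min_points_def by (intro CollectI always_eventually allI)
  have "bdd_below (orbit_dist k0 C ` ?A)"
    by (rule bdd_belowI2[of _ 0]) (simp add: orbit_dist_def)
  then have "d_min k0 C \<le> orbit_dist k0 C V"
    unfolding d_min_def using V by (rule cINF_lower)
  moreover have "?A \<noteq> {}" using V by blast
  then have "0 \<le> d_min k0 C"
    unfolding d_min_def by (rule cINF_greatest) (simp add: orbit_dist_def)
  ultimately show False using assms zero by linarith
qed

lemma has_vector_derivative_removable:
  fixes f g :: "real \<Rightarrow> real"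
  assumes x: "a < x" "x < b" and f: "continuous_on {a<..<b} f" and g: "continuous_on {a<..<b} g"
    and d: "\<And>t. t \<in> {a<..<b} - {x} \<Longrightarrow> (f has_vector_derivative g t) (at t)"
  shows "(f has_vector_derivative g x) (at x)"
proof -
  obtain a' where a': "a < a'" "a' < x" using dense[OF x(1)] by blast
  obtain b' where b': "x < b'" "b' < b" using dense[OF x(2)] by blast
  note ab = a' b'
  have sub: "{a'..b'} \<subseteq> {a<..<b}" using ab by auto
  have eq: "integral {a'..t} g = f t - f a'" if t: "t \<in> {a'..b'}" for t
  proof (rule integral_unique, rule fundamental_theorem_of_calculus_interior_strong[of "{x}"])
    have "{a'..t} \<subseteq> {a<..<b}" using sub t by auto
    then show "continuous_on {a'..t} f" by (rule continuous_on_subset[OF f])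
    show "(f has_vector_derivative g y) (at y)" if "y \<in> {a'<..<t} - {x}" for y
    proof (rule d)
      show "y \<in> {a<..<b} - {x}" using that t ab by simp
    qed
    show "a' \<le> t" using t by simp
  qed simp
  have "((\<lambda>t. integral {a'..t} g) has_vector_derivative g x) (at x within {a'..b'})"
  proof (rule integral_has_vector_derivative)
    show "continuous_on {a'..b'} g" using g sub by (rule continuous_on_subset)
    show "x \<in> {a'..b'}" using ab by simp
  qed
  then have "((\<lambda>t. f t - f a') has_vector_derivative g x) (at x within {a'..b'})"
  proof (rule has_vector_derivative_transform[rotated 2])
    show "x \<in> {a'..b'}" using ab by simp
    show "f t - f a' = integral {a'..t} g" if "t \<in> {a'..b'}" for t
      by (rule eq[OF that, symmetric])
  qed
  then have "((\<lambda>t. f t - f a') has_vector_derivative g x) (at x)"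
    unfolding at_within_Icc_at[OF ab(2,3)] .
  from has_vector_derivative_add[OF this has_vector_derivative_const[of "f a'"]]
  show ?thesis by (simp only: diff_add_cancel add_0_right)
qed

lemma classical_solution_at:
  assumes sol: "generalized_solution k0 \<mu> a E' I Y"
    and S: "open S" "connected S" "S \<subseteq> I - crossing_times k0 a E' I Y" "t \<in> S"
  shows "(Y has_vector_derivative - (J2 *v averaged_grad_Y_R k0 \<mu> (config_at k0 a E' Y t))) (at t)"
proof -
  let ?R = "I - crossing_times k0 a E' I Y"
  let ?J = "connected_component_set ?R t"
  have "t \<in> ?R" using S(3,4) by blast
  then have "?J \<in> components ?R" by (rule componentsI)
  then have "classical_solution k0 \<mu> a E' ?J Y"
    using sol by (simp add: generalized_solution_def)
  moreover have sub: "S \<subseteq> ?J" by (rule connected_component_maximal[OF S(4,2,3)])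
  ultimately have "(Y has_vector_derivative - (J2 *v averaged_grad_Y_R k0 \<mu> (config_at k0 a E' Y t)))
      (at t within ?J)"
    using S(4) unfolding classical_solution_def by blast
  then show ?thesis
    using at_within_open_subset[OF S(4,1) sub] by simp
qed

theorem proposition4:
  fixes k0 \<mu> a t0 tc :: real
    and E' :: "real \<Rightarrow> elements"
    and Y0 :: "real ^ 4"
    and I :: "real set"
    and Y :: "real \<Rightarrow> real ^ 4"
    and U :: "config set"
    and Vh :: "config \<Rightarrow> real ^ 2"
  assumes "k0 > 0" and "\<mu> > 0" and "a > 0"
    and "E' C1_differentiable_on I"
    and "generalized_cauchy_solution k0 \<mu> a E' t0 Y0 I Y"
    and "tc \<in> crossing_times k0 a E' I Y"
    and "nondegenerate k0 (config_at k0 a E' Y tc)"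
    and "crossing k0 (config_at k0 a E' Y tc)"
    and "only_one_crossing_point k0 (config_at k0 a E' Y tc)"
    and "min_point_continuation k0 U Vh"
    and "config_at k0 a E' Y tc \<in> U"
    and "orbit_dist k0 (config_at k0 a E' Y tc) (Vh (config_at k0 a E' Y tc)) = 0"
  shows "\<exists>ta tb. ta < tc \<and> tc < tb \<and> {ta<..<tb} \<subseteq> I \<and>
           (\<forall>t\<in>{ta<..<tb}. config_at k0 a E' Y t \<in> U \<and>
              tau3 k0 (config_at k0 a E' Y t) (Vh (config_at k0 a E' Y t)) \<noteq> 0) \<and>
           (\<lambda>t. signed_dist k0 Vh (config_at k0 a E' Y t)) C1_differentiable_on {ta<..<tb}"
proof -
  let ?c = "config_at k0 a E' Y" and ?T = "crossing_times k0 a E' I Y"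
  let ?Cc = "?c tc"
  have sol: "generalized_solution k0 \<mu> a E' I Y"
    using assms(5) by (simp add: generalized_cauchy_solution_def)
  then have I: "open I" "is_interval I" "continuous_on I Y" "discrete ?T"
    by (simp_all add: generalized_solution_def)
  have tcI: "tc \<in> I" using assms(6) by (simp add: crossing_times_def)
  obtain D where D: "\<And>t. t \<in> I \<Longrightarrow> (E' has_vector_derivative D t) (at t)" "continuous_on I D"
    using assms(4) unfolding C1_differentiable_on_def by blast
  have "continuous_on I E'"
    using D(1) has_vector_derivative_continuous continuous_at_imp_continuous_on by blast
  then have c_cont: "continuous_on I ?c"
    unfolding config_at_def using I(3) by (intro continuous_intros)
  have U: "U \<subseteq> regular" "continuous_on U Vh"
    using assms(10) by (simp_all add: min_point_continuation_def)
  have Ccr: "?Cc \<in> regular" using U assms(11) by blast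
  have zero: "Delta k0 ?Cc (Vh ?Cc) = 0" using assms(12) by (simp add: orbit_dist_def)
  have \<tau>c: "tau3 k0 ?Cc (Vh ?Cc) \<noteq> 0"
    by (rule nondegenerate_crossing_imp_tau3[OF Ccr assms(7) zero])
  obtain \<delta> \<rho> c where N: "0 < \<delta>" "0 < \<rho>" "0 < c" "cball ?Cc \<delta> \<subseteq> U"
    "\<And>C. C \<in> cball ?Cc \<delta> \<Longrightarrow> critical_point k0 C (Vh C) \<and> tau3 k0 C (Vh C) \<noteq> 0"
    "\<And>C C'. C \<in> cball ?Cc \<delta> \<Longrightarrow> C' \<in> cball ?Cc \<delta> \<Longrightarrow>
       orbit_dist2 k0 C (Vh C) \<le> orbit_dist2 k0 C (Vh C')"
    "\<And>C u. C \<in> cball ?Cc \<delta> \<Longrightarrow> norm u < \<rho> \<Longrightarrow> c * norm u \<le> norm (Delta k0 C (Vh C + u))"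
    "\<And>C u. C \<in> cball ?Cc \<delta> \<Longrightarrow> \<bar>u $ 1\<bar> \<le> pi \<Longrightarrow> \<bar>u $ 2\<bar> \<le> pi \<Longrightarrow> u \<noteq> 0 \<Longrightarrow>
       Delta k0 C (Vh C + u) \<noteq> 0"
    by (rule neighbourhood_of_crossing[OF assms(10,11) zero \<tau>c assms(9)]) (rule that)
  have reg: "cball ?Cc \<delta> \<subseteq> regular" and Vh: "continuous_on (cball ?Cc \<delta>) Vh"
    using N(4) U continuous_on_subset by blast+
  obtain d M where M: "0 < d" "d \<le> \<delta>" "0 \<le> M"
    "\<And>C u. C \<in> cball ?Cc d \<Longrightarrow> \<bar>u $ 1\<bar> \<le> pi \<Longrightarrow> \<bar>u $ 2\<bar> \<le> pi \<Longrightarrow> u \<noteq> 0 \<Longrightarrow>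
       \<bar>kappa k0 C (Vh C) (Vh C + u)\<bar> \<le> M / norm u"
    by (rule kappa_bound[OF N(1) reg Vh conjunct2[OF N(5)] assms(1) N(2,3,7,8)], assumption+, rule that)
  define B where "B = cball ?Cc d"
  have B_sub: "B \<subseteq> cball ?Cc \<delta>" using M(2) by (auto simp: B_def)
  have B: "B \<subseteq> regular" "continuous_on B Vh" "\<And>C. C \<in> B \<Longrightarrow> tau3 k0 C (Vh C) \<noteq> 0"
    using B_sub reg N(5) continuous_on_subset[OF Vh] by blast+
  define \<Phi> where "\<Phi> C = integral {- pi..pi} (\<lambda>x. integral {- pi..pi}
      (\<lambda>y. kappa k0 C (Vh C) (Vh C + vec2 x y)))" for C
  have vec2_nz: "vec2 x y \<noteq> 0" if "(x, y) \<noteq> (0, 0)" for x y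
    using that by (auto simp: vec_eq_iff forall_2)
  have \<Phi>_cont: "continuous_on B \<Phi>"
    unfolding \<Phi>_def
  proof (rule continuous_on_integral_weak_singularity[where M = M])
    show "continuous_on (B \<times> ({- pi..pi} \<times> {- pi..pi} - {(0, 0)}))
        (\<lambda>(C, x, y). kappa k0 C (Vh C) (Vh C + vec2 x y))"
      unfolding case_prod_unfold
    proof (rule continuous_on_kappa[OF B assms(1)])
      show "Delta k0 (fst s) (Vh (fst s) + vec2 (fst (snd s)) (snd (snd s))) \<noteq> 0"
        if s: "s \<in> B \<times> ({- pi..pi} \<times> {- pi..pi} - {(0, 0)})" for s
      proof -
        have "(fst (snd s), snd (snd s)) \<noteq> (0, 0)" "\<bar>fst (snd s)\<bar> \<le> pi" "\<bar>snd (snd s)\<bar> \<le> pi"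
          "fst s \<in> cball ?Cc \<delta>"
          using s B_sub by auto
        then show ?thesis by (intro N(8) vec2_nz) simp_all
      qed
    qed (auto intro!: continuous_intros)
    show "\<bar>kappa k0 C (Vh C) (Vh C + vec2 x y)\<bar> \<le> M / norm (vec2 x y)"
      if "C \<in> B" "\<bar>x\<bar> \<le> pi" "\<bar>y\<bar> \<le> pi" "(x, y) \<noteq> (0, 0)" for C x y
      using that M(4)[of C "vec2 x y"] vec2_nz by (simp add: B_def)
  qed (use M in auto)
  have "isCont ?c tc" using c_cont I(1) tcI continuous_on_eq_continuous_at by blast
  then obtain e1 where e1: "0 < e1" "\<And>t. dist t tc < e1 \<Longrightarrow> dist (?c t) ?Cc < d"
    unfolding continuous_at_eps_delta using M(1) by blast
  obtain e2 where e2: "0 < e2" "ball tc e2 \<subseteq> I" using I(1) tcI openE by blast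
  \<comment> \<open>Crossing times are isolated, so near \<open>tc\<close> the solution is classical except at \<open>tc\<close>.\<close>
  obtain W where W: "open W" "W \<inter> ?T = {tc}"
    using I(4) assms(6) unfolding discrete_def isolated_in_def by blast
  then obtain e3 where e3: "0 < e3" "ball tc e3 \<subseteq> W" using openE by blast
  define \<epsilon> where "\<epsilon> = min e1 (min e2 e3)"
  have \<epsilon>: "0 < \<epsilon>" "\<epsilon> \<le> e1" "\<epsilon> \<le> e2" "\<epsilon> \<le> e3" using e1 e2 e3 by (auto simp: \<epsilon>_def)
  let ?J = "{tc - \<epsilon><..<tc + \<epsilon>}"
  have J: "?J = ball tc \<epsilon>" by (simp add: ball_eq_greaterThanLessThan)
  have "?J \<subseteq> W" using e3(2) \<epsilon>(4) unfolding J by auto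
  then have J_sub: "?J \<subseteq> I" "?J \<inter> ?T \<subseteq> {tc}" "\<And>t. t \<in> ?J \<Longrightarrow> ?c t \<in> ball ?Cc d"
    using e1(2) e2 \<epsilon> W(2) unfolding J by (auto simp: dist_commute)
  have J_B: "?c ` ?J \<subseteq> B" using J_sub(3) by (force simp: B_def)
  have cJ: "continuous_on ?J ?c" using c_cont J_sub(1) continuous_on_subset by blast
  \<comment> \<open>The candidate derivative: the asteroid enters through \<open>\<Phi>\<close>, which is continuous at crossings too.\<close>
  define \<Psi> where "\<Psi> t = \<mu> * k0\<^sup>2 / (2 * pi)\<^sup>2 * \<Phi> (?c t) - sgn (tau3 k0 (?c t) (Vh (?c t))) \<bullet>
      fderiv (pos k0) (snd (?c t), Vh (?c t) $ 2) (D t, 0)" for t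
  have \<Psi>_cont: "continuous_on ?J \<Psi>"
  proof -
    have V: "continuous_on ?J (\<lambda>t. Vh (?c t))" by (rule continuous_on_compose2[OF B(2) cJ J_B])
    have \<tau>: "continuous_on ?J (\<lambda>t. tau3 k0 (?c t) (Vh (?c t)))"
      by (rule continuous_on_vel(4)[OF cJ V]) (use J_B B in blast)
    have "continuous_on ?J (\<lambda>t. fderiv (pos k0) (snd (?c t), Vh (?c t) $ 2) (D t, 0))"
    proof (rule continuous_on_fderiv[OF C1_on_position])
      show "continuous_on ?J (\<lambda>t. (snd (?c t), Vh (?c t) $ 2))" using cJ V by (intro continuous_intros)
      show "continuous_on ?J (\<lambda>t. (D t, 0))"
        using continuous_on_subset[OF D(2) J_sub(1)] by (intro continuous_intros)
      show "(\<lambda>t. (snd (?c t), Vh (?c t) $ 2)) ` ?J \<subseteq> kepler_domain"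
      proof (rule image_subsetI)
        fix t assume "t \<in> ?J"
        then have "?c t \<in> regular" using J_B B(1) by blast
        then show "(snd (?c t), Vh (?c t) $ 2) \<in> kepler_domain" by (simp add: regular_iff)
      qed
    qed
    then show ?thesis
      unfolding \<Psi>_def
      by (intro continuous_on_diff continuous_on_mult continuous_on_const continuous_on_inner
          continuous_on_sgn \<tau> continuous_on_compose2[OF \<Phi>_cont cJ J_B]) (use J_B B(3) in blast)
  qed
  let ?s = "\<lambda>t. signed_dist k0 Vh (?c t)"
  have s_cont: "continuous_on ?J ?s"
    by (rule continuous_on_compose2[OF continuous_on_signed_dist[OF B] cJ J_B])
  have s_deriv: "(?s has_vector_derivative \<Psi> t) (at t)" if t: "t \<in> ?J - {tc}" for t
  proof -
    let ?C = "?c t" and ?n = "sgn (tau3 k0 (?c t) (Vh (?c t)))"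
    let ?g = "averaged_grad_Y_R k0 \<mu> ?C"
    let ?Y' = "- (J2 *v ?g)"
    have tI: "t \<in> I" and tT: "t \<notin> ?T" using t J_sub by auto
    have CB: "?C \<in> ball ?Cc d" using J_sub(3) t by blast
    have Cr: "?C \<in> regular" using B(1) J_B t by blast
    have nz: "Delta k0 ?C V \<noteq> 0" for V
      by (rule noncrossing_Delta) (use tI tT in \<open>simp add: crossing_times_def\<close>)
    have sub: "A \<subseteq> I - ?T" if "A \<subseteq> ?J" "tc \<notin> A" for A
      using that J_sub(1,2) by blast
    have Y': "(Y has_vector_derivative ?Y') (at t)"
    proof (cases "t < tc")
      case True
      show ?thesis
        by (rule classical_solution_at[OF sol _ _ sub, of "{tc - \<epsilon><..<tc}"]) (use True t \<epsilon>(1) in auto)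
    next
      case False
      show ?thesis
        by (rule classical_solution_at[OF sol _ _ sub, of "{tc<..<tc + \<epsilon>}"]) (use False t \<epsilon>(1) in auto)
    qed
    have "(?c has_vector_derivative ((0, y), D t)) (at t)"
      if "(Y has_vector_derivative y) (at t)" for y
      unfolding config_at_def
      by (intro has_vector_derivative_Pair has_vector_derivative_const that D(1)[OF tI])
    note c' = this[OF Y']
    let ?L = "\<lambda>h. ?n \<bullet> fderiv (Delta2 k0) (?C, Vh ?C) (h, 0)"
    have ball_sub: "ball ?Cc d \<subseteq> cball ?Cc \<delta>" using M(2) by auto
    have L: "(signed_dist k0 Vh has_derivative ?L) (at ?C)"
    proof (rule signed_dist_has_derivative[where S = "ball ?Cc d"])
      show "ball ?Cc d \<subseteq> regular" using ball_sub reg by blast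
      show "continuous_on (ball ?Cc d) Vh" using continuous_on_subset[OF Vh ball_sub] .
      show "critical_point k0 C (Vh C)" "tau3 k0 C (Vh C) \<noteq> 0" if "C \<in> ball ?Cc d" for C
        using N(5)[OF subsetD[OF ball_sub that]] by blast+
      show "orbit_dist2 k0 x (Vh x) \<le> orbit_dist2 k0 x (Vh y)"
        if "x \<in> ball ?Cc d" "y \<in> ball ?Cc d" for x y
        by (rule N(6)[OF subsetD[OF ball_sub that(1)] subsetD[OF ball_sub that(2)]])
    qed (fact CB nz open_ball)+
    have "(?s has_derivative (\<lambda>h. ?L (h *\<^sub>R ((0, ?Y'), D t)))) (at t)"
      using has_derivative_compose[OF c'[unfolded has_vector_derivative_def] L] .
    then have "(?s has_vector_derivative ?L ((0, ?Y'), D t)) (at t)"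
      unfolding has_vector_derivative_def linear_scale[OF has_derivative_linear[OF L]] .
    moreover have "?L ((0, ?Y'), D t) = \<Psi> t"
    proof -
      have "?L ((0, ?Y'), D t) = ?n \<bullet> shiftY k0 ?C (Vh ?C) ?Y'
          - ?n \<bullet> fderiv (pos k0) (snd ?C, Vh ?C $ 2) (D t, 0)"
        by (simp add: fderiv_Delta2_elements[OF Cr] shiftY_def inner_diff_right)
      moreover have "?n \<bullet> shiftY k0 ?C (Vh ?C) ?Y' = - (tangent_dir k0 ?C (Vh ?C) \<bullet> ?g)"
        unfolding inner_shiftY[OF Cr] by (simp add: grad_d_inner_J2)
      moreover have "tangent_dir k0 ?C (Vh ?C) \<bullet> ?g = - (\<mu> * k0\<^sup>2 / (2 * pi)\<^sup>2) * \<Phi> ?C"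
        unfolding \<Phi>_def by (rule tangent_inner_averaged_grad[OF Cr assms(1) nz])
      ultimately show ?thesis by (simp add: \<Psi>_def)
    qed
    ultimately show ?thesis by simp
  qed
  have "(?s has_vector_derivative \<Psi> t) (at t)" if "t \<in> ?J" for t
  proof (cases "t = tc")
    case True
    show ?thesis
      unfolding True by (rule has_vector_derivative_removable[OF _ _ s_cont \<Psi>_cont s_deriv]) (use \<epsilon>(1) in simp_all)
  next
    case False
    then show ?thesis using s_deriv that by blast
  qed
  then have "?s C1_differentiable_on ?J"
    unfolding C1_differentiable_on_def using \<Psi>_cont by blast
  moreover have "?c t \<in> U \<and> tau3 k0 (?c t) (Vh (?c t)) \<noteq> 0" if "t \<in> ?J" for t
    using J_B B(3) B_sub N(4) that by blast
  ultimately show ?thesis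
    using \<epsilon>(1) J_sub(1) by (intro exI[of _ "tc - \<epsilon>"] exI[of _ "tc + \<epsilon>"]) simp
qed

end
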